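(* Let $n\ge 1$ be an integer and let $\mathscr{H}_n$ be the $(2n+1)$-dimensional discrete Heisenberg group. Then $$\mathrm{Crit}_{[0,1]}(\mathscr{H}_n)=1+\frac1n.$$
   Context: The $(2n+1)$-dimensional discrete Heisenberg group is the group, under matrix multiplication, of $(n+2)\times(n+2)$ matrices $$\mathscr{H}_n=\left\{\begin{pmatrix}1&\vec{x}&c\\ \vec{0}^{\,t}&I_n&\vec{y}^{\,t}\\ 0&\vec{0}&1\end{pmatrix} : \vec{x},\vec{y}\in\mathbb{Z}^n,\ c\in\mathbb{Z}\right\},$$ where $I_n$ is the $n\times n$ identity matrix, $\vec x,\vec y,\vec 0$ are row vectors of length $n$, and $t$ denotes transpose. For an integer $m\ge 0$ and a real $\alpha\in[0,1)$, $\mathrm{Diff}_+^{m+\alpha}([0,1])$ denotes the group of all orientation preserving $C^m$-diffeomorphisms of $[0,1]$ whose $m$-th derivative is $\alpha$-H\"older continuous (for $m=0,\alpha=0$: the orientation preserving homeomorphisms of $[0,1]$). The critical regularity of a group $G$ on $[0,1]$ is $$\mathrm{Crit}_{[0,1]}(G)=\sup\{m+\alpha \mid m\ge 0,\ \alpha\in[0,1),\ G \text{ embeds into } \mathrm{Diff}_+^{m+\alpha}([0,1])\},$$ with $\mathrm{Crit}_{[0,1]}(G)=-\infty$ if $G$ does not embed into $\mathrm{Diff}_+^{0}([0,1])$. *)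

theory Defs
  imports "HOL-Analysis.Analysis" "HOL-Algebra.Bij" "Jordan_Normal_Form.Matrix"
begin

section \<open>The discrete Heisenberg groups\<close>

text \<open>
  Rows and columns are numbered from \<open>0\<close> to \<open>n + 1\<close>. The vectors of the first row and of the last
  column are \<open>(x 1, \<dots>, x n)\<close> and \<open>(y 1, \<dots>, y n)\<close>; other values of \<open>x\<close> and \<open>y\<close> do not occur.
\<close>

definition heisenberg_mat :: "nat \<Rightarrow> (nat \<Rightarrow> int) \<Rightarrow> (nat \<Rightarrow> int) \<Rightarrow> int \<Rightarrow> int mat" where
  "heisenberg_mat n x y c = Matrix.mat (n + 2) (n + 2) (\<lambda>(i, j).
     if i = j then 1
     else if i = 0 then (if j = n + 1 then c else x j)
     else if j = n + 1 then y i
     else 0)"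

definition heisenberg_group :: "nat \<Rightarrow> int mat monoid" where
  "heisenberg_group n =
     \<lparr>carrier = {heisenberg_mat n x y c | x y c. True}, mult = (*), one = 1\<^sub>m (n + 2)\<rparr>"

lemma heisenberg_mat_mult:
  "heisenberg_mat n x y c * heisenberg_mat n x' y' c' =
   heisenberg_mat n (\<lambda>i. x i + x' i) (\<lambda>i. y i + y' i) (c + c' + (\<Sum>i=1..n. x i * y' i))"
  (is "?L = ?R")
proof (rule eq_matI)
  fix i j assume "i < dim_row ?R" "j < dim_col ?R"
  then have ij: "i < n + 2" "j < n + 2" by (auto simp: heisenberg_mat_def)
  let ?f = "\<lambda>k. (heisenberg_mat n x y c $$ (i, k)) * (heisenberg_mat n x' y' c' $$ (k, j))"
  have "{0..<n + 2} = insert 0 (insert (n + 1) {1..n})" by auto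
  then have S: "sum ?f {0..<n + 2} = ?f 0 + ?f (n + 1) + sum ?f {1..n}" by simp
  have L: "?L $$ (i, j) = sum ?f {0..<n + 2}"
    using ij by (simp add: heisenberg_mat_def scalar_prod_def)
  consider "i = 0" "j = 0" | "i = 0" "j = n + 1" | "i = 0" "1 \<le> j" "j \<le> n"
    | "i = n + 1" | "1 \<le> i" "i \<le> n" "j = n + 1" | "1 \<le> i" "i \<le> n" "j \<le> n"
    using ij by linarith
  then show "?L $$ (i, j) = ?R $$ (i, j)"
  proof cases
    case 1
    then have "sum ?f {1..n} = 0" by (intro sum.neutral) (auto simp: heisenberg_mat_def)
    with 1 show ?thesis unfolding L S by (simp add: heisenberg_mat_def)
  next
    case 2
    then have "sum ?f {1..n} = (\<Sum>i=1..n. x i * y' i)"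
      by (intro sum.cong) (auto simp: heisenberg_mat_def)
    with 2 show ?thesis unfolding L S by (simp add: heisenberg_mat_def)
  next
    case 3
    then have "sum ?f {1..n} = sum (\<lambda>k. if k = j then x j else 0) {1..n}"
      by (intro sum.cong) (auto simp: heisenberg_mat_def)
    with 3 show ?thesis unfolding L S by (simp add: heisenberg_mat_def)
  next
    case 4
    then have "sum ?f {1..n} = 0" by (intro sum.neutral) (auto simp: heisenberg_mat_def)
    with 4 ij show ?thesis unfolding L S by (simp add: heisenberg_mat_def)
  next
    case 5
    then have "sum ?f {1..n} = sum (\<lambda>k. if k = i then y' i else 0) {1..n}"
      by (intro sum.cong) (auto simp: heisenberg_mat_def)
    with 5 show ?thesis unfolding L S by (simp add: heisenberg_mat_def)
  next
    case 6
    then have "sum ?f {1..n} = sum (\<lambda>k. if k = i then (if i = j then 1 else 0) else 0) {1..n}"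
      by (intro sum.cong) (auto simp: heisenberg_mat_def)
    with 6 show ?thesis unfolding L S by (simp add: heisenberg_mat_def)
  qed
qed (auto simp: heisenberg_mat_def)

lemma heisenberg_mat_0: "heisenberg_mat n (\<lambda>_. 0) (\<lambda>_. 0) 0 = 1\<^sub>m (n + 2)"
  by (rule eq_matI) (auto simp: heisenberg_mat_def)

lemma group_heisenberg_group: "group (heisenberg_group n)"
proof (rule groupI)
  show "\<one>\<^bsub>heisenberg_group n\<^esub> \<in> carrier (heisenberg_group n)"
    unfolding heisenberg_group_def using heisenberg_mat_0[of n] by (auto intro: sym)
next
  fix A B assume "A \<in> carrier (heisenberg_group n)" "B \<in> carrier (heisenberg_group n)"
  then show "A \<otimes>\<^bsub>heisenberg_group n\<^esub> B \<in> carrier (heisenberg_group n)"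
    unfolding heisenberg_group_def using heisenberg_mat_mult by fastforce
next
  fix A B C assume "A \<in> carrier (heisenberg_group n)" "B \<in> carrier (heisenberg_group n)"
    "C \<in> carrier (heisenberg_group n)"
  then show "A \<otimes>\<^bsub>heisenberg_group n\<^esub> B \<otimes>\<^bsub>heisenberg_group n\<^esub> C =
      A \<otimes>\<^bsub>heisenberg_group n\<^esub> (B \<otimes>\<^bsub>heisenberg_group n\<^esub> C)"
    by (auto simp: heisenberg_group_def heisenberg_mat_mult algebra_simps sum.distrib)
next
  fix A assume A: "A \<in> carrier (heisenberg_group n)"
  then show "\<one>\<^bsub>heisenberg_group n\<^esub> \<otimes>\<^bsub>heisenberg_group n\<^esub> A = A"
    by (auto simp: heisenberg_group_def heisenberg_mat_def)
  from A obtain x y c where A: "A = heisenberg_mat n x y c"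
    by (auto simp: heisenberg_group_def)
  let ?B = "heisenberg_mat n (\<lambda>i. - x i) (\<lambda>i. - y i) (- c + (\<Sum>i=1..n. x i * y i))"
  have "?B * A = 1\<^sub>m (n + 2)"
    unfolding A heisenberg_mat_mult heisenberg_mat_0[symmetric] by (simp add: sum_negf)
  then show "\<exists>B\<in>carrier (heisenberg_group n).
      B \<otimes>\<^bsub>heisenberg_group n\<^esub> A = \<one>\<^bsub>heisenberg_group n\<^esub>"
    by (auto simp: heisenberg_group_def)
qed


section \<open>Diffeomorphisms of the unit interval\<close>

text \<open>Derivatives at the endpoints are one-sided.\<close>

definition deriv01 :: "nat \<Rightarrow> (real \<Rightarrow> real) \<Rightarrow> real \<Rightarrow> real" where
  "deriv01 k f = ((\<lambda>g x. vector_derivative g (at x within {0..1})) ^^ k) f"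

definition C01 :: "nat \<Rightarrow> (real \<Rightarrow> real) \<Rightarrow> bool" where
  "C01 m f \<longleftrightarrow>
     (\<forall>k<m. deriv01 k f differentiable_on {0..1}) \<and> continuous_on {0..1} (deriv01 m f)"

text \<open>For \<open>\<alpha> = 0\<close> this is boundedness, so it adds nothing to continuity on \<open>{0..1}\<close>.\<close>

definition hoelder_on :: "real \<Rightarrow> real set \<Rightarrow> (real \<Rightarrow> real) \<Rightarrow> bool" where
  "hoelder_on \<alpha> S f \<longleftrightarrow> (\<exists>C. \<forall>x\<in>S. \<forall>y\<in>S. \<bar>f x - f y\<bar> \<le> C * \<bar>x - y\<bar> powr \<alpha>)"

text \<open>
  Elements of \<open>Bij {0..1}\<close> are \<open>undefined\<close> outside \<open>{0..1}\<close>, so that equality of maps is equality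
  on \<open>{0..1}\<close>.
\<close>

definition Diff01 :: "nat \<Rightarrow> real \<Rightarrow> (real \<Rightarrow> real) set" where
  "Diff01 m \<alpha> = {f \<in> Bij {0..1}. strict_mono_on {0..1} f \<and>
     C01 m f \<and> C01 m (inv_into {0..1} f) \<and> hoelder_on \<alpha> {0..1} (deriv01 m f)}"

text \<open>
  For \<open>m = 0\<close> and \<open>0 < \<alpha>\<close> the set \<open>Diff01 m \<alpha>\<close> is not closed under composition. The image of a
  homomorphism from a group is nevertheless a subgroup of the group of homeomorphisms, contained
  in \<open>Diff01 m \<alpha>\<close>.
\<close>

definition Diff01_group :: "nat \<Rightarrow> real \<Rightarrow> (real \<Rightarrow> real) monoid" where
  "Diff01_group m \<alpha> = (BijGroup {0..1})\<lparr>carrier := Diff01 m \<alpha>\<rparr>"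

definition embeds :: "('a, 'c) monoid_scheme \<Rightarrow> ('b, 'd) monoid_scheme \<Rightarrow> bool" where
  "embeds G H \<longleftrightarrow> mon G H \<noteq> {}"

definition critical_regularity :: "('a, 'c) monoid_scheme \<Rightarrow> ereal" where
  "critical_regularity G =
     Sup {ereal (real m + \<alpha>) | m \<alpha>. 0 \<le> \<alpha> \<and> \<alpha> < 1 \<and> embeds G (Diff01_group m \<alpha>)}"

lemma C01_imp_continuous_on:
  assumes "C01 m f"
  shows "continuous_on {0..1} f"
proof (cases m)
  case 0
  with assms show ?thesis by (simp add: C01_def deriv01_def)
next
  case (Suc k)
  with assms have "deriv01 0 f differentiable_on {0..1}" by (auto simp: C01_def)
  then show ?thesis by (simp add: deriv01_def differentiable_imp_continuous_on)
qed

lemma Diff01_0_0: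
  "Diff01 0 0 = {f \<in> Bij {0..1}. strict_mono_on {0..1} f \<and>
     continuous_on {0..1} f \<and> continuous_on {0..1} (inv_into {0..1} f)}"
proof -
  have "hoelder_on 0 {0..1} f" if "f \<in> Bij {0..1}" for f
  proof -
    have "f x \<in> {0..1}" if "x \<in> {0..1}" for x
      using Bij_imp_funcset[OF \<open>f \<in> Bij {0..1}\<close>] that by blast
    then have *: "0 \<le> f x" "f x \<le> 1" if "x \<in> {0..1}" for x
      using that by force+
    have "\<bar>f x - f y\<bar> \<le> 1 * \<bar>x - y\<bar> powr 0" if "x \<in> {0..1}" "y \<in> {0..1}" for x y
      using *[OF that(1)] *[OF that(2)] by (cases "x = y") auto
    then have "\<forall>x\<in>{0..1}. \<forall>y\<in>{0..1}. \<bar>f x - f y\<bar> \<le> 1 * \<bar>x - y\<bar> powr 0"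
      by blast
    then show ?thesis unfolding hoelder_on_def by blast
  qed
  then show ?thesis by (auto simp: Diff01_def C01_def deriv01_def)
qed

lemma Diff01_subset: "Diff01 m \<alpha> \<subseteq> Diff01 0 0"
  unfolding Diff01_0_0 by (auto simp: Diff01_def C01_imp_continuous_on)

text \<open>The supremum of the empty set of extended reals provides the convention for \<open>-\<infinity>\<close>.\<close>

lemma critical_regularity_eq_minus_infinity:
  assumes "\<not> embeds G (Diff01_group 0 0)"
  shows "critical_regularity G = -\<infinity>"
proof -
  have "\<not> embeds G (Diff01_group m \<alpha>)" for m \<alpha>
  proof
    assume "embeds G (Diff01_group m \<alpha>)"
    then obtain h where "h \<in> mon G (Diff01_group m \<alpha>)" by (auto simp: embeds_def)
    then have "h \<in> mon G (Diff01_group 0 0)"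
      using Diff01_subset[of m \<alpha>] by (auto simp: mon_def hom_def Diff01_group_def)
    with assms show False by (auto simp: embeds_def)
  qed
  then have "{ereal (real m + \<alpha>) | m \<alpha>.
      0 \<le> \<alpha> \<and> \<alpha> < 1 \<and> embeds G (Diff01_group m \<alpha>)} = {}" by simp
  then show ?thesis
    unfolding critical_regularity_def by (simp only: Sup_empty bot_ereal_def)
qed

end

theory Submission
  imports Defs "HOL-Real_Asymp.Real_Asymp"
begin

text \<open>
  Let \<open>c\<close> be the generator of the centre of the group of Heisenberg matrices \<open>(x, y, z)\<close>; the
  commutator of two elements is the power of \<open>c\<close> given by the symplectic product of their
  parts \<open>(x, y)\<close>.

  Upper bound. Suppose the group acts faithfully by diffeomorphisms whose derivatives are
  \<open>\<tau>\<close>-Hoelder, where \<open>1 / n < \<tau> < 1\<close> or \<open>\<tau> = 1\<close>. Let \<open>J\<close> be a component of the set of points moved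
  by \<open>c\<close>. The group permutes these components. On \<open>J\<close> the stabiliser of \<open>J\<close> commutes with \<open>c\<close>, which
  has no fixed point there, so no nontrivial power of \<open>c\<close> is a commutator of elements of the
  stabiliser (\<open>free_central_power_not_commutator\<close>). Hence the stabiliser is isotropic, and one can
  choose one standard generator out of each symplectic pair such that the resulting \<open>n\<close> commuting
  maps move \<open>J\<close> around without overlap, indexed by integer vectors (\<open>isotropic_complement\<close>,
  \<open>wandering_gap\<close>). The disjoint translates have total length at most \<open>1\<close>. Averaging over the random
  monotone path that is uniformly distributed on each level of the lattice shows that there are
  arbitrarily long paths along which the sum of the \<open>\<tau>\<close>-th powers of the lengths stays bounded
  (\<open>cheap_lattice_path\<close>, \<open>level_average_powr_bound\<close>); for \<open>\<tau> < 1\<close> this is where \<open>\<tau> > 1 / n\<close> is used. So the composed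
  maps have bounded distortion on \<open>J\<close> although they make \<open>J\<close> arbitrarily short, and the argument of
  Kopell's lemma (\<open>bounded_distortion_along_wandering_intervals_impossible\<close>) excludes this.

  Lower bound. For \<open>\<alpha> < 1 / n\<close> let \<open>p = 1 / \<alpha> > n\<close>. The group acts on pairs of an integer vector \<open>k\<close>
  and a real time \<open>t\<close> by \<open>(k, t) \<mapsto> (k + y, t + z + x \<bullet> k)\<close>, and preserves the order that compares
  \<open>k\<close> lexicographically first. Replace the line over \<open>k\<close> by an interval of length of order
  \<open>N powr (- p)\<close>, where \<open>N = 1 + (\<Sum>i. \<bar>k i\<bar>)\<close>; these lengths are summable because \<open>p > n\<close>. Let time run
  through the interval at scale \<open>N powr (p + 1)\<close>, with a profile for which the derivatives of all
  maps tend to \<open>1\<close> at the end points. A group element then acts with derivative \<open>1 + O(1 / N)\<close>,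
  Lipschitz after rescaling the interval (\<open>fibre_density_lipschitz\<close>). Since \<open>1 / N\<close> is of the order of
  the length to the power \<open>\<alpha>\<close>, the derivative of the glued map is \<open>\<alpha>\<close>-Hoelder
  (\<open>glued_has_derivative\<close>, \<open>glued_deriv_hoelder\<close>).
\<close>

section \<open>Cheap monotone lattice paths\<close>

definition lattice_level :: "nat \<Rightarrow> nat \<Rightarrow> (nat \<Rightarrow> nat) set" where
  "lattice_level n j = {k. (\<forall>i. i \<notin> {1..n} \<longrightarrow> k i = 0) \<and> sum k {1..n} = j}"

abbreviation step_up :: "(nat \<Rightarrow> nat) \<Rightarrow> nat \<Rightarrow> nat \<Rightarrow> nat" where
  "step_up k i \<equiv> k(i := Suc (k i))"

lemma finite_lattice_level [simp]: "finite (lattice_level n j)"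
proof (rule finite_subset)
  show "lattice_level n j \<subseteq> {k. \<forall>i. (i \<in> {1..n} \<longrightarrow> k i \<in> {..j}) \<and> (i \<notin> {1..n} \<longrightarrow> k i = 0)}"
    unfolding lattice_level_def by (auto intro: member_le_sum)
  show "finite {k. \<forall>i. (i \<in> {1..n} \<longrightarrow> k i \<in> {..j}) \<and> (i \<notin> {1..n} \<longrightarrow> k i = (0::nat))}"
    by (rule finite_set_of_finite_funs) auto
qed

lemma lattice_level_0: "lattice_level n 0 = {\<lambda>_. 0}"
proof -
  have "k = (\<lambda>_. 0)" if k: "\<forall>i. i \<notin> {1..n} \<longrightarrow> k i = 0" "sum k {1..n} = 0" for k :: "nat \<Rightarrow> nat"
  proof
    fix i
    have "\<forall>i\<in>{1..n}. k i = 0" using k(2) by simp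
    with k(1) show "k i = 0" by blast
  qed
  then show ?thesis by (auto simp: lattice_level_def)
qed

lemma bij_betw_step_up:
  assumes "i \<in> {1..n}"
  shows "bij_betw (\<lambda>k. step_up k i) (lattice_level n j) {k \<in> lattice_level n (Suc j). k i > 0}"
proof (rule bij_betw_byWitness[where f' = "\<lambda>k. k(i := k i - 1)"])
  have S: "sum k {1..n} = k i + sum k ({1..n} - {i})" for k :: "nat \<Rightarrow> nat"
    using assms by (simp add: sum.remove)
  have T: "sum (k(i := a)) {1..n} = a + sum k ({1..n} - {i})" for k :: "nat \<Rightarrow> nat" and a
    by (subst S) (auto intro!: sum.cong)
  show "(\<lambda>k. step_up k i) ` lattice_level n j \<subseteq> {k \<in> lattice_level n (Suc j). k i > 0}"
    using assms S by (auto simp: lattice_level_def T)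
  show "(\<lambda>k. k(i := k i - 1)) ` {k \<in> lattice_level n (Suc j). k i > 0} \<subseteq> lattice_level n j"
    using assms S by (fastforce simp: lattice_level_def T)
qed auto

text \<open>
  A step from \<open>k\<close> to \<open>step_up k i\<close> is to be taken with probability \<open>(k i + 1) / (j + n)\<close>, as in
  Polya's urn. The identity says that this walk carries the uniform distribution on one level to
  the uniform distribution on the next: counted from the target \<open>k'\<close>, the weights of the steps into
  \<open>k'\<close> are its coordinates \<open>k' i\<close>, whose sum is the level.
\<close>

lemma sum_step_up_lattice_level:
  fixes g :: "(nat \<Rightarrow> nat) \<Rightarrow> real"
  shows "(\<Sum>k\<in>lattice_level n j. \<Sum>i=1..n. real (k i + 1) * g (step_up k i)) =
    real (Suc j) * (\<Sum>k\<in>lattice_level n (Suc j). g k)"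
proof -
  have "(\<Sum>k\<in>lattice_level n j. real (k i + 1) * g (step_up k i)) =
      (\<Sum>k\<in>lattice_level n (Suc j). real (k i) * g k)" if "i \<in> {1..n}" for i
  proof -
    have "(\<Sum>k\<in>lattice_level n j. real (k i + 1) * g (step_up k i)) =
        (\<Sum>k\<in>lattice_level n j. (\<lambda>k. real (k i) * g k) (step_up k i))"
      by simp
    also have "\<dots> = (\<Sum>k\<in>{k \<in> lattice_level n (Suc j). k i > 0}. real (k i) * g k)"
      by (rule sum.reindex_bij_betw[OF bij_betw_step_up[OF that]])
    also have "\<dots> = (\<Sum>k\<in>lattice_level n (Suc j). real (k i) * g k)"
      by (rule sum.mono_neutral_left) auto
    finally show ?thesis .
  qed
  then have "(\<Sum>k\<in>lattice_level n j. \<Sum>i=1..n. real (k i + 1) * g (step_up k i)) =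
      (\<Sum>i=1..n. \<Sum>k\<in>lattice_level n (Suc j). real (k i) * g k)"
    by (subst sum.swap) (rule sum.cong, auto)
  also have "\<dots> = (\<Sum>k\<in>lattice_level n (Suc j). \<Sum>i=1..n. real (k i) * g k)"
    by (rule sum.swap)
  also have "\<dots> = (\<Sum>k\<in>lattice_level n (Suc j). real (Suc j) * g k)"
  proof (rule sum.cong[OF refl])
    fix k assume "k \<in> lattice_level n (Suc j)"
    then have "sum k {1..n} = Suc j" by (simp add: lattice_level_def)
    then have "(\<Sum>i=1..n. real (k i)) = real (Suc j)" by (metis of_nat_sum)
    then show "(\<Sum>i=1..n. real (k i) * g k) = real (Suc j) * g k"
      by (simp only: sum_distrib_right[symmetric])
  qed
  finally show ?thesis by (simp add: sum_distrib_left)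
qed

lemma sum_Suc_lattice_level:
  assumes "k \<in> lattice_level n j"
  shows "(\<Sum>i=1..n. real (k i + 1)) = real (j + n)"
proof -
  have "(\<Sum>i=1..n. real (k i + 1)) = real (sum k {1..n}) + real n"
    by (simp add: sum.distrib)
  with assms show ?thesis by (simp add: lattice_level_def)
qed

lemma card_lattice_level_Suc:
  "real (j + n) * real (card (lattice_level n j)) = real (Suc j) * real (card (lattice_level n (Suc j)))"
  using sum_step_up_lattice_level[where g = "\<lambda>_. 1" and n = n and j = j]
  by (simp add: sum_Suc_lattice_level[simplified] mult.commute)

lemma card_lattice_level:
  assumes "n \<ge> 1"
  shows "card (lattice_level n j) = (j + n - 1) choose (n - 1)"
proof (induction j)
  case 0
  then show ?case by (simp add: lattice_level_0)
next
  case (Suc j)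
  have "Suc j * ((j + n) choose (Suc j)) = (j + n) * ((j + n - 1) choose j)"
    using assms binomial_absorption[of j "j + n"] by simp
  moreover have "(j + n) choose (Suc j) = (j + n) choose (n - 1)"
    using assms binomial_symmetric[of "Suc j" "j + n"] by simp
  moreover have "(j + n - 1) choose j = (j + n - 1) choose (n - 1)"
    using assms binomial_symmetric[of j "j + n - 1"] by simp
  ultimately have "Suc j * ((j + n) choose (n - 1)) = Suc j * card (lattice_level n (Suc j))"
    using card_lattice_level_Suc[of j n] Suc.IH by (metis of_nat_eq_iff of_nat_mult)
  then have "(j + n) choose (n - 1) = card (lattice_level n (Suc j))"
    by (simp only: mult_cancel1) auto
  then show ?case using assms by simp
qed

lemma card_lattice_level_pos:
  assumes "n \<ge> 1"
  shows "card (lattice_level n j) > 0"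
  using assms by (simp add: card_lattice_level zero_less_binomial_iff)

lemma card_lattice_level_ge:
  assumes "n \<ge> 2"
  shows "(real (Suc j) / real n) ^ (n - 1) \<le> real (card (lattice_level n j))"
proof -
  have "real (Suc j) / real n \<le> real (j + n - 1) / real (n - 1)"
    using assms by (intro frac_le) auto
  then have "(real (Suc j) / real n) ^ (n - 1) \<le> (real (j + n - 1) / real (n - 1)) ^ (n - 1)"
    by (intro power_mono) auto
  also have "\<dots> \<le> real ((j + n - 1) choose (n - 1))"
    using assms by (intro binomial_ge_n_over_k_pow_k) auto
  finally show ?thesis using assms by (simp add: card_lattice_level)
qed

text \<open>
  The cost of a path counts its first \<open>d\<close> vertices, starting with \<open>k\<close>; the end point is free.
\<close>

fun min_path_cost :: "nat \<Rightarrow> ((nat \<Rightarrow> nat) \<Rightarrow> real) \<Rightarrow> nat \<Rightarrow> (nat \<Rightarrow> nat) \<Rightarrow> real" where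
  "min_path_cost n f 0 k = 0"
| "min_path_cost n f (Suc d) k = f k + Min ((\<lambda>i. min_path_cost n f d (step_up k i)) ` {1..n})"

lemma min_path_cost_attained:
  assumes "n \<ge> 1"
  shows "\<exists>\<kappa>. \<kappa> 0 = k \<and> (\<forall>j<d. \<exists>i\<in>{1..n}. \<kappa> (Suc j) = step_up (\<kappa> j) i) \<and>
    (\<Sum>j<d. f (\<kappa> j)) = min_path_cost n f d k"
proof (induction d arbitrary: k)
  case 0
  then show ?case by auto
next
  case (Suc d)
  let ?m = "Min ((\<lambda>i. min_path_cost n f d (step_up k i)) ` {1..n})"
  have "?m \<in> (\<lambda>i. min_path_cost n f d (step_up k i)) ` {1..n}"
    using assms by (intro Min_in) auto
  then obtain i where i: "i \<in> {1..n}" "?m = min_path_cost n f d (step_up k i)" by blast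
  obtain \<kappa> where \<kappa>: "\<kappa> 0 = step_up k i" "\<forall>j<d. \<exists>i\<in>{1..n}. \<kappa> (Suc j) = step_up (\<kappa> j) i"
    "(\<Sum>j<d. f (\<kappa> j)) = min_path_cost n f d (step_up k i)"
    using Suc.IH[of "step_up k i"] by blast
  let ?\<kappa> = "case_nat k \<kappa>"
  have "\<forall>j<Suc d. \<exists>i\<in>{1..n}. ?\<kappa> (Suc j) = step_up (?\<kappa> j) i"
  proof (intro allI impI)
    fix j assume "j < Suc d"
    then show "\<exists>i\<in>{1..n}. ?\<kappa> (Suc j) = step_up (?\<kappa> j) i"
      using i(1) \<kappa>(1,2) by (cases j) auto
  qed
  moreover have "(\<Sum>j<Suc d. f (?\<kappa> j)) = min_path_cost n f (Suc d) k"
    using i(2) \<kappa>(3) by (simp add: sum.lessThan_Suc_shift del: sum.lessThan_Suc)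
  ultimately show ?case by (intro exI[of _ ?\<kappa>] conjI) (simp only: nat.case)
qed

definition level_average :: "nat \<Rightarrow> ((nat \<Rightarrow> nat) \<Rightarrow> real) \<Rightarrow> nat \<Rightarrow> real" where
  "level_average n f j = (\<Sum>k\<in>lattice_level n j. f k) / card (lattice_level n j)"

text \<open>
  The cheapest continuation costs at most the average over the steps of Polya's walk, and that walk
  maps the uniform distribution on a level to the uniform distribution on the next one.
\<close>

lemma level_average_min_path_cost_Suc:
  assumes "n \<ge> 1"
  shows "level_average n (min_path_cost n f (Suc d)) j \<le>
    level_average n f j + level_average n (min_path_cost n f d) (Suc j)"
proof -
  let ?m = "\<lambda>k. Min ((\<lambda>i. min_path_cost n f d (step_up k i)) ` {1..n})"
  let ?c = "\<lambda>j. real (card (lattice_level n j))"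
  let ?S = "\<Sum>k\<in>lattice_level n (Suc j). min_path_cost n f d k"
  have "real (j + n) * ?m k \<le> (\<Sum>i=1..n. real (k i + 1) * min_path_cost n f d (step_up k i))"
    if "k \<in> lattice_level n j" for k
  proof -
    have "real (j + n) * ?m k = (\<Sum>i=1..n. real (k i + 1) * ?m k)"
      unfolding sum_Suc_lattice_level[OF that, symmetric] by (rule sum_distrib_right)
    also have "\<dots> \<le> (\<Sum>i=1..n. real (k i + 1) * min_path_cost n f d (step_up k i))"
      by (intro sum_mono mult_left_mono Min_le) auto
    finally show ?thesis .
  qed
  then have "real (j + n) * (\<Sum>k\<in>lattice_level n j. ?m k) \<le> real (Suc j) * ?S"
    unfolding sum_distrib_left[of "real (j + n)"] sum_step_up_lattice_level[symmetric]
    by (intro sum_mono) auto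
  moreover have c: "?c j > 0" "?c (Suc j) > 0" "real (j + n) * ?c j = real (Suc j) * ?c (Suc j)"
    using card_lattice_level_pos[OF assms] card_lattice_level_Suc by auto
  ultimately have "(\<Sum>k\<in>lattice_level n j. ?m k) / ?c j \<le> ?S / ?c (Suc j)"
  proof -
    assume a: "real (j + n) * (\<Sum>k\<in>lattice_level n j. ?m k) \<le> real (Suc j) * ?S"
    have jn: "real (j + n) > 0" using assms by simp
    have "(\<Sum>k\<in>lattice_level n j. ?m k) / ?c j =
        real (j + n) * (\<Sum>k\<in>lattice_level n j. ?m k) / (real (j + n) * ?c j)"
      using jn by simp
    also have "\<dots> \<le> real (Suc j) * ?S / (real (j + n) * ?c j)"
      using a jn c by (intro divide_right_mono) auto
    also have "\<dots> = ?S / ?c (Suc j)" unfolding c(3) by simp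
    finally show ?thesis .
  qed
  then show ?thesis by (simp add: level_average_def sum.distrib add_divide_distrib)
qed

lemma cheap_lattice_path:
  assumes "n \<ge> 1"
  obtains \<kappa> where "\<kappa> 0 = (\<lambda>_. 0)" "\<And>j. j < d \<Longrightarrow> \<exists>i\<in>{1..n}. \<kappa> (Suc j) = step_up (\<kappa> j) i"
    "(\<Sum>j<d. f (\<kappa> j)) \<le> (\<Sum>j<d. level_average n f j)"
proof -
  have "level_average n (min_path_cost n f d) j \<le> (\<Sum>i<d. level_average n f (j + i))" for j
  proof (induction d arbitrary: j)
    case 0
    then show ?case by (simp add: level_average_def)
  next
    case (Suc d)
    show ?case
      using level_average_min_path_cost_Suc[OF assms, of f d j] Suc.IH[of "Suc j"]
      by (simp add: sum.lessThan_Suc_shift del: sum.lessThan_Suc min_path_cost.simps)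
  qed
  from this[of 0] have "min_path_cost n f d (\<lambda>_. 0) \<le> (\<Sum>i<d. level_average n f i)"
    by (simp add: level_average_def lattice_level_0)
  with min_path_cost_attained[OF assms, of "\<lambda>_. 0" d f] that show ?thesis by metis
qed

text \<open>
  This is where \<open>\<tau> > 1 / n\<close> enters. Level \<open>j\<close> has \<open>c \<ge> (j + 1)^(n - 1) / n^(n - 1)\<close> points, and Young's
  inequality bounds \<open>len k powr \<tau> / c\<close> by \<open>len k + c powr (-1 / (1 - \<tau>))\<close>. Summed over a level, the
  second term gives \<open>c powr (-\<tau> / (1 - \<tau>))\<close>, which is summable over \<open>j\<close> exactly when
  \<open>(n - 1) * \<tau> / (1 - \<tau>) > 1\<close>, that is, \<open>n * \<tau> > 1\<close>. For \<open>\<tau> = 1\<close> the average is at most the sum.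
\<close>

lemma level_average_powr_bound:
  fixes len :: "(nat \<Rightarrow> nat) \<Rightarrow> real"
  assumes n: "n \<ge> 1" and \<tau>: "\<tau> = 1 \<or> (1 / real n < \<tau> \<and> \<tau> < 1)"
    and pos: "\<And>k. len k \<ge> 0"
    and total: "\<And>d. (\<Sum>j<d. \<Sum>k\<in>lattice_level n j. len k) \<le> 1"
  obtains B where "\<And>d. (\<Sum>j<d. level_average n (\<lambda>k. len k powr \<tau>) j) \<le> B"
proof (cases "\<tau> = 1")
  case True
  have "(\<Sum>j<d. level_average n (\<lambda>k. len k powr \<tau>) j) \<le> 1" for d
  proof -
    have "level_average n (\<lambda>k. len k powr \<tau>) j \<le> (\<Sum>k\<in>lattice_level n j. len k)" for j
    proof -
      have "real (card (lattice_level n j)) \<ge> 1" using card_lattice_level_pos[OF n, of j] by linarith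
      then have "(\<Sum>k\<in>lattice_level n j. len k) / real (card (lattice_level n j)) \<le> (\<Sum>k\<in>lattice_level n j. len k) / 1"
        by (intro divide_left_mono sum_nonneg pos) auto
      then show ?thesis using True pos by (simp add: level_average_def)
    qed
    then have "(\<Sum>j<d. level_average n (\<lambda>k. len k powr \<tau>) j) \<le> (\<Sum>j<d. \<Sum>k\<in>lattice_level n j. len k)"
      by (intro sum_mono) auto
    with total[of d] show ?thesis by linarith
  qed
  then show ?thesis by (rule that)
next
  case False
  with \<tau> have \<tau>': "1 / real n < \<tau>" "\<tau> < 1" by auto
  have n2: "n \<ge> 2"
  proof (rule ccontr)
    assume "\<not> n \<ge> 2"
    with n have "n = 1" by simp
    with \<tau>' show False by simp
  qed
  have \<tau>0: "\<tau> > 0" using \<tau>' n by (smt (verit) divide_nonneg_nonneg of_nat_0_le_iff)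
  define e where "e = \<tau> / (1 - \<tau>)"
  have e0: "e > 0" using \<tau>' \<tau>0 by (simp add: e_def)
  have e1: "real (n - 1) * e > 1"
  proof -
    have "1 < real n * \<tau>" using \<tau>'(1) n by (simp add: field_simps)
    then have "1 - \<tau> < real (n - 1) * \<tau>" using n by (simp add: of_nat_diff algebra_simps)
    then show ?thesis using \<tau>' by (simp add: e_def field_simps)
  qed
  let ?c = "\<lambda>j. real (card (lattice_level n j))"
  define s where "s = - (real (n - 1) * e)"
  have c: "?c j > 0" for j using card_lattice_level_pos[OF n] by simp
  (* The threshold is the point where len k powr (1 - \<tau>) equals 1 / c. *)
  have young: "len k powr \<tau> / ?c j \<le> len k + ?c j powr (- e) / ?c j" for k j
  proof (cases "len k \<le> ?c j powr (- (1 + e))")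
    case True
    have "len k powr \<tau> \<le> (?c j powr (- (1 + e))) powr \<tau>"
      using True pos \<tau>0 by (intro powr_mono2) auto
    also have "\<dots> = ?c j powr (- e)"
    proof -
      have "(1 + e) * \<tau> = e" using \<tau>' by (simp add: e_def field_simps)
      then have "- (1 + e) * \<tau> = - e" by (simp only: minus_mult_left[symmetric])
      then show ?thesis by (simp only: powr_powr)
    qed
    finally have "len k powr \<tau> / ?c j \<le> ?c j powr (- e) / ?c j"
      using c[of j] by (intro divide_right_mono) auto
    then show ?thesis using pos[of k] by linarith
  next
    case False
    have l0: "len k > 0" using False by (smt (verit) powr_ge_zero)
    have "1 / ?c j = (?c j powr (- (1 + e))) powr (1 - \<tau>)"
    proof -
      have "(1 + e) * (1 - \<tau>) = 1" using \<tau>' by (simp add: e_def field_simps)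
      then have "- (1 + e) * (1 - \<tau>) = - 1" by (simp only: minus_mult_left[symmetric])
      then have "(?c j powr (- (1 + e))) powr (1 - \<tau>) = ?c j powr (- 1)"
        by (simp only: powr_powr)
      then show ?thesis using c[of j] by (simp add: powr_minus_divide)
    qed
    also have "\<dots> \<le> len k powr (1 - \<tau>)"
      using False \<tau>' by (intro powr_mono2) auto
    finally have "len k powr \<tau> * (1 / ?c j) \<le> len k powr \<tau> * len k powr (1 - \<tau>)"
      by (intro mult_left_mono) auto
    also have "\<dots> = len k" using l0 by (simp flip: powr_add)
    finally show ?thesis using c[of j] by (simp add: add_increasing2)
  qed
  have avg: "level_average n (\<lambda>k. len k powr \<tau>) j \<le>
      (\<Sum>k\<in>lattice_level n j. len k) + real n powr (- s) * real (Suc j) powr s" for j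
  proof -
    have "level_average n (\<lambda>k. len k powr \<tau>) j \<le> (\<Sum>k\<in>lattice_level n j. len k + ?c j powr (- e) / ?c j)"
      unfolding level_average_def sum_divide_distrib by (intro sum_mono young)
    also have "\<dots> = (\<Sum>k\<in>lattice_level n j. len k) + ?c j powr (- e)"
      using c[of j] by (simp add: sum.distrib)
    also have "?c j powr (- e) \<le> ((real (Suc j) / real n) ^ (n - 1)) powr (- e)"
      using card_lattice_level_ge[OF n2, of j] e0 n2 by (intro powr_mono2') auto
    also have "\<dots> = (real (Suc j) / real n) powr s"
      using n2 by (simp add: s_def powr_powr flip: powr_realpow)
    also have "\<dots> = real n powr (- s) * real (Suc j) powr s"
      using n2 by (simp add: powr_divide powr_minus_divide)
    finally show ?thesis by simp
  qed
  have "summable (\<lambda>j. real j powr s)" using e1 n by (simp add: summable_real_powr_iff s_def of_nat_diff)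
  then have sm: "summable (\<lambda>j. real (Suc j) powr s)"
    using summable_Suc_iff[of "\<lambda>j. real j powr s"] by simp
  have "(\<Sum>j<d. level_average n (\<lambda>k. len k powr \<tau>) j) \<le>
      1 + real n powr (- s) * (\<Sum>j. real (Suc j) powr s)" for d
  proof -
    have "(\<Sum>j<d. level_average n (\<lambda>k. len k powr \<tau>) j) \<le>
       (\<Sum>j<d. \<Sum>k\<in>lattice_level n j. len k) + real n powr (- s) * (\<Sum>j<d. real (Suc j) powr s)"
      unfolding sum_distrib_left sum.distrib[symmetric] by (intro sum_mono avg)
    also have "\<dots> \<le> 1 + real n powr (- s) * (\<Sum>j. real (Suc j) powr s)"
      using sm by (intro add_mono total mult_left_mono sum_le_suminf) auto
    finally show ?thesis .
  qed
  then show ?thesis by (rule that)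
qed

section \<open>Bounded distortion along wandering intervals\<close>

lemma mean_value_within_01:
  fixes f f' :: "real \<Rightarrow> real"
  assumes D: "\<forall>x\<in>{0..1}. (f has_real_derivative f' x) (at x within {0..1})"
    and pq: "0 \<le> p" "p < q" "q \<le> 1"
  shows "\<exists>z. p < z \<and> z < q \<and> f q - f p = f' z * (q - p)"
proof -
  have D': "(f has_derivative (*) (f' x)) (at x within {p..q})" if "x \<in> {p..q}" for x
    using has_field_derivative_subset[OF bspec[OF D, of x], of "{p..q}"] that pq
    by (simp add: has_field_derivative_def)
  have "\<exists>z\<in>{p<..<q}. f q - f p = f' z * (q - p)"
    by (rule mvt_simple[OF pq(2)]) (rule D', simp)
  then show ?thesis by auto
qed

lemma has_derivative_funpow_01:
  fixes f f' :: "real \<Rightarrow> real"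
  assumes maps: "\<And>x. x \<in> {0..1} \<Longrightarrow> f x \<in> {0..1}"
    and D: "\<forall>x\<in>{0..1}. (f has_real_derivative f' x) (at x within {0..1})"
    and cont: "continuous_on {0..1} f'"
  shows "\<exists>g'. (\<forall>x\<in>{0..1}. (f ^^ m has_real_derivative g' x) (at x within {0..1})) \<and>
    continuous_on {0..1} g'"
proof -
  have maps_pow: "(f ^^ m) x \<in> {0..1}" if "x \<in> {0..1}" for x m
    using that by (induction m) (simp_all only: funpow.simps id_apply comp_apply maps)
  show ?thesis
  proof (induction m)
    case 0
    show ?case by (rule exI[of _ "\<lambda>_. 1"]) (simp add: id_def)
  next
    case (Suc m)
    then obtain g' where g': "\<forall>x\<in>{0..1}. (f ^^ m has_real_derivative g' x) (at x within {0..1})"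
      "continuous_on {0..1} g'" by blast
    have "continuous_on {0..1} (f ^^ m)"
      by (rule DERIV_continuous_on[where D = g']) (use g'(1) in blast)
    then have "continuous_on {0..1} (\<lambda>x. f' ((f ^^ m) x))"
      by (rule continuous_on_compose2[OF cont]) (use maps_pow in blast)
    then have "continuous_on {0..1} (\<lambda>x. f' ((f ^^ m) x) * g' x)"
      by (rule continuous_on_mult[OF _ g'(2)])
    moreover have "(f ^^ Suc m has_real_derivative f' ((f ^^ m) x) * g' x) (at x within {0..1})"
      if "x \<in> {0..1}" for x
    proof -
      have "(f has_real_derivative f' ((f ^^ m) x)) (at ((f ^^ m) x) within (f ^^ m) ` {0..1})"
        by (rule has_field_derivative_subset[OF bspec[OF D maps_pow[OF that]]]) (use maps_pow in blast)
      from DERIV_image_chain[OF this bspec[OF g'(1) that]] show ?thesis by (simp only: funpow.simps)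
    qed
    ultimately show ?case by (intro exI[of _ "\<lambda>x. f' ((f ^^ m) x) * g' x"] conjI ballI)
  qed
qed

text \<open>
  The mechanism of Kopell's lemma. The map \<open>\<psi>\<close> commutes with \<open>f\<close> and carries \<open>{a..b}\<close> to a very short
  interval whose end points are fixed by \<open>f ^^ m\<close>. By the mean value theorem the derivative of
  \<open>f ^^ m\<close> equals \<open>1\<close> somewhere on the short interval, hence is at least \<open>1 / 2\<close> on all of it. Since
  \<open>\<psi>\<close> changes ratios of lengths by a factor of at most \<open>B\<close>, no iterate of \<open>f\<close> shrinks the interval
  between \<open>x\<close> and \<open>f x\<close> by more than \<open>2 * B\<close>. But the iterates of \<open>x\<close> converge monotonically.
\<close>

lemma bounded_distortion_along_wandering_intervals_impossible:
  fixes f f' :: "real \<Rightarrow> real"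
  assumes maps: "\<And>x. x \<in> {0..1} \<Longrightarrow> f x \<in> {0..1}"
    and mono: "strict_mono_on {0..1} f"
    and D: "\<forall>x\<in>{0..1}. (f has_real_derivative f' x) (at x within {0..1})"
    and cont: "continuous_on {0..1} f'"
    and ab: "0 \<le> a" "a < b" "b \<le> 1" "f a = a" "f b = b" "\<And>x. a < x \<Longrightarrow> x < b \<Longrightarrow> f x \<noteq> x"
    and B: "B > 0"
    and distortion: "\<And>e. e > 0 \<Longrightarrow> \<exists>\<psi> \<psi>'. (\<forall>x\<in>{0..1}. \<psi> x \<in> {0..1}) \<and> strict_mono_on {0..1} \<psi> \<and>
      (\<forall>x\<in>{0..1}. (\<psi> has_real_derivative \<psi>' x) (at x within {0..1})) \<and> (\<forall>x\<in>{0..1}. \<psi>' x > 0) \<and>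
      (\<forall>x\<in>{0..1}. \<psi> (f x) = f (\<psi> x)) \<and> (\<forall>x\<in>{a..b}. \<forall>y\<in>{a..b}. \<psi>' x \<le> B * \<psi>' y) \<and>
      \<psi> b - \<psi> a < e"
  shows False
proof -
  have in01: "x \<in> {0..1}" if "x \<in> {a..b}" for x using that ab(1-3) by simp
  have f_inside: "f x \<in> {a<..<b}" if "x \<in> {a<..<b}" for x
    using that strict_mono_onD[OF mono, of a x] strict_mono_onD[OF mono, of x b] ab(1-5) by simp
  have pow_inside: "(f ^^ m) x \<in> {a<..<b}" if "x \<in> {a<..<b}" for x m
    using that by (induction m) (simp_all only: funpow.simps id_apply comp_apply f_inside)
  have pow_mono: "(f ^^ m) x < (f ^^ m) y" if "x < y" "x \<in> {a<..<b}" "y \<in> {a<..<b}" for x y m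
    using that
  proof (induction m)
    case (Suc m)
    have "(f ^^ m) x \<in> {0..1}" "(f ^^ m) y \<in> {0..1}"
      using pow_inside[OF Suc.prems(2), of m] pow_inside[OF Suc.prems(3), of m] ab(1,3) by simp_all
    from strict_mono_onD[OF mono this Suc.IH[OF Suc.prems]] show ?case by simp
  qed simp
  define x0 where "x0 = (a + b) / 2"
  have x0: "x0 \<in> {a<..<b}" using ab(2) by (simp add: x0_def)
  define p where "p = min x0 (f x0)"
  define q where "q = max x0 (f x0)"
  have fx0: "f x0 \<noteq> x0" using ab(6)[of x0] x0 by simp
  have pq: "p < q" "p \<in> {a<..<b}" "q \<in> {a<..<b}"
    using x0 f_inside[OF x0] fx0 by (auto simp: p_def q_def)
  have key: "(q - p) / (2 * B) \<le> (f ^^ m) q - (f ^^ m) p" for m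
  proof -
    let ?g = "f ^^ m"
    have "\<exists>g'. (\<forall>x\<in>{0..1}. (?g has_real_derivative g' x) (at x within {0..1})) \<and> continuous_on {0..1} g'"
      by (rule has_derivative_funpow_01[where f = f and f' = f']) (fact maps, fact D, fact cont)
    then obtain g' where g'0: "\<forall>x\<in>{0..1}. (?g has_real_derivative g' x) (at x within {0..1})"
      "continuous_on {0..1} g'" by (elim exE conjE) (rule that)
    note g' = bspec[OF g'0(1)] g'0(2)
    have "uniformly_continuous_on {0..1} g'"
      by (rule compact_uniformly_continuous[OF g'(2)]) simp
    then obtain d where d: "d > 0" "\<And>x y. x \<in> {0..1} \<Longrightarrow> y \<in> {0..1} \<Longrightarrow> dist y x < d \<Longrightarrow> dist (g' y) (g' x) < 1 / 2"
      by (rule uniformly_continuous_onE[of _ _ "1 / 2"]) (simp, rule that)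
    obtain \<psi> \<psi>' where \<psi>0: "\<forall>x\<in>{0..1}. \<psi> x \<in> {0..1}" "strict_mono_on {0..1} \<psi>"
      "\<forall>x\<in>{0..1}. (\<psi> has_real_derivative \<psi>' x) (at x within {0..1})" "\<forall>x\<in>{0..1}. \<psi>' x > 0"
      "\<forall>x\<in>{0..1}. \<psi> (f x) = f (\<psi> x)" "\<forall>x\<in>{a..b}. \<forall>y\<in>{a..b}. \<psi>' x \<le> B * \<psi>' y"
      "\<psi> b - \<psi> a < d"
      using distortion[OF d(1)] by (elim exE conjE) (rule that)
    note \<psi> = bspec[OF \<psi>0(1)] \<psi>0(2) bspec[OF \<psi>0(3)] bspec[OF \<psi>0(4)] bspec[OF \<psi>0(5)]
      bspec[OF bspec[OF \<psi>0(6)]] \<psi>0(7)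
    have maps_pow: "(f ^^ i) x \<in> {0..1}" if "x \<in> {0..1}" for x i
      using that by (induction i) (simp_all only: funpow.simps id_apply comp_apply maps)
    have comm: "\<psi> ((f ^^ i) x) = (f ^^ i) (\<psi> x)" if "x \<in> {0..1}" for x i
      by (induction i) (simp_all add: \<psi>(5)[OF maps_pow[OF that]])
    have fix_pow: "(f ^^ i) a = a" "(f ^^ i) b = b" for i
      by (induction i) (simp_all add: ab)
    have lt: "\<psi> x < \<psi> y" if "x < y" "x \<in> {a..b}" "y \<in> {a..b}" for x y
      using strict_mono_onD[OF \<psi>(2) in01[OF that(2)] in01[OF that(3)] that(1)] .
    have a01: "a \<in> {0..1}" "b \<in> {0..1}" "p \<in> {0..1}" "q \<in> {0..1}" using ab(1-3) pq by simp_all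
    have order: "\<psi> a < \<psi> p" "\<psi> p < \<psi> q" "\<psi> q < \<psi> b"
      using lt[of a p] lt[of p q] lt[of q b] pq by simp_all
    have gpq: "?g p < ?g q" "?g p \<in> {a<..<b}" "?g q \<in> {a<..<b}"
      by (rule pow_mono[OF pq], rule pow_inside[OF pq(2)], rule pow_inside[OF pq(3)])
    have range: "0 \<le> \<psi> a" "\<psi> b \<le> 1" "0 \<le> \<psi> p" "\<psi> q \<le> 1" "0 \<le> p" "q \<le> 1" "0 \<le> ?g p" "?g q \<le> 1"
      using a01 \<psi>(1)[OF a01(1)] \<psi>(1)[OF a01(2)] \<psi>(1)[OF a01(3)] \<psi>(1)[OF a01(4)] gpq ab(1,3)
      by simp_all
    obtain \<xi> where \<xi>: "\<psi> a < \<xi>" "\<xi> < \<psi> b" "?g (\<psi> b) - ?g (\<psi> a) = g' \<xi> * (\<psi> b - \<psi> a)"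
      using mean_value_within_01[OF g'0(1) range(1) less_trans[OF less_trans[OF order(1,2)] order(3)] range(2)] by (elim exE conjE) (rule that)
    have "?g (\<psi> b) - ?g (\<psi> a) = \<psi> b - \<psi> a"
      using comm[OF a01(1), of m] comm[OF a01(2), of m] by (simp only: fix_pow)
    then have "g' \<xi> * (\<psi> b - \<psi> a) = 1 * (\<psi> b - \<psi> a)" unfolding \<xi>(3) by (simp only: mult_1)
    moreover have "\<psi> b - \<psi> a \<noteq> 0" using order by linarith
    ultimately have g\<xi>: "g' \<xi> = 1" by (rule mult_right_cancel[THEN iffD1, rotated])
    obtain \<zeta> where \<zeta>: "\<psi> p < \<zeta>" "\<zeta> < \<psi> q" "?g (\<psi> q) - ?g (\<psi> p) = g' \<zeta> * (\<psi> q - \<psi> p)"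
      using mean_value_within_01[OF g'0(1) range(3) order(2) range(4)] by (elim exE conjE) (rule that)
    have "dist (g' \<zeta>) (g' \<xi>) < 1 / 2"
      by (intro d(2)) (use \<xi>(1,2) \<zeta>(1,2) order \<psi>(7) range in \<open>simp_all add: dist_real_def\<close>)
    then have "\<bar>g' \<zeta> - 1\<bar> < 1 / 2" using g\<xi> by (simp only: dist_real_def)
    then have g\<zeta>: "g' \<zeta> \<ge> 1 / 2" by linarith
    obtain s where s: "p < s" "s < q" "\<psi> q - \<psi> p = \<psi>' s * (q - p)"
      using mean_value_within_01[OF \<psi>0(3) range(5) pq(1) range(6)] by (elim exE conjE) (rule that)
    obtain t where t: "?g p < t" "t < ?g q" "\<psi> (?g q) - \<psi> (?g p) = \<psi>' t * (?g q - ?g p)"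
      using mean_value_within_01[OF \<psi>0(3) range(7) gpq(1) range(8)] by (elim exE conjE) (rule that)
    have t': "\<psi>' t > 0" "\<psi>' s > 0" using t(1,2) gpq s(1,2) pq ab(1-3) by (simp_all add: \<psi>(4))
    have st: "\<psi>' t \<le> B * \<psi>' s" using t(1,2) gpq s(1,2) pq by (intro \<psi>(6)) simp_all
    have "\<psi>' s * ((q - p) / 2) \<le> g' \<zeta> * (\<psi>' s * (q - p))"
      using mult_right_mono[OF g\<zeta>, of "\<psi>' s * (q - p)"] t' pq by simp
    also have "\<dots> = \<psi>' t * (?g q - ?g p)"
      by (simp only: \<zeta>(3)[symmetric] s(3)[symmetric] t(3)[symmetric] comm[OF a01(3)] comm[OF a01(4)])
    also have "\<dots> \<le> B * \<psi>' s * (?g q - ?g p)"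
      using st gpq by (intro mult_right_mono) auto
    finally have "\<psi>' s * ((q - p) / 2) \<le> \<psi>' s * (B * (?g q - ?g p))" by (simp only: mult_ac)
    then have "(q - p) / 2 \<le> B * (?g q - ?g p)" by (rule mult_left_le_imp_le) (rule t'(2))
    then show ?thesis using B by (simp add: field_simps)
  qed
  define X where "X = (\<lambda>m. (f ^^ m) x0)"
  have step: "X (Suc m) = (f ^^ m) (f x0)" for m
    unfolding X_def funpow.simps comp_apply by (rule funpow_swap1[of f m x0])
  have gap: "(q - p) / (2 * B) \<le> \<bar>X (Suc m) - X m\<bar>" for m
  proof (cases "x0 < f x0")
    case True
    then have "p = x0" "q = f x0" by (simp_all add: p_def q_def)
    with key[of m] have "(q - p) / (2 * B) \<le> \<bar>(f ^^ m) (f x0) - (f ^^ m) x0\<bar>"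
      by (simp only:)
    then show ?thesis unfolding step unfolding X_def .
  next
    case False
    then have "p = f x0" "q = x0" by (simp_all add: p_def q_def)
    with key[of m] have "(q - p) / (2 * B) \<le> \<bar>(f ^^ m) (f x0) - (f ^^ m) x0\<bar>"
      by (simp only:)
    then show ?thesis unfolding step unfolding X_def .
  qed
  have bdd: "Bseq X"
  proof (rule BseqI'[of _ 1])
    fix m
    have "a < X m" "X m < b" using pow_inside[OF x0, of m] by (auto simp: X_def)
    then show "norm (X m) \<le> 1" using ab(1,3) by simp
  qed
  have "monoseq X"
  proof (cases "x0 < f x0")
    case True
    have "X m < X (Suc m)" for m
      unfolding step unfolding X_def by (rule pow_mono[OF True x0 f_inside[OF x0]])
    then show ?thesis unfolding monoseq_iff by (intro disjI1 incseq_SucI less_imp_le)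
  next
    case False
    with fx0 have "f x0 < x0" by simp
    then have "X (Suc m) < X m" for m
      unfolding step unfolding X_def by (rule pow_mono[OF _ f_inside[OF x0] x0])
    then show ?thesis unfolding monoseq_iff by (intro disjI2 decseq_SucI less_imp_le)
  qed
  with bdd have "convergent X" by (rule Bseq_monoseq_convergent)
  then obtain L where L: "X \<longlonglongrightarrow> L" by (auto simp: convergent_def)
  have "(\<lambda>m. \<bar>X (Suc m) - X m\<bar>) \<longlonglongrightarrow> \<bar>L - L\<bar>"
    by (intro tendsto_intros L LIMSEQ_Suc)
  then have "(q - p) / (2 * B) \<le> \<bar>L - L\<bar>"
    by (rule LIMSEQ_le_const) (use gap in auto)
  moreover have "(q - p) / (2 * B) > 0" using pq B by simp
  ultimately show False by simp
qed

section \<open>Maps commuting with a fixed-point-free map\<close>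

lemma iterates_cofinal:
  fixes f :: "real \<Rightarrow> real"
  assumes cont: "continuous_on {a..b} f"
    and inside: "\<And>x. x \<in> {a<..<b} \<Longrightarrow> f x \<in> {a<..<b}"
    and up: "\<And>x. x \<in> {a<..<b} \<Longrightarrow> x < f x"
    and xy: "x \<in> {a<..<b}" "y \<in> {a<..<b}"
  shows "\<exists>m. y \<le> (f ^^ m) x"
proof (rule ccontr)
  assume "\<not> ?thesis"
  then have below: "(f ^^ m) x < y" for m by (auto simp: not_le)
  define X where "X = (\<lambda>m. (f ^^ m) x)"
  have X: "X m \<in> {a<..<b}" for m
    unfolding X_def using xy(1) by (induction m) (auto simp: inside simp del: greaterThanLessThan_iff)
  have "incseq X" by (rule incseq_SucI) (use up X in \<open>auto simp: X_def intro: less_imp_le\<close>)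
  then obtain L where L: "X \<longlonglongrightarrow> L" "\<And>i. X i \<le> L"
    using incseq_convergent[of X y] below by (auto simp: X_def intro: less_imp_le)
  have Ly: "L \<le> y" by (rule LIMSEQ_le_const2[OF L(1)]) (use below in \<open>auto simp: X_def intro: less_imp_le\<close>)
  have L_in: "L \<in> {a<..<b}" using L(2)[of 0] Ly xy X[of 0] by auto
  have "(\<lambda>m. f (X m)) \<longlonglongrightarrow> f L"
    by (rule continuous_on_tendsto_compose[OF cont L(1)])
      (use L_in X in \<open>auto intro!: always_eventually less_imp_le\<close>)
  then have "(\<lambda>m. X (Suc m)) \<longlonglongrightarrow> f L" by (simp add: X_def)
  with LIMSEQ_Suc[OF L(1)] have "f L = L" using LIMSEQ_unique by blast
  with up[OF L_in] show False by simp
qed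

text \<open>
  This replaces the translation number of \<open>v\<close> relative to \<open>f\<close>, which is a conjugation invariant. The
  displacement of \<open>v\<close>, measured in iterates of the commuting map \<open>f\<close>, is bounded below uniformly:
  \<open>y \<le> (f ^^ Suc i) (v y)\<close> for all \<open>y\<close>. On the other hand, conjugation by \<open>u ^^ k\<close> turns \<open>v\<close> into
  \<open>v\<close> composed with \<open>f ^^ (w * k)\<close>, which forces \<open>v\<close> to move some point down by arbitrarily many
  iterates of \<open>f\<close>.
\<close>

lemma free_central_power_not_commutator:
  fixes S :: "'a :: linorder set"
  assumes maps: "\<And>x. x \<in> S \<Longrightarrow> f x \<in> S" "\<And>x. x \<in> S \<Longrightarrow> u x \<in> S" "\<And>x. x \<in> S \<Longrightarrow> v x \<in> S"
    and mono: "strict_mono_on S f" "strict_mono_on S u" "strict_mono_on S v"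
    and up: "\<And>x. x \<in> S \<Longrightarrow> x < f x"
    and cofinal: "\<And>x y. x \<in> S \<Longrightarrow> y \<in> S \<Longrightarrow> \<exists>m. y \<le> (f ^^ m) x"
    and commute: "\<And>x. x \<in> S \<Longrightarrow> u (f x) = f (u x)" "\<And>x. x \<in> S \<Longrightarrow> v (f x) = f (v x)"
    and commutator: "\<And>x. x \<in> S \<Longrightarrow> u (v x) = v (u ((f ^^ w) x))"
    and w: "w > 0" and "S \<noteq> {}"
  shows False
proof -
  obtain x where x: "x \<in> S" using \<open>S \<noteq> {}\<close> by blast
  have le: "f y \<le> f z \<longleftrightarrow> y \<le> z" "u y \<le> u z \<longleftrightarrow> y \<le> z" "v y \<le> v z \<longleftrightarrow> y \<le> z"
    if "y \<in> S" "z \<in> S" for y z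
    using that strict_mono_on_less_eq mono by blast+
  have pow: "(f ^^ m) y \<in> S" "(u ^^ m) y \<in> S" if "y \<in> S" for y m
    using that by (induction m) (auto simp: maps)
  have pow_le: "(f ^^ m) y \<le> (f ^^ m) z \<longleftrightarrow> y \<le> z" if "y \<in> S" "z \<in> S" for y z m
    using that by (induction m) (auto simp: le pow)
  have upow_le: "(u ^^ m) y \<le> (u ^^ m) z \<longleftrightarrow> y \<le> z" if "y \<in> S" "z \<in> S" for y z m
    using that by (induction m) (auto simp: le pow)
  have comm_f: "u ((f ^^ m) y) = (f ^^ m) (u y)" "v ((f ^^ m) y) = (f ^^ m) (v y)" if "y \<in> S" for y m
    using that by (induction m) (auto simp: commute pow)
  have comm_u: "(u ^^ k) ((f ^^ m) y) = (f ^^ m) ((u ^^ k) y)" if "y \<in> S" for y k m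
    using that by (induction k) (auto simp: comm_f pow)
  have pow_up: "y \<le> (f ^^ m) y" if "y \<in> S" for y m
    using that
  proof (induction m)
    case (Suc m)
    then show ?case using up[OF pow(1)[OF Suc.prems, of m]] by (simp add: order_trans[OF _ less_imp_le])
  qed simp
  have pow_pow: "(f ^^ p) ((f ^^ q) y) = (f ^^ (p + q)) y" for p q y
    by (simp add: funpow_add)
  have pow_lt: "m < m'" if "(f ^^ m) y < (f ^^ m') y" "y \<in> S" for m m' y
  proof (rule ccontr)
    assume "\<not> m < m'"
    then have "(f ^^ m) y = (f ^^ (m - m')) ((f ^^ m') y)" by (simp add: pow_pow)
    with pow_up[OF pow(1)[OF that(2)], of m' "m - m'"] that(1) show False by simp
  qed
  obtain i where i: "x \<le> (f ^^ i) (v x)" using cofinal[of "v x" x] x maps by blast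
  obtain j where j: "v x \<le> (f ^^ j) x" using cofinal[of x "v x"] x maps by blast
  have uniform: "y \<le> (f ^^ Suc i) (v y)" if y: "y \<in> S" for y
  proof (cases "x \<le> y")
    case True
    define m where "m = (LEAST m. y \<le> (f ^^ m) x)"
    have m: "y \<le> (f ^^ m) x" unfolding m_def by (rule LeastI_ex) (rule cofinal[OF x y])
    show ?thesis
    proof (cases m)
      case 0
      with m have "y \<le> x" by simp
      with True have "y = x" by simp
      moreover have "x \<le> (f ^^ Suc i) (v x)"
        using order_trans[OF i less_imp_le[OF up[OF pow(1)[OF maps(3)[OF x]]]]] by simp
      ultimately show ?thesis by simp
    next
      case (Suc l)
      then have "\<not> y \<le> (f ^^ l) x" unfolding m_def using not_less_Least by (metis lessI)
      then have l: "(f ^^ l) x \<le> y" by simp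
      have "y \<le> (f ^^ Suc l) x" using m Suc by simp
      also have "\<dots> \<le> (f ^^ Suc l) ((f ^^ i) (v x))"
        using i pow_le[OF x pow(1)[OF maps(3)[OF x]]] by blast
      also have "\<dots> = (f ^^ Suc i) (v ((f ^^ l) x))"
        by (simp only: comm_f(2)[OF x] pow_pow add_Suc add_Suc_right add.commute)
      also have "\<dots> \<le> (f ^^ Suc i) (v y)"
        using l le(3)[OF pow(1)[OF x] y] pow_le[OF maps(3)[OF pow(1)[OF x]] maps(3)[OF y]] by blast
      finally show ?thesis .
    qed
  next
    case False
    define m where "m = (LEAST m. x \<le> (f ^^ m) y)"
    have m: "x \<le> (f ^^ m) y" unfolding m_def by (rule LeastI_ex) (rule cofinal[OF y x])
    with False obtain l where l: "m = Suc l" by (cases m) auto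
    then have "\<not> x \<le> (f ^^ l) y" unfolding m_def using not_less_Least by (metis lessI)
    then have "(f ^^ m) y \<le> f x" using le(1)[OF pow(1)[OF y] x, of l] l by simp
    also have "\<dots> \<le> f ((f ^^ i) (v x))" using i le(1)[OF x pow(1)[OF maps(3)[OF x]]] by simp
    also have "\<dots> = (f ^^ Suc i) (v x)" by simp
    also have "\<dots> \<le> (f ^^ Suc i) (v ((f ^^ m) y))"
      using m le(3)[OF x pow(1)[OF y]] pow_le[OF maps(3)[OF x] maps(3)[OF pow(1)[OF y]]] by blast
    also have "\<dots> = (f ^^ m) ((f ^^ Suc i) (v y))"
      by (simp only: comm_f(2)[OF y] pow_pow add.commute)
    finally show ?thesis using pow_le[OF y pow(1)[OF maps(3)[OF y]]] by blast
  qed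
  have iterate: "(u ^^ k) (v y) = v ((u ^^ k) ((f ^^ (w * k)) y))" if y: "y \<in> S" for y k
  proof (induction k)
    case (Suc k)
    let ?z = "(f ^^ (w * k)) y"
    have "(u ^^ Suc k) (v y) = u (v ((u ^^ k) ?z))" using Suc by simp
    also have "\<dots> = v (u ((f ^^ w) ((u ^^ k) ?z)))" by (rule commutator) (use y pow in blast)
    also have "(f ^^ w) ((u ^^ k) ?z) = (u ^^ k) ((f ^^ w) ?z)" by (rule comm_u[symmetric]) (use y pow in blast)
    also have "(f ^^ w) ?z = (f ^^ (w * Suc k)) y" by (simp add: funpow_add)
    finally show ?case by simp
  qed simp
  (* Any k beyond the lower bound Suc i plus the upper bound j contradicts w > 0. *)
  define k where "k = Suc (Suc i + j)"
  define y where "y = (u ^^ k) x"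
  have y: "y \<in> S" unfolding y_def by (rule pow(2)[OF x])
  have "(f ^^ (w * k)) (v y) = (u ^^ k) (v x)"
    unfolding iterate[OF x] y_def comm_u[OF x] using comm_f(2)[OF pow(2)[OF x]] by simp
  also have "\<dots> \<le> (u ^^ k) ((f ^^ j) x)" using j upow_le[OF maps(3)[OF x] pow(1)[OF x]] by blast
  also have "\<dots> = (f ^^ j) y" unfolding y_def by (rule comm_u[OF x])
  finally have 1: "(f ^^ (w * k)) (v y) \<le> (f ^^ j) y" .
  have 2: "(f ^^ (w * k)) y \<le> (f ^^ (w * k)) ((f ^^ Suc i) (v y))"
    using uniform[OF y] pow_le[OF y pow(1)[OF maps(3)[OF y]]] by blast
  have 3: "(f ^^ (w * k)) ((f ^^ Suc i) (v y)) = (f ^^ Suc i) ((f ^^ (w * k)) (v y))"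
    by (simp only: pow_pow add.commute)
  have 4: "(f ^^ Suc i) ((f ^^ (w * k)) (v y)) \<le> (f ^^ Suc i) ((f ^^ j) y)"
    using 1 pow_le[OF pow(1)[OF maps(3)[OF y]] pow(1)[OF y]] by blast
  have 5: "(f ^^ Suc i) ((f ^^ j) y) < f ((f ^^ Suc i) ((f ^^ j) y))"
    by (intro up pow(1) y)
  have 6: "f ((f ^^ Suc i) ((f ^^ j) y)) = (f ^^ k) y"
    by (simp only: k_def pow_pow funpow.simps comp_apply add_Suc)
  have "(f ^^ (w * k)) y < (f ^^ k) y"
    using order_le_less_trans[OF order_trans[OF 2[unfolded 3] 4] 5] unfolding 6 .
  then have "w * k < k" by (rule pow_lt[OF _ y])
  with w show False by simp
qed

section \<open>Isotropic sets of integer vectors\<close>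

text \<open>
  A linear-algebra fact about coordinate complements of isotropic subspaces, by induction on \<open>n\<close>. In
  the last symplectic pair take the first basis vector, unless a nonzero multiple of it lies in \<open>S\<close>;
  in that case no nonzero multiple of the second one can, since the two have nonzero product. The
  vectors that lie in \<open>S\<close> after adding a multiple of the chosen basis vector form an isotropic set
  of smaller rank.
\<close>

lemma isotropic_complement:
  fixes S :: "((nat \<Rightarrow> int) \<times> (nat \<Rightarrow> int)) set"
  assumes "\<And>x y x' y'. (x, y) \<in> S \<Longrightarrow> (x', y') \<in> S \<Longrightarrow> (\<Sum>i=1..n. x i * y' i - x' i * y i) = 0"
  shows "\<exists>\<sigma>. \<forall>k. (\<forall>i. i \<notin> {1..n} \<longrightarrow> k i = 0) \<longrightarrow>
    ((\<lambda>i. if \<sigma> i then k i else 0, \<lambda>i. if \<sigma> i then 0 else k i) \<in> S) \<longrightarrow> k = (\<lambda>_. 0)"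
  using assms
proof (induction n arbitrary: S)
  case 0
  have "k = (\<lambda>_. 0)" if "\<forall>i. i \<notin> {1..0 :: nat} \<longrightarrow> k i = 0" for k :: "nat \<Rightarrow> int"
    using that by auto
  then show ?case by blast
next
  case (Suc n)
  let ?N = "Suc n"
  let ?e = "\<lambda>a. (\<lambda>_. 0 :: int)(?N := a)"
  define e where "e \<longleftrightarrow> \<not> (\<exists>a. a \<noteq> 0 \<and> (?e a, \<lambda>_. 0) \<in> S)"
  define S' where "S' = {(x, y). x ?N = 0 \<and> y ?N = 0 \<and>
    (\<exists>a. (if e then (x(?N := a), y) else (x, y(?N := a))) \<in> S)}"
  have "(\<Sum>i=1..n. x i * y' i - x' i * y i) = 0" if xy: "(x, y) \<in> S'" "(x', y') \<in> S'" for x y x' y'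
  proof (cases e)
    case True
    with xy obtain a a' where S: "(x(?N := a), y) \<in> S" "(x'(?N := a'), y') \<in> S" and 0: "y ?N = 0" "y' ?N = 0"
      by (auto simp: S'_def)
    have "(\<Sum>i=1..n. (x(?N := a)) i * y' i - (x'(?N := a')) i * y i) = (\<Sum>i=1..n. x i * y' i - x' i * y i)"
      by (rule sum.cong) auto
    with Suc.prems[OF S] 0 show ?thesis by simp
  next
    case False
    with xy obtain a a' where S: "(x, y(?N := a)) \<in> S" "(x', y'(?N := a')) \<in> S" and 0: "x ?N = 0" "x' ?N = 0"
      by (auto simp: S'_def)
    have "(\<Sum>i=1..n. x i * (y'(?N := a')) i - x' i * (y(?N := a)) i) = (\<Sum>i=1..n. x i * y' i - x' i * y i)"
      by (rule sum.cong) auto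
    with Suc.prems[OF S] 0 show ?thesis by simp
  qed
  from Suc.IH[OF this] obtain \<sigma> where \<sigma>: "\<And>k. (\<forall>i. i \<notin> {1..n} \<longrightarrow> k i = 0) \<Longrightarrow>
    (\<lambda>i. if \<sigma> i then k i else 0, \<lambda>i. if \<sigma> i then 0 else k i) \<in> S' \<Longrightarrow> k = (\<lambda>_. 0)" by blast
  show ?case
  proof (intro exI allI impI)
    fix k :: "nat \<Rightarrow> int"
    assume supp: "\<forall>i. i \<notin> {1..?N} \<longrightarrow> k i = 0"
      and kS: "(\<lambda>i. if (\<sigma>(?N := e)) i then k i else 0, \<lambda>i. if (\<sigma>(?N := e)) i then 0 else k i) \<in> S"
    let ?k = "k(?N := 0)"
    have "(\<lambda>i. if \<sigma> i then ?k i else 0, \<lambda>i. if \<sigma> i then 0 else ?k i) \<in> S'"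
    proof -
      have "(if e then ((\<lambda>i. if \<sigma> i then ?k i else 0)(?N := k ?N), \<lambda>i. if \<sigma> i then 0 else ?k i)
        else (\<lambda>i. if \<sigma> i then ?k i else 0, (\<lambda>i. if \<sigma> i then 0 else ?k i)(?N := k ?N))) =
        (\<lambda>i. if (\<sigma>(?N := e)) i then k i else 0, \<lambda>i. if (\<sigma>(?N := e)) i then 0 else k i)"
        by (auto simp: fun_eq_iff)
      with kS show ?thesis unfolding S'_def by (auto intro!: exI[of _ "k ?N"])
    qed
    then have k0: "?k = (\<lambda>_. 0)" by (rule \<sigma>[rotated]) (use supp in auto)
    have k_off: "k i = 0" if "i \<noteq> ?N" for i using fun_cong[OF k0, of i] that by simp
    show "k = (\<lambda>_. 0)"
    proof (rule ccontr)
      assume "k \<noteq> (\<lambda>_. 0)"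
      then obtain i where "k i \<noteq> 0" by blast
      then have kN: "k ?N \<noteq> 0" using k_off[of i] by (cases "i = ?N") auto
      show False
      proof (cases e)
        case True
        have "(\<lambda>i. if (\<sigma>(?N := e)) i then k i else 0, \<lambda>i. if (\<sigma>(?N := e)) i then 0 else k i) = (?e (k ?N), \<lambda>_. 0)"
          using True by (auto simp: fun_eq_iff k_off)
        with kS kN True show False unfolding e_def by auto
      next
        case False
        then obtain a where a: "a \<noteq> 0" "(?e a, \<lambda>_. 0) \<in> S" unfolding e_def by blast
        have "(\<lambda>i. if (\<sigma>(?N := e)) i then k i else 0, \<lambda>i. if (\<sigma>(?N := e)) i then 0 else k i) = (\<lambda>_. 0, ?e (k ?N))"
          using False by (auto simp: fun_eq_iff k_off)
        with kS have "(\<lambda>_. 0, ?e (k ?N)) \<in> S" by simp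
        from Suc.prems[OF a(2) this] a(1) kN show False by simp
      qed
    qed
  qed
qed

section \<open>Heisenberg actions on the interval\<close>

locale heisenberg_action =
  fixes n :: nat and act :: "(nat \<Rightarrow> int) \<Rightarrow> (nat \<Rightarrow> int) \<Rightarrow> int \<Rightarrow> real \<Rightarrow> real"
  assumes maps: "\<And>x y z t. t \<in> {0..1} \<Longrightarrow> act x y z t \<in> {0..1}"
    and mono: "\<And>x y z. strict_mono_on {0..1} (act x y z)"
    and cont: "\<And>x y z. continuous_on {0..1} (act x y z)"
    and comp: "\<And>x y z x' y' z' t. t \<in> {0..1} \<Longrightarrow> act x y z (act x' y' z' t) =
      act (\<lambda>i. x i + x' i) (\<lambda>i. y i + y' i) (z + z' + (\<Sum>i=1..n. x i * y' i)) t"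
    and ident: "\<And>t. t \<in> {0..1} \<Longrightarrow> act (\<lambda>_. 0) (\<lambda>_. 0) 0 t = t"
begin

abbreviation central :: "int \<Rightarrow> real \<Rightarrow> real" where
  "central \<equiv> act (\<lambda>_. 0) (\<lambda>_. 0)"

lemma less_iff: "s \<in> {0..1} \<Longrightarrow> t \<in> {0..1} \<Longrightarrow> act x y z s < act x y z t \<longleftrightarrow> s < t"
  by (rule strict_mono_on_less[OF mono])

lemma eq_iff: "s \<in> {0..1} \<Longrightarrow> t \<in> {0..1} \<Longrightarrow> act x y z s = act x y z t \<longleftrightarrow> s = t"
  by (rule strict_mono_on_eq[OF mono])

lemma act_inverse: "t \<in> {0..1} \<Longrightarrow>
    act (\<lambda>i. - x i) (\<lambda>i. - y i) (- z + (\<Sum>i=1..n. x i * y i)) (act x y z t) = t"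
  "t \<in> {0..1} \<Longrightarrow>
    act x y z (act (\<lambda>i. - x i) (\<lambda>i. - y i) (- z + (\<Sum>i=1..n. x i * y i)) t) = t"
  by (simp_all add: comp ident sum_negf)

lemma act_surj:
  assumes "s \<in> {0..1}"
  shows "\<exists>t\<in>{0..1}. act x y z t = s"
  using act_inverse(2)[OF assms, of x y z] maps[OF assms] by blast

lemma act_endpoints: "act x y z 0 = 0" "act x y z 1 = 1"
proof -
  have "(0::real) \<in> {0..1}" by simp
  from act_surj[OF this, of x y z] obtain t where t: "t \<in> {0..1}" "act x y z t = 0" by blast
  have "\<not> 0 < t" using less_iff[of 0 t x y z] t maps[of 0 x y z] by simp
  with t show "act x y z 0 = 0" by simp
  have "(1::real) \<in> {0..1}" by simp
  from act_surj[OF this, of x y z] obtain t where t: "t \<in> {0..1}" "act x y z t = 1" by blast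
  have "\<not> t < 1" using less_iff[of t 1 x y z] t maps[of 1 x y z] by simp
  with t show "act x y z 1 = 1" by simp
qed

lemma central_commutes: "t \<in> {0..1} \<Longrightarrow> act x y z (central w t) = central w (act x y z t)"
  by (simp add: comp add.commute)

lemma central_funpow:
  assumes "t \<in> {0..1}"
  shows "(central s ^^ m) t = central (s * int m) t"
proof (induction m)
  case 0
  show ?case using assms by (simp add: ident)
next
  case (Suc m)
  then show ?case using assms by (simp add: comp algebra_simps)
qed

text \<open>
  The gaps are the connected components of the set of points moved by the centre. Central elements
  commute with the whole action, so the group permutes the gaps.
\<close>

definition gap :: "real \<Rightarrow> real \<Rightarrow> bool" where
  "gap a b \<longleftrightarrow> 0 \<le> a \<and> a < b \<and> b \<le> 1 \<and> central 1 a = a \<and> central 1 b = b \<and>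
    (\<forall>t. a < t \<and> t < b \<longrightarrow> central 1 t \<noteq> t)"

lemma gap_D:
  assumes "gap a b"
  shows "0 \<le> a" "a < b" "b \<le> 1" "a \<in> {0..1}" "b \<in> {0..1}" "central 1 a = a" "central 1 b = b"
    "\<And>t. a < t \<Longrightarrow> t < b \<Longrightarrow> central 1 t \<noteq> t"
  using assms unfolding gap_def by auto

lemma gap_exists:
  assumes t0: "t0 \<in> {0..1}" "central 1 t0 \<noteq> t0"
  shows "\<exists>a b. gap a b"
proof -
  let ?f = "\<lambda>t. central 1 t - t"
  have c: "continuous_on {0..1} ?f" by (intro continuous_intros cont)
  have "compact {t \<in> {u..v}. ?f t = 0}" if "{u..v} \<subseteq> {0..1}" for u v
    by (intro compact_eq_bounded_closed[THEN iffD2] conjI bounded_subset[OF bounded_closed_interval[of u v]]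
        continuous_closed_preimage_constant continuous_on_subset[OF c that] closed_atLeastAtMost) auto
  then have "compact {t \<in> {0..t0}. ?f t = 0}" "compact {t \<in> {t0..1}. ?f t = 0}" using t0(1) by simp_all
  moreover have "0 \<in> {t \<in> {0..t0}. ?f t = 0}" "1 \<in> {t \<in> {t0..1}. ?f t = 0}"
    using t0 by (simp_all add: act_endpoints)
  ultimately obtain a b where a: "a \<in> {t \<in> {0..t0}. ?f t = 0}" "\<forall>t\<in>{t \<in> {0..t0}. ?f t = 0}. t \<le> a"
    and b: "b \<in> {t \<in> {t0..1}. ?f t = 0}" "\<forall>t\<in>{t \<in> {t0..1}. ?f t = 0}. b \<le> t"
    using compact_attains_sup[of "{t \<in> {0..t0}. ?f t = 0}"] compact_attains_inf[of "{t \<in> {t0..1}. ?f t = 0}"]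
    by blast
  have "a \<noteq> t0" "b \<noteq> t0" using a(1) b(1) t0(2) by auto
  then have ab: "0 \<le> a" "a < t0" "t0 < b" "b \<le> 1" "central 1 a = a" "central 1 b = b" using a(1) b(1) by auto
  have "central 1 t \<noteq> t" if "a < t" "t < b" for t
  proof
    assume "central 1 t = t"
    then have "t \<le> a \<or> b \<le> t" using a(2) b(2) that ab by (cases "t \<le> t0") auto
    with that show False by simp
  qed
  with ab have "gap a b" by (simp add: gap_def)
  then show ?thesis by blast
qed

lemma gap_image:
  assumes "gap a b"
  shows "gap (act x y z a) (act x y z b)"
proof -
  note g = gap_D[OF assms]
  have "central 1 s \<noteq> s" if s: "act x y z a < s" "s < act x y z b" for s
  proof
    assume fs: "central 1 s = s"
    have "s \<in> {0..1}" using s maps[OF g(4), of x y z] maps[OF g(5), of x y z] by simp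
    then obtain t where t: "t \<in> {0..1}" "act x y z t = s" using act_surj by blast
    have "a < t" "t < b" using s less_iff[OF g(4) t(1), of x y z] less_iff[OF t(1) g(5), of x y z] t(2) by auto
    then have "central 1 t \<noteq> t" by (rule g(8))
    moreover have "act x y z (central 1 t) = act x y z t"
      using central_commutes[OF t(1)] t(2) fs by simp
    ultimately show False using eq_iff[OF maps[OF t(1)] t(1)] by simp
  qed
  moreover have "act x y z a < act x y z b" using less_iff[OF g(4,5)] g(2) by simp
  moreover have "0 \<le> act x y z a" "act x y z b \<le> 1"
    using maps[OF g(4), of x y z] maps[OF g(5), of x y z] by simp_all
  moreover have "central 1 (act x y z a) = act x y z a" "central 1 (act x y z b) = act x y z b"
    using central_commutes[OF g(4), of x y z 1] central_commutes[OF g(5), of x y z 1] g(6,7) by simp_all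
  ultimately show ?thesis unfolding gap_def by blast
qed

lemma gaps_meet_imp_eq:
  assumes "gap a b" "gap a' b'" "a < b'" "a' < b"
  shows "a = a' \<and> b = b'"
proof -
  note g = gap_D[OF assms(1)] and g' = gap_D[OF assms(2)]
  have "\<not> (a < a' \<and> a' < b)" "\<not> (a' < a \<and> a < b')" "\<not> (a < b' \<and> b' < b)" "\<not> (a' < b \<and> b < b')"
    using g(6-8) g'(6-8) by blast+
  with assms(3,4) show ?thesis by linarith
qed

text \<open>
  Two elements that fix the end point \<open>a\<close> preserve the gap and commute there with the centre, which
  acts without fixed points. Their commutator is the power of the central generator whose exponent
  is the symplectic product, so that product vanishes. The sign \<open>s\<close> selects the central generator
  that moves points upwards.
\<close>

lemma stabilizer_isotropic:
  assumes g: "gap a b" and fixed: "act x y 0 a = a" "act x' y' 0 a = a"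
  shows "(\<Sum>i=1..n. x i * y' i - x' i * y i) = 0"
proof (rule ccontr)
  define \<omega> where "\<omega> = (\<Sum>i=1..n. x i * y' i - x' i * y i)"
  assume "\<not> ?thesis"
  then have \<omega>: "\<omega> \<noteq> 0" by (simp add: \<omega>_def)
  note gD = gap_D[OF g]
  have in01: "t \<in> {0..1}" if "t \<in> {a<..<b}" for t using that gD(1,3) by simp
  have fixed_b: "act x y z b = b" if "act x y z a = a" for x y z
    using gaps_meet_imp_eq[OF g gap_image[OF g, of x y z]] that gD(2) less_iff[OF gD(4,5), of x y z] by simp
  have inside: "act x y z t \<in> {a<..<b}" if "act x y z a = a" "t \<in> {a<..<b}" for x y z t
    using less_iff[OF gD(4) in01[OF that(2)], of x y z] less_iff[OF in01[OF that(2)] gD(5), of x y z]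
      that fixed_b[OF that(1)] by simp
  obtain s :: int where s: "s = 1 \<or> s = - 1" and up: "\<forall>t\<in>{a<..<b}. t < central s t"
  proof -
    have cf: "continuous_on {u..v} (\<lambda>t. central 1 t - t)" if "a < u" "v < b" for u v
      by (intro continuous_intros continuous_on_subset[OF cont]) (use that gD(1,3) in auto)
    have same_sign: "(u < central 1 u) = (v < central 1 v)" if uv: "u \<in> {a<..<b}" "v \<in> {a<..<b}" "u \<le> v" for u v
    proof -
      have nofix: "central 1 t - t \<noteq> 0" if "u \<le> t" "t \<le> v" for t using gD(8)[of t] that uv by simp
      have "\<not> (central 1 u - u \<le> 0 \<and> 0 \<le> central 1 v - v)"
        using IVT'[of "\<lambda>t. central 1 t - t" u 0 v] cf[of u v] uv nofix by auto
      moreover have "\<not> (central 1 v - v \<le> 0 \<and> 0 \<le> central 1 u - u)"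
        using IVT2'[of "\<lambda>t. central 1 t - t" v 0 u] cf[of u v] uv nofix by auto
      ultimately show ?thesis using nofix[of u] nofix[of v] uv(3) by linarith
    qed
    have same: "(u < central 1 u) = (v < central 1 v)" if uv: "u \<in> {a<..<b}" "v \<in> {a<..<b}" for u v
      using same_sign[OF uv] same_sign[OF uv(2) uv(1)] by linarith
    define m where "m = (a + b) / 2"
    have m: "m \<in> {a<..<b}" using gD(2) by (simp add: m_def)
    show thesis
    proof (cases "m < central 1 m")
      case True
      then have "\<forall>t\<in>{a<..<b}. t < central 1 t" using same[OF m] by blast
      then show thesis by (rule that[rotated]) simp
    next
      case False
      have "t < central (- 1) t" if t: "t \<in> {a<..<b}" for t
      proof -
        have "\<not> t < central 1 t" using same[OF m t] False by simp
        then have "central 1 t < t" using gD(8)[of t] t by simp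
        then have "central (-1) (central 1 t) < central (-1) t"
          using less_iff[OF maps[OF in01[OF t]] in01[OF t]] by blast
        moreover have "central (-1) (central 1 t) = t" using comp[OF in01[OF t], of _ _ "-1" _ _ 1] ident[OF in01[OF t]] by simp
        ultimately show ?thesis by simp
      qed
      then show thesis by (intro that[of "-1"] ballI) simp_all
    qed
  qed
  have central_a: "central s a = a"
    using s
  proof
    assume "s = - 1"
    moreover have "central (-1) (central 1 a) = a" using comp[OF gD(4), of _ _ "-1" _ _ 1] ident[OF gD(4)] by simp
    ultimately show ?thesis using gD(6) by simp
  qed (simp add: gD(6))
  have contradiction: False
    if w: "0 < w" and u: "act ux uy 0 a = a" and v: "act vx vy 0 a = a"
      and com: "s * int w = (\<Sum>i=1..n. ux i * vy i - vx i * uy i)" for w ux uy vx vy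
  proof (rule free_central_power_not_commutator)
    show "t \<in> {a<..<b} \<Longrightarrow> central s t \<in> {a<..<b}" for t by (rule inside[OF central_a])
    show "t \<in> {a<..<b} \<Longrightarrow> act ux uy 0 t \<in> {a<..<b}" for t by (rule inside[OF u])
    show "t \<in> {a<..<b} \<Longrightarrow> act vx vy 0 t \<in> {a<..<b}" for t by (rule inside[OF v])
    have sub: "{a<..<b} \<subseteq> {0..1}" using in01 by (rule subsetI)
    show "strict_mono_on {a<..<b} (central s)" "strict_mono_on {a<..<b} (act ux uy 0)"
      "strict_mono_on {a<..<b} (act vx vy 0)"
      by (rule monotone_on_subset[OF mono sub])+
    show "t \<in> {a<..<b} \<Longrightarrow> t < central s t" for t using up by (rule bspec)
    show "\<exists>m. t' \<le> (central s ^^ m) t" if t: "t \<in> {a<..<b}" "t' \<in> {a<..<b}" for t t'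
    proof (rule iterates_cofinal[OF _ _ _ t])
      show "continuous_on {a..b} (central s)"
        using gD(1,3) by (intro continuous_on_subset[OF cont]) simp
      show "r \<in> {a<..<b} \<Longrightarrow> central s r \<in> {a<..<b}" for r by (rule inside[OF central_a])
      show "r \<in> {a<..<b} \<Longrightarrow> r < central s r" for r using up by (rule bspec)
    qed
    show "act ux uy 0 (central s t) = central s (act ux uy 0 t)" if "t \<in> {a<..<b}" for t
      by (rule central_commutes[OF in01[OF that]])
    show "act vx vy 0 (central s t) = central s (act vx vy 0 t)" if "t \<in> {a<..<b}" for t
      by (rule central_commutes[OF in01[OF that]])
    show "act ux uy 0 (act vx vy 0 t) = act vx vy 0 (act ux uy 0 ((central s ^^ w) t))"
      if t: "t \<in> {a<..<b}" for t
    proof -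
      have "(\<Sum>i=1..n. ux i * vy i) = s * int w + (\<Sum>i=1..n. vx i * uy i)"
        unfolding com by (simp add: sum_subtractf)
      then show ?thesis
        using in01[OF t] by (simp add: central_funpow comp maps add.commute)
    qed
    show "0 < w" by (rule w)
    show "{a<..<b} \<noteq> {}" using gD(2) by simp
  qed
  show False
  proof (cases "s * \<omega> > 0")
    case True
    have "s * int (nat (s * \<omega>)) = \<omega>" using True s by auto
    then show False using True by (intro contradiction[OF _ fixed, of "nat (s * \<omega>)"]) (simp_all add: \<omega>_def)
  next
    case False
    have "s * \<omega> < 0" using False \<omega> s by auto
    then have "s * int (nat (- (s * \<omega>))) = - \<omega>" using s by auto
    moreover have "- \<omega> = (\<Sum>i=1..n. x' i * y i - x i * y' i)"
      unfolding \<omega>_def sum_negf[symmetric] by (rule sum.cong) simp_all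
    ultimately show False using \<open>s * \<omega> < 0\<close>
      by (intro contradiction[OF _ fixed(2) fixed(1), of "nat (- (s * \<omega>))"]) simp_all
  qed
qed

end

section \<open>Smooth Heisenberg actions\<close>

lemma sum_lengths_disjoint_intervals_le_1:
  fixes l r :: "'k \<Rightarrow> real"
  assumes fin: "finite K"
    and sub: "\<And>k. k \<in> K \<Longrightarrow> 0 \<le> l k \<and> l k < r k \<and> r k \<le> 1"
    and disj: "\<And>k k'. k \<in> K \<Longrightarrow> k' \<in> K \<Longrightarrow> k \<noteq> k' \<Longrightarrow> \<not> (l k < r k' \<and> l k' < r k)"
  shows "(\<Sum>k\<in>K. r k - l k) \<le> 1"
proof -
  let ?I = "\<lambda>k. {l k<..<r k}"
  have d: "disjoint_family_on ?I K"
    unfolding disjoint_family_on_def using disj by fastforce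
  have "(\<Sum>k\<in>K. r k - l k) = (\<Sum>k\<in>K. measure lborel (?I k))"
    by (rule sum.cong) (use sub in \<open>simp_all add: less_imp_le\<close>)
  also have "\<dots> = measure lborel (\<Union>k\<in>K. ?I k)"
    by (rule measure_finite_Union[symmetric, OF fin _ d]) (use sub in \<open>auto simp: emeasure_lborel_Ioo less_imp_le\<close>)
  also have "\<dots> \<le> measure lborel {0..1 :: real}"
  proof (rule measure_mono_fmeasurable)
    show "(\<Union>k\<in>K. ?I k) \<subseteq> {0..1}" using sub by force
    show "(\<Union>k\<in>K. ?I k) \<in> sets lborel" using fin by (intro sets.finite_UN) simp_all
    show "{0..1 :: real} \<in> fmeasurable lborel" by (rule fmeasurableI) simp_all
  qed
  finally show ?thesis by simp
qed

lemma step_up_in_lattice_level: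
  assumes "k \<in> lattice_level n j" "i \<in> {1..n}"
  shows "step_up k i \<in> lattice_level n (Suc j)"
  using bij_betwE[OF bij_betw_step_up[OF assms(2), of j]] assms(1) by blast

definition log_hoelder_diff :: "real \<Rightarrow> (real \<Rightarrow> real) \<Rightarrow> bool" where
  "log_hoelder_diff \<tau> f \<longleftrightarrow> (\<exists>D C. (\<forall>t\<in>{0..1}. (f has_real_derivative D t) (at t within {0..1})) \<and>
    continuous_on {0..1} D \<and> (\<forall>t\<in>{0..1}. D t > 0) \<and>
    (\<forall>s\<in>{0..1}. \<forall>t\<in>{0..1}. \<bar>ln (D s) - ln (D t)\<bar> \<le> C * \<bar>s - t\<bar> powr \<tau>))"

definition log_distortion_le :: "real \<Rightarrow> real \<Rightarrow> real \<Rightarrow> (real \<Rightarrow> real) \<Rightarrow> bool" where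
  "log_distortion_le S a b f \<longleftrightarrow> (\<exists>D. (\<forall>t\<in>{0..1}. (f has_real_derivative D t) (at t within {0..1})) \<and>
    (\<forall>t\<in>{0..1}. D t > 0) \<and> (\<forall>s\<in>{a..b}. \<forall>t\<in>{a..b}. ln (D s) - ln (D t) \<le> S))"

locale smooth_heisenberg_action = heisenberg_action +
  fixes \<tau> :: real
  assumes smooth: "\<And>x y z. log_hoelder_diff \<tau> (act x y z)"
    and \<tau>_pos: "\<tau> > 0"
begin

text \<open>
  The choice \<open>\<sigma>\<close> picks one generator out of each symplectic pair. The chosen generators commute, so
  \<open>k \<mapsto> translation \<sigma> k\<close> is an action of the integer vectors \<open>k\<close>.
\<close>

definition translation :: "(nat \<Rightarrow> bool) \<Rightarrow> (nat \<Rightarrow> int) \<Rightarrow> real \<Rightarrow> real" where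
  "translation \<sigma> k = act (\<lambda>i. if \<sigma> i then k i else 0) (\<lambda>i. if \<sigma> i then 0 else k i) 0"

lemma translation_add:
  assumes "t \<in> {0..1}"
  shows "translation \<sigma> k (translation \<sigma> k' t) = translation \<sigma> (\<lambda>i. k i + k' i) t"
proof -
  have 1: "(\<lambda>i. (if \<sigma> i then k i else 0) + (if \<sigma> i then k' i else 0)) = (\<lambda>i. if \<sigma> i then k i + k' i else 0)"
    "(\<lambda>i. (if \<sigma> i then 0 else k i) + (if \<sigma> i then 0 else k' i)) = (\<lambda>i. if \<sigma> i then 0 else k i + k' i)"
    by (simp_all add: fun_eq_iff)
  have 2: "(\<Sum>i=1..n. (if \<sigma> i then k i else 0) * (if \<sigma> i then 0 else k' i)) = 0"
    by (rule sum.neutral) simp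
  show ?thesis unfolding translation_def comp[OF assms] 1 2 by simp
qed

abbreviation unit_vec :: "nat \<Rightarrow> nat \<Rightarrow> int" where
  "unit_vec i \<equiv> (\<lambda>j. if j = i then 1 else 0)"

abbreviation orbit_map :: "(nat \<Rightarrow> bool) \<Rightarrow> (nat \<Rightarrow> nat) \<Rightarrow> real \<Rightarrow> real" where
  "orbit_map \<sigma> k \<equiv> translation \<sigma> (\<lambda>i. int (k i))"

lemma orbit_map_step_up:
  assumes "t \<in> {0..1}"
  shows "orbit_map \<sigma> (step_up k i) t = translation \<sigma> (unit_vec i) (orbit_map \<sigma> k t)"
proof -
  have "(\<lambda>j. unit_vec i j + int (k j)) = (\<lambda>j. int (step_up k i j))" by (simp add: fun_eq_iff)
  then show ?thesis by (simp only: translation_add[OF assms])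
qed

lemma orbit_map_maps: "t \<in> {0..1} \<Longrightarrow> orbit_map \<sigma> k t \<in> {0..1}"
  unfolding translation_def by (rule maps)

text \<open>
  If two translates of the gap meet, they coincide, and the difference of their indices stabilises
  the gap. The stabiliser is isotropic, so for a suitable \<open>\<sigma>\<close> it contains no nonzero translation.
\<close>

lemma wandering_gap:
  assumes g: "gap a b"
  shows "\<exists>\<sigma>. \<forall>k k' j j'. k \<in> lattice_level n j \<longrightarrow> k' \<in> lattice_level n j' \<longrightarrow> k \<noteq> k' \<longrightarrow>
    \<not> (orbit_map \<sigma> k a < orbit_map \<sigma> k' b \<and> orbit_map \<sigma> k' a < orbit_map \<sigma> k b)"
proof -
  note gD = gap_D[OF g]
  define S where "S = {(x, y). act x y 0 a = a}"
  have "(\<Sum>i=1..n. x i * y' i - x' i * y i) = 0" if "(x, y) \<in> S" "(x', y') \<in> S" for x y x' y'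
    using that by (intro stabilizer_isotropic[OF g]) (simp_all add: S_def)
  then have "\<exists>\<sigma>. \<forall>k. (\<forall>i. i \<notin> {1..n} \<longrightarrow> k i = 0) \<longrightarrow>
    ((\<lambda>i. if \<sigma> i then k i else 0, \<lambda>i. if \<sigma> i then 0 else k i) \<in> S) \<longrightarrow> k = (\<lambda>_. 0)"
    by (rule isotropic_complement)
  then obtain \<sigma> where \<sigma>: "\<And>k. (\<forall>i. i \<notin> {1..n} \<longrightarrow> k i = 0) \<Longrightarrow> translation \<sigma> k a = a \<Longrightarrow> k = (\<lambda>_. 0)"
    unfolding S_def translation_def by auto
  show ?thesis
  proof (intro exI allI impI notI)
    fix k k' j j'
    assume k: "k \<in> lattice_level n j" "k' \<in> lattice_level n j'" "k \<noteq> k'"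
      and meet: "orbit_map \<sigma> k a < orbit_map \<sigma> k' b \<and> orbit_map \<sigma> k' a < orbit_map \<sigma> k b"
    have "gap (orbit_map \<sigma> k a) (orbit_map \<sigma> k b)" "gap (orbit_map \<sigma> k' a) (orbit_map \<sigma> k' b)"
      unfolding translation_def by (rule gap_image[OF g])+
    with meet have eq: "orbit_map \<sigma> k a = orbit_map \<sigma> k' a" using gaps_meet_imp_eq by blast
    let ?d = "\<lambda>i. int (k' i) - int (k i)"
    have "orbit_map \<sigma> k (translation \<sigma> ?d a) = orbit_map \<sigma> k' a"
      using translation_add[OF gD(4), of \<sigma> "\<lambda>i. int (k i)" ?d] by simp
    then have "orbit_map \<sigma> k (translation \<sigma> ?d a) = orbit_map \<sigma> k a" using eq by simp
    then have "translation \<sigma> ?d a = a"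
      using eq_iff[OF maps[OF gD(4)] gD(4)] unfolding translation_def by blast
    then have "?d = (\<lambda>_. 0)" using k(1,2) by (intro \<sigma>) (auto simp: lattice_level_def)
    then have "k = k'" by (simp add: fun_eq_iff)
    with k(3) show False by simp
  qed
qed

text \<open>
  The logarithm of the derivative of a composition is a sum along the path, and each summand varies
  over the current translate of \<open>{a..b}\<close> by at most a constant times its length to the power \<open>\<tau>\<close>.
\<close>

lemma distortion_along_path:
  assumes ab: "a \<in> {0..1}" "b \<in> {0..1}"
  shows "\<exists>C\<ge>0. \<forall>\<kappa> d. \<kappa> 0 = (\<lambda>_. 0) \<longrightarrow> (\<forall>j<d. \<exists>i\<in>{1..n}. \<kappa> (Suc j) = step_up (\<kappa> j) i) \<longrightarrow>
    log_distortion_le (C * (\<Sum>j<d. (orbit_map \<sigma> (\<kappa> j) b - orbit_map \<sigma> (\<kappa> j) a) powr \<tau>))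
      a b (orbit_map \<sigma> (\<kappa> d))"
proof -
  have "\<forall>i. \<exists>D C. (\<forall>t\<in>{0..1}. (translation \<sigma> (unit_vec i) has_real_derivative D t) (at t within {0..1})) \<and>
      (\<forall>t\<in>{0..1}. D t > 0) \<and>
      (\<forall>s\<in>{0..1}. \<forall>t\<in>{0..1}. \<bar>ln (D s) - ln (D t)\<bar> \<le> C * \<bar>s - t\<bar> powr \<tau>)"
  proof
    fix i
    from smooth[of "\<lambda>j. if \<sigma> j then unit_vec i j else 0" "\<lambda>j. if \<sigma> j then 0 else unit_vec i j" 0]
    show "\<exists>D C. (\<forall>t\<in>{0..1}. (translation \<sigma> (unit_vec i) has_real_derivative D t) (at t within {0..1})) \<and>
      (\<forall>t\<in>{0..1}. D t > 0) \<and>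
      (\<forall>s\<in>{0..1}. \<forall>t\<in>{0..1}. \<bar>ln (D s) - ln (D t)\<bar> \<le> C * \<bar>s - t\<bar> powr \<tau>)"
      unfolding translation_def log_hoelder_diff_def by (elim exE conjE) (intro exI conjI)
  qed
  then obtain D C where DC0: "\<forall>i. (\<forall>t\<in>{0..1}. (translation \<sigma> (unit_vec i) has_real_derivative D i t) (at t within {0..1})) \<and>
      (\<forall>t\<in>{0..1}. D i t > 0) \<and>
      (\<forall>s\<in>{0..1}. \<forall>t\<in>{0..1}. \<bar>ln (D i s) - ln (D i t)\<bar> \<le> C i * \<bar>s - t\<bar> powr \<tau>)"
    unfolding choice_iff by (elim exE) (rule that)
  note DC = DC0[THEN spec, THEN conjunct1] DC0[THEN spec, THEN conjunct2, THEN conjunct1]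
    DC0[THEN spec, THEN conjunct2, THEN conjunct2]
  define C0 where "C0 = (\<Sum>i=1..n. \<bar>C i\<bar>)"
  have C0: "C i \<le> C0" if "i \<in> {1..n}" for i
    using member_le_sum[of i "{1..n}" "\<lambda>i. \<bar>C i\<bar>"] that by (simp add: C0_def)
  have "0 \<le> C0" by (simp add: C0_def sum_nonneg)
  moreover have "log_distortion_le (C0 * (\<Sum>j<d. (orbit_map \<sigma> (\<kappa> j) b - orbit_map \<sigma> (\<kappa> j) a) powr \<tau>))
      a b (orbit_map \<sigma> (\<kappa> d))"
    if "\<kappa> 0 = (\<lambda>_. 0)" "\<forall>j<d. \<exists>i\<in>{1..n}. \<kappa> (Suc j) = step_up (\<kappa> j) i" for \<kappa> d
    using that
  proof (induction d)
    case 0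
    have "((\<lambda>t. t) has_real_derivative 1) (at t within {0..1})" for t :: real by (rule DERIV_ident)
    then have "(orbit_map \<sigma> (\<kappa> 0) has_real_derivative 1) (at t within {0..1})" if "t \<in> {0..1}" for t
      by (rule has_field_derivative_transform_within[OF _ _ that, where d = 1])
        (use 0 in \<open>simp_all add: translation_def ident\<close>)
    then show ?case unfolding log_distortion_le_def by (intro exI[of _ "\<lambda>_. 1"]) simp
  next
    case (Suc d)
    have "\<forall>j<d. \<exists>i\<in>{1..n}. \<kappa> (Suc j) = step_up (\<kappa> j) i"
      using Suc.prems(2) by (meson less_SucI)
    from Suc.IH[OF Suc.prems(1) this] obtain E where E: "\<forall>t\<in>{0..1}. (orbit_map \<sigma> (\<kappa> d) has_real_derivative E t) (at t within {0..1})"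
      "\<forall>t\<in>{0..1}. E t > 0"
      "\<forall>s\<in>{a..b}. \<forall>t\<in>{a..b}. ln (E s) - ln (E t) \<le>
        C0 * (\<Sum>j<d. (orbit_map \<sigma> (\<kappa> j) b - orbit_map \<sigma> (\<kappa> j) a) powr \<tau>)"
      unfolding log_distortion_le_def by (elim exE conjE) (rule that)
    obtain i where i: "i \<in> {1..n}" "\<kappa> (Suc d) = step_up (\<kappa> d) i" using Suc.prems(2) by blast
    let ?g = "translation \<sigma> (unit_vec i)" and ?\<phi> = "orbit_map \<sigma> (\<kappa> d)"
    define E' where "E' = (\<lambda>t. D i (?\<phi> t) * E t)"
    have der: "(orbit_map \<sigma> (\<kappa> (Suc d)) has_real_derivative E' t) (at t within {0..1})" if t: "t \<in> {0..1}" for t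
    proof -
      have "(?g has_real_derivative D i (?\<phi> t)) (at (?\<phi> t) within ?\<phi> ` {0..1})"
        by (rule has_field_derivative_subset[OF bspec[OF DC(1) orbit_map_maps[OF t]]])
          (use orbit_map_maps in blast)
      from DERIV_image_chain[OF this bspec[OF E(1) t]]
      have "(?g \<circ> ?\<phi> has_real_derivative E' t) (at t within {0..1})" unfolding E'_def .
      then show ?thesis
        by (rule has_field_derivative_transform_within[OF _ _ t, where d = 1])
          (simp_all only: i(2) orbit_map_step_up comp_apply zero_less_one)
    qed
    have pos: "E' t > 0" if "t \<in> {0..1}" for t
      unfolding E'_def by (rule mult_pos_pos[OF bspec[OF DC(2) orbit_map_maps[OF that]] bspec[OF E(2) that]])
    have dist: "ln (E' s) - ln (E' t) \<le> C0 * (\<Sum>j<Suc d. (orbit_map \<sigma> (\<kappa> j) b - orbit_map \<sigma> (\<kappa> j) a) powr \<tau>)"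
      if st: "s \<in> {a..b}" "t \<in> {a..b}" for s t
    proof -
      have st01: "s \<in> {0..1}" "t \<in> {0..1}" using st ab by auto
      have mono_le: "?\<phi> u \<le> ?\<phi> v" if "u \<le> v" "u \<in> {0..1}" "v \<in> {0..1}" for u v
        using that less_iff[of v u] unfolding translation_def by (simp add: not_less[symmetric])
      have "\<bar>?\<phi> s - ?\<phi> t\<bar> \<le> ?\<phi> b - ?\<phi> a"
        using mono_le[of a s] mono_le[of a t] mono_le[of s b] mono_le[of t b] st st01 ab by simp
      then have pw: "\<bar>?\<phi> s - ?\<phi> t\<bar> powr \<tau> \<le> (?\<phi> b - ?\<phi> a) powr \<tau>" using \<tau>_pos by (intro powr_mono2) simp_all
      have "ln (D i (?\<phi> s)) - ln (D i (?\<phi> t)) \<le> C i * \<bar>?\<phi> s - ?\<phi> t\<bar> powr \<tau>"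
        using bspec[OF bspec[OF DC(3)[of i] orbit_map_maps[OF st01(1), of \<sigma> "\<kappa> d"]] orbit_map_maps[OF st01(2), of \<sigma> "\<kappa> d"]] by linarith
      also have "\<dots> \<le> C0 * \<bar>?\<phi> s - ?\<phi> t\<bar> powr \<tau>" by (rule mult_right_mono[OF C0[OF i(1)] powr_ge_zero])
      also have "\<dots> \<le> C0 * (?\<phi> b - ?\<phi> a) powr \<tau>" by (rule mult_left_mono[OF pw \<open>0 \<le> C0\<close>])
      finally have 1: "ln (D i (?\<phi> s)) - ln (D i (?\<phi> t)) \<le> C0 * (?\<phi> b - ?\<phi> a) powr \<tau>" .
      have ln_E': "ln (E' r) = ln (D i (?\<phi> r)) + ln (E r)" if "r \<in> {0..1}" for r
        unfolding E'_def
        by (rule ln_mult_pos[OF bspec[OF DC(2) orbit_map_maps[OF that]] bspec[OF E(2) that]])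
      show ?thesis
        using 1 bspec[OF bspec[OF E(3) st(1)] st(2)] unfolding ln_E'[OF st01(1)] ln_E'[OF st01(2)]
        by (simp add: distrib_left)
    qed
    show ?case unfolding log_distortion_le_def using der pos dist by (intro exI[of _ E'] conjI ballI)
  qed
  ultimately show ?thesis by (intro exI[of _ C0] conjI allI impI)
qed

text \<open>
  The translates of a gap are disjoint, so their lengths have sum at most \<open>1\<close>. Hence there are
  lattice paths of every length \<open>d\<close> along which the distortion is bounded independently of \<open>d\<close>, while
  the gap at the end of the path becomes arbitrarily short for suitable \<open>d\<close>.
\<close>

theorem central_element_trivial:
  assumes n: "n \<ge> 1" and \<tau>: "\<tau> = 1 \<or> (1 / real n < \<tau> \<and> \<tau> < 1)" and t0: "t0 \<in> {0..1}"
  shows "central 1 t0 = t0"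
proof (rule ccontr)
  assume "central 1 t0 \<noteq> t0"
  then obtain a b where g: "gap a b" using gap_exists t0 by blast
  note gD = gap_D[OF g]
  obtain \<sigma> where wander: "\<And>k k' j j'. k \<in> lattice_level n j \<Longrightarrow> k' \<in> lattice_level n j' \<Longrightarrow> k \<noteq> k' \<Longrightarrow>
    \<not> (orbit_map \<sigma> k a < orbit_map \<sigma> k' b \<and> orbit_map \<sigma> k' a < orbit_map \<sigma> k b)"
    using wandering_gap[OF g] by blast
  define len where "len k = orbit_map \<sigma> k b - orbit_map \<sigma> k a" for k
  have len_pos: "len k > 0" for k
    using less_iff[OF gD(4,5)] gD(2) unfolding len_def translation_def by simp
  have total: "(\<Sum>j<d. \<Sum>k\<in>lattice_level n j. len k) \<le> 1" for d
  proof -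
    let ?K = "SIGMA j:{..<d}. lattice_level n j"
    have "(\<Sum>j<d. \<Sum>k\<in>lattice_level n j. len k) = (\<Sum>p\<in>?K. len (snd p))"
      by (subst sum.Sigma) (simp_all add: case_prod_unfold)
    also have "\<dots> \<le> 1"
      unfolding len_def
    proof (rule sum_lengths_disjoint_intervals_le_1)
      show "finite ?K" by simp
    next
      fix p
      show "0 \<le> orbit_map \<sigma> (snd p) a \<and> orbit_map \<sigma> (snd p) a < orbit_map \<sigma> (snd p) b \<and> orbit_map \<sigma> (snd p) b \<le> 1"
        using len_pos[of "snd p"] orbit_map_maps[OF gD(4), of \<sigma> "snd p"] orbit_map_maps[OF gD(5), of \<sigma> "snd p"]
        by (simp add: len_def)
    next
      fix p p' assume p: "p \<in> ?K" "p' \<in> ?K" "p \<noteq> p'"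
      have "snd p \<noteq> snd p'"
      proof
        assume eq: "snd p = snd p'"
        have "fst p = fst p'" using p(1,2) eq by (auto simp: lattice_level_def)
        with eq p(3) show False by (simp add: prod_eq_iff)
      qed
      then show "\<not> (orbit_map \<sigma> (snd p) a < orbit_map \<sigma> (snd p') b \<and> orbit_map \<sigma> (snd p') a < orbit_map \<sigma> (snd p) b)"
        using p(1,2) by (intro wander[of "snd p" "fst p" "snd p'" "fst p'"]) auto
    qed
    finally show ?thesis .
  qed
  obtain B where B: "\<And>d. (\<Sum>j<d. level_average n (\<lambda>k. len k powr \<tau>) j) \<le> B"
    using level_average_powr_bound[OF n \<tau> _ total] less_imp_le[OF len_pos] by metis
  have "\<exists>\<kappa>. \<kappa> 0 = (\<lambda>_. 0) \<and> (\<forall>j<d. \<exists>i\<in>{1..n}. \<kappa> (Suc j) = step_up (\<kappa> j) i) \<and>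
      (\<Sum>j<d. len (\<kappa> j) powr \<tau>) \<le> B" for d
    by (rule cheap_lattice_path[OF n, of d "\<lambda>k. len k powr \<tau>"]) (use B[of d] order_trans in blast)
  then obtain \<kappa> where \<kappa>: "\<And>d. \<kappa> d 0 = (\<lambda>_. 0)"
    "\<And>d. \<forall>j<d. \<exists>i\<in>{1..n}. \<kappa> d (Suc j) = step_up (\<kappa> d j) i"
    "\<And>d. (\<Sum>j<d. len (\<kappa> d j) powr \<tau>) \<le> B" by metis
  have level: "j \<le> d \<Longrightarrow> \<kappa> d j \<in> lattice_level n j" for d j
  proof (induction j)
    case 0
    show ?case by (simp add: lattice_level_0 \<kappa>(1))
  next
    case (Suc j)
    have "j < d" using Suc.prems by simp
    then obtain i where i: "i \<in> {1..n}" "\<kappa> d (Suc j) = step_up (\<kappa> d j) i" using \<kappa>(2)[of d] by blast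
    show ?case unfolding i(2) by (rule step_up_in_lattice_level[OF Suc.IH i(1)]) (use \<open>j < d\<close> in simp)
  qed
  have short: "\<exists>d. len (\<kappa> d d) < e" if e: "e > 0" for e
  proof (rule ccontr)
    assume "\<not> ?thesis"
    then have ge: "e \<le> len (\<kappa> d d)" for d by (simp add: not_less)
    obtain M where M: "1 < real M * e" using spec[OF reals_Archimedean3[OF e], of 1] by (elim exE) (rule that)
    have "real M * e = (\<Sum>d<M. e)" by simp
    also have "\<dots> \<le> (\<Sum>d<M. \<Sum>k\<in>lattice_level n d. len k)"
    proof (rule sum_mono)
      fix d
      have "len (\<kappa> d d) \<le> (\<Sum>k\<in>lattice_level n d. len k)"
        by (rule member_le_sum) (use level less_imp_le[OF len_pos] in auto)
      with ge[of d] show "e \<le> (\<Sum>k\<in>lattice_level n d. len k)" by linarith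
    qed
    also have "\<dots> \<le> 1" by (rule total)
    finally show False using M by simp
  qed
  obtain C where C: "C \<ge> 0" and Cdist: "\<forall>\<kappa> d. \<kappa> 0 = (\<lambda>_. 0) \<longrightarrow> (\<forall>j<d. \<exists>i\<in>{1..n}. \<kappa> (Suc j) = step_up (\<kappa> j) i) \<longrightarrow>
    log_distortion_le (C * (\<Sum>j<d. (orbit_map \<sigma> (\<kappa> j) b - orbit_map \<sigma> (\<kappa> j) a) powr \<tau>))
      a b (orbit_map \<sigma> (\<kappa> d))"
    using distortion_along_path[OF gD(4,5), of \<sigma>] by (elim exE conjE) (rule that)
  obtain c' where c': "\<forall>t\<in>{0..1}. (central 1 has_real_derivative c' t) (at t within {0..1})"
    "continuous_on {0..1} c'"
    using smooth[of "\<lambda>_. 0" "\<lambda>_. 0" 1] unfolding log_hoelder_diff_def by (elim exE conjE) (rule that)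
  show False
  proof (rule bounded_distortion_along_wandering_intervals_impossible[where f = "central 1" and f' = c'
        and a = a and b = b and B = "exp (C * B)"])
    show "\<And>x. x \<in> {0..1} \<Longrightarrow> central 1 x \<in> {0..1}" by (rule maps)
    show "strict_mono_on {0..1} (central 1)" by (rule mono)
    show "\<forall>x\<in>{0..1}. (central 1 has_real_derivative c' x) (at x within {0..1})" by (rule c'(1))
    show "continuous_on {0..1} c'" by (rule c'(2))
    show "0 \<le> a" "a < b" "b \<le> 1" "central 1 a = a" "central 1 b = b" by (rule gD)+
    show "\<And>x. a < x \<Longrightarrow> x < b \<Longrightarrow> central 1 x \<noteq> x" by (rule gD(8))
    show "0 < exp (C * B)" by simp
    fix e :: real assume "e > 0"
    then obtain d where d: "len (\<kappa> d d) < e" using short by blast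
    obtain D where D: "\<forall>t\<in>{0..1}. (orbit_map \<sigma> (\<kappa> d d) has_real_derivative D t) (at t within {0..1})"
      "\<forall>t\<in>{0..1}. D t > 0"
      "\<forall>s\<in>{a..b}. \<forall>t\<in>{a..b}. ln (D s) - ln (D t) \<le>
        C * (\<Sum>j<d. (orbit_map \<sigma> (\<kappa> d j) b - orbit_map \<sigma> (\<kappa> d j) a) powr \<tau>)"
      using Cdist[THEN spec[of _ "\<kappa> d"], THEN spec[of _ d], THEN mp, THEN mp, OF \<kappa>(1) \<kappa>(2)]
      unfolding log_distortion_le_def by (elim exE conjE) (rule that)
    have ratio: "D s \<le> exp (C * B) * D t" if st: "s \<in> {a..b}" "t \<in> {a..b}" for s t
    proof -
      have st01: "s \<in> {0..1}" "t \<in> {0..1}" using st gD(1,3) by auto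
      have "ln (D s) - ln (D t) \<le> C * (\<Sum>j<d. len (\<kappa> d j) powr \<tau>)"
        unfolding len_def by (rule bspec[OF bspec[OF D(3) st(1)] st(2)])
      also have "\<dots> \<le> C * B" by (rule mult_left_mono[OF \<kappa>(3) C])
      finally have "exp (ln (D s)) \<le> exp (C * B + ln (D t))" by simp
      then show ?thesis using D(2) st01 by (simp add: exp_add)
    qed
    have F: "\<forall>x\<in>{0..1}. orbit_map \<sigma> (\<kappa> d d) x \<in> {0..1}" "strict_mono_on {0..1} (orbit_map \<sigma> (\<kappa> d d))"
      "\<forall>x\<in>{0..1}. orbit_map \<sigma> (\<kappa> d d) (central 1 x) = central 1 (orbit_map \<sigma> (\<kappa> d d) x)"
      unfolding translation_def by (intro ballI maps, assumption, rule mono, intro ballI central_commutes, assumption)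
    have ratio': "\<forall>x\<in>{a..b}. \<forall>y\<in>{a..b}. D x \<le> exp (C * B) * D y" by (intro ballI ratio)
    show "\<exists>\<psi> \<psi>'. (\<forall>x\<in>{0..1}. \<psi> x \<in> {0..1}) \<and> strict_mono_on {0..1} \<psi> \<and>
      (\<forall>x\<in>{0..1}. (\<psi> has_real_derivative \<psi>' x) (at x within {0..1})) \<and> (\<forall>x\<in>{0..1}. \<psi>' x > 0) \<and>
      (\<forall>x\<in>{0..1}. \<psi> (central 1 x) = central 1 (\<psi> x)) \<and> (\<forall>x\<in>{a..b}. \<forall>y\<in>{a..b}. \<psi>' x \<le> exp (C * B) * \<psi>' y) \<and>
      \<psi> b - \<psi> a < e"
      by (intro exI[of _ "orbit_map \<sigma> (\<kappa> d d)"] exI[of _ D] conjI F D(1,2) ratio' d[unfolded len_def])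
  qed
qed

end

section \<open>No embedding above the critical regularity\<close>

lemma deriv01_0 [simp]: "deriv01 0 f = f"
  by (simp add: deriv01_def)

lemma deriv01_Suc: "deriv01 (Suc k) f = (\<lambda>x. vector_derivative (deriv01 k f) (at x within {0..1}))"
  by (simp add: deriv01_def)

lemma deriv01_works:
  assumes "C01 m f" "k < m"
  shows "\<forall>t\<in>{0..1}. (deriv01 k f has_real_derivative deriv01 (Suc k) f t) (at t within {0..1})"
    "continuous_on {0..1} (deriv01 (Suc k) f)"
proof -
  have d: "deriv01 k f differentiable_on {0..1}" if "k < m" for k using assms(1) that by (auto simp: C01_def)
  show "\<forall>t\<in>{0..1}. (deriv01 k f has_real_derivative deriv01 (Suc k) f t) (at t within {0..1})"
    using d[OF assms(2)]
    by (simp add: deriv01_Suc differentiable_on_def vector_derivative_works[symmetric]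
        has_real_derivative_iff_has_vector_derivative)
  show "continuous_on {0..1} (deriv01 (Suc k) f)"
  proof (cases "Suc k = m")
    case True
    then show ?thesis using assms(1) by (simp add: C01_def)
  next
    case False
    then show ?thesis using d[of "Suc k"] assms(2) by (intro differentiable_imp_continuous_on) simp
  qed
qed

lemma Bij01_inv_into:
  assumes "f \<in> Bij {0..1 :: real}" "t \<in> {0..1}"
  shows "f t \<in> {0..1}" "inv_into {0..1} f (f t) = t"
  using assms by (auto simp: Bij_def bij_betw_def intro: inv_into_f_f simp del: atLeastAtMost_iff)

text \<open>
  The derivative never vanishes because the inverse map is differentiable too. It is continuous, and
  it is positive somewhere by the mean value theorem.
\<close>

lemma deriv01_pos:
  assumes f: "f \<in> Diff01 m \<alpha>" and m: "0 < m" and t: "t \<in> {0..1}"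
  shows "deriv01 1 f t > 0"
proof -
  let ?g = "inv_into {0..1} f"
  have B: "f \<in> Bij {0..1}" and C: "C01 m f" "C01 m ?g" and mono: "strict_mono_on {0..1} f"
    using f by (auto simp: Diff01_def)
  note F = deriv01_works[OF C(1) m, unfolded deriv01_0 One_nat_def[symmetric]]
  note G = deriv01_works[OF C(2) m, unfolded deriv01_0 One_nat_def[symmetric]]
  have nz: "deriv01 1 f s \<noteq> 0" if s: "s \<in> {0..1}" for s
  proof -
    have "(?g has_real_derivative deriv01 1 ?g (f s)) (at (f s) within f ` {0..1})"
      by (rule has_field_derivative_subset[OF bspec[OF G(1) Bij01_inv_into(1)[OF B s]]])
        (use Bij01_inv_into(1)[OF B] in blast)
    from DERIV_image_chain[OF this bspec[OF F(1) s]]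
    have "(?g \<circ> f has_real_derivative deriv01 1 ?g (f s) * deriv01 1 f s) (at s within {0..1})" .
    then have "((\<lambda>r. r) has_real_derivative deriv01 1 ?g (f s) * deriv01 1 f s) (at s within {0..1})"
      by (rule has_field_derivative_transform_within[OF _ _ s, where d = 1])
        (simp_all only: comp_apply Bij01_inv_into(2)[OF B] zero_less_one)
    moreover have "((\<lambda>r. r) has_real_derivative 1) (at s within {0..1})" by (rule DERIV_ident)
    ultimately have "deriv01 1 ?g (f s) * deriv01 1 f s = 1"
      using vector_derivative_unique_within_closed_interval[of 0 1 s "\<lambda>r. r"] s
      by (simp add: has_real_derivative_iff_has_vector_derivative)
    then show ?thesis by auto
  qed
  obtain z where z: "0 < z" "z < 1" "f 1 - f 0 = deriv01 1 f z * (1 - 0)"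
    using mean_value_within_01[OF F(1), of 0 1] by auto
  have "f 0 < f 1" using strict_mono_onD[OF mono, of 0 1] by simp
  with z have z_pos: "deriv01 1 f z > 0" by simp
  have con: "connected (deriv01 1 f ` {0..1})" by (rule connected_continuous_image[OF F(2)]) simp
  show ?thesis
  proof (rule ccontr)
    assume "\<not> ?thesis"
    then have "0 \<in> deriv01 1 f ` {0..1}"
      using connectedD_interval[OF con imageI[OF t] imageI[of z "{0..1}"]] z z_pos by simp
    with nz show False by (metis imageE)
  qed
qed

lemma Diff01_hoelder:
  assumes f: "f \<in> Diff01 m \<alpha>" and m: "m = 1 \<and> \<tau> = \<alpha> \<or> m \<ge> 2 \<and> \<tau> = 1"
  shows "\<exists>C. \<forall>s\<in>{0..1}. \<forall>t\<in>{0..1}. \<bar>deriv01 1 f s - deriv01 1 f t\<bar> \<le> C * \<bar>s - t\<bar> powr \<tau>"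
proof (cases "m = 1")
  case True
  with f m show ?thesis by (auto simp: Diff01_def hoelder_on_def)
next
  case False
  with m have m: "1 < m" "\<tau> = 1" by auto
  have C: "C01 m f" using f by (simp add: Diff01_def)
  note F = deriv01_works[OF C m(1)]
  have "bounded (deriv01 (Suc 1) f ` {0..1})"
    by (intro compact_imp_bounded compact_continuous_image F(2)) simp
  then obtain M where M: "\<forall>t\<in>{0..1}. \<bar>deriv01 (Suc 1) f t\<bar> \<le> M"
    by (auto simp: bounded_iff)
  have lt: "\<bar>deriv01 1 f t - deriv01 1 f s\<bar> \<le> M * (t - s)" if st: "0 \<le> s" "s < t" "t \<le> 1" for s t
  proof -
    obtain z where z: "s < z" "z < t" "deriv01 1 f t - deriv01 1 f s = deriv01 (Suc 1) f z * (t - s)"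
      using mean_value_within_01[OF F(1) st] by (elim exE conjE) (rule that)
    have "\<bar>deriv01 (Suc 1) f z\<bar> * (t - s) \<le> M * (t - s)"
      using M z(1,2) st by (intro mult_right_mono) simp_all
    then show ?thesis using z st by (simp add: abs_mult)
  qed
  show ?thesis
  proof (intro exI ballI)
    fix s t :: real assume st: "s \<in> {0..1}" "t \<in> {0..1}"
    consider "s < t" | "s = t" | "t < s" by linarith
    then have "\<bar>deriv01 1 f s - deriv01 1 f t\<bar> \<le> M * \<bar>s - t\<bar>"
    proof cases
      case 1
      then show ?thesis using lt[of s t] st by simp
    next
      case 3
      then show ?thesis using lt[of t s] st by simp
    qed simp
    then show "\<bar>deriv01 1 f s - deriv01 1 f t\<bar> \<le> M * \<bar>s - t\<bar> powr \<tau>" using m(2) by simp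
  qed
qed

lemma Diff01_log_deriv:
  assumes f: "f \<in> Diff01 m \<alpha>" and m: "m = 1 \<and> \<tau> = \<alpha> \<or> m \<ge> 2 \<and> \<tau> = 1"
  shows "log_hoelder_diff \<tau> f"
proof -
  have m0: "0 < m" using m by auto
  have C: "C01 m f" using f by (simp add: Diff01_def)
  note F = deriv01_works[OF C m0, unfolded deriv01_0 One_nat_def[symmetric]]
  let ?F = "deriv01 1 f"
  have pos: "\<forall>t\<in>{0..1}. ?F t > 0" using deriv01_pos[OF f m0] by blast
  obtain K where K: "\<forall>s\<in>{0..1}. \<forall>t\<in>{0..1}. \<bar>?F s - ?F t\<bar> \<le> K * \<bar>s - t\<bar> powr \<tau>"
    using Diff01_hoelder[OF f m] by blast
  obtain p where p: "p \<in> {0..1}" "\<forall>t\<in>{0..1}. ?F p \<le> ?F t"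
    using continuous_attains_inf[OF compact_Icc _ F(2)] by auto
  have p0: "?F p > 0" using pos p(1) by blast
  have le: "ln (?F s) - ln (?F t) \<le> K / ?F p * \<bar>s - t\<bar> powr \<tau>" if st: "s \<in> {0..1}" "t \<in> {0..1}" for s t
  proof -
    have "ln (?F s) - ln (?F t) \<le> (?F s - ?F t) / ?F t"
      using pos st by (intro ln_diff_le) auto
    also have "\<dots> \<le> \<bar>?F s - ?F t\<bar> / ?F t"
      using pos st by (intro divide_right_mono) (auto intro: less_imp_le)
    also have "\<dots> \<le> \<bar>?F s - ?F t\<bar> / ?F p"
      by (rule divide_left_mono[OF bspec[OF p(2) st(2)] abs_ge_zero mult_pos_pos[OF bspec[OF pos st(2)] p0]])
    also have "\<dots> \<le> K * \<bar>s - t\<bar> powr \<tau> / ?F p"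
      using K st p0 by (intro divide_right_mono) (auto intro: less_imp_le)
    finally show ?thesis by simp
  qed
  have "\<bar>ln (?F s) - ln (?F t)\<bar> \<le> K / ?F p * \<bar>s - t\<bar> powr \<tau>" if st: "s \<in> {0..1}" "t \<in> {0..1}" for s t
    using le[OF st] le[OF st(2,1)] by (simp add: abs_le_iff abs_minus_commute)
  then have "\<forall>s\<in>{0..1}. \<forall>t\<in>{0..1}. \<bar>ln (?F s) - ln (?F t)\<bar> \<le> K / ?F p * \<bar>s - t\<bar> powr \<tau>" by simp
  with F pos show ?thesis unfolding log_hoelder_diff_def by (intro exI[of _ ?F] exI[of _ "K / ?F p"] conjI)
qed

text \<open>
  For \<open>m \<ge> 2\<close> the first derivative is Lipschitz, which is the case \<open>\<tau> = 1\<close>. So the central generator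
  would act trivially, against injectivity.
\<close>

lemma heisenberg_not_embeds:
  assumes n: "n \<ge> 1" and m: "m = 1 \<and> 1 / real n < \<alpha> \<and> \<alpha> < 1 \<or> m \<ge> 2"
  shows "\<not> embeds (heisenberg_group n) (Diff01_group m \<alpha>)"
proof
  define \<tau> where "\<tau> = (if m = 1 then \<alpha> else 1)"
  have m\<tau>: "m = 1 \<and> \<tau> = \<alpha> \<or> m \<ge> 2 \<and> \<tau> = 1" using m by (auto simp: \<tau>_def)
  have \<tau>: "\<tau> = 1 \<or> (1 / real n < \<tau> \<and> \<tau> < 1)" using m by (auto simp: \<tau>_def)
  have \<tau>0: "\<tau> > 0"
  proof -
    have "1 / real n > 0" using n by simp
    then show ?thesis using \<tau> by linarith
  qed
  assume "embeds (heisenberg_group n) (Diff01_group m \<alpha>)"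
  then obtain h where h: "h \<in> mon (heisenberg_group n) (Diff01_group m \<alpha>)" by (auto simp: embeds_def)
  let ?M = "heisenberg_mat n"
  have car: "?M x y z \<in> carrier (heisenberg_group n)" for x y z by (auto simp: heisenberg_group_def)
  have D: "h (?M x y z) \<in> Diff01 m \<alpha>" for x y z
    using h car[of x y z] by (auto simp: mon_def hom_def Diff01_group_def)
  then have Bij: "h (?M x y z) \<in> Bij {0..1}" for x y z by (simp add: Diff01_def)
  have mult: "h (?M x y z * ?M x' y' z') = compose {0..1} (h (?M x y z)) (h (?M x' y' z'))" for x y z x' y' z'
  proof -
    have "h (?M x y z \<otimes>\<^bsub>heisenberg_group n\<^esub> ?M x' y' z') =
        h (?M x y z) \<otimes>\<^bsub>Diff01_group m \<alpha>\<^esub> h (?M x' y' z')"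
      using h car by (auto simp: mon_def hom_def)
    then show ?thesis using Bij by (simp add: heisenberg_group_def Diff01_group_def BijGroup_def)
  qed
  define act where "act x y z = h (?M x y z)" for x y z
  interpret smooth_heisenberg_action n act \<tau>
  proof
    fix x y x' y' :: "nat \<Rightarrow> int" and z z' :: int and t :: real
    show maps: "t \<in> {0..1} \<Longrightarrow> act x y z t \<in> {0..1}" for x y z t
      unfolding act_def by (rule Bij01_inv_into(1)[OF Bij])
    show mono: "strict_mono_on {0..1} (act x y z)" for x y z
      unfolding act_def using D[of x y z] by (simp add: Diff01_def)
    show "continuous_on {0..1} (act x y z)"
      unfolding act_def using D[of x y z] by (intro C01_imp_continuous_on[of m]) (simp add: Diff01_def)
    show comp: "t \<in> {0..1} \<Longrightarrow> act x y z (act x' y' z' t) =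
      act (\<lambda>i. x i + x' i) (\<lambda>i. y i + y' i) (z + z' + (\<Sum>i=1..n. x i * y' i)) t" for x y z x' y' z' t
      unfolding act_def heisenberg_mat_mult[symmetric] mult by (simp add: compose_eq)
    show "act (\<lambda>_. 0) (\<lambda>_. 0) 0 t = t" if t: "t \<in> {0..1}"
    proof -
      have "act (\<lambda>_. 0) (\<lambda>_. 0) 0 (act (\<lambda>_. 0) (\<lambda>_. 0) 0 t) = act (\<lambda>_. 0) (\<lambda>_. 0) 0 t"
        by (simp add: comp[OF t])
      then show ?thesis using strict_mono_on_eq[OF mono maps[OF t] t] by blast
    qed
    show "log_hoelder_diff \<tau> (act x y z)"
      unfolding act_def by (rule Diff01_log_deriv[OF D m\<tau>])
    show "0 < \<tau>" by (rule \<tau>0)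
  qed
  have "h (?M (\<lambda>_. 0) (\<lambda>_. 0) 1) = h (?M (\<lambda>_. 0) (\<lambda>_. 0) 0)"
  proof (rule extensionalityI[of _ "{0..1}"])
    show "h (?M (\<lambda>_. 0) (\<lambda>_. 0) 1) \<in> extensional {0..1}" "h (?M (\<lambda>_. 0) (\<lambda>_. 0) 0) \<in> extensional {0..1}"
      using Bij by (simp_all add: Bij_def)
    fix t :: real assume t: "t \<in> {0..1}"
    show "h (?M (\<lambda>_. 0) (\<lambda>_. 0) 1) t = h (?M (\<lambda>_. 0) (\<lambda>_. 0) 0) t"
      using central_element_trivial[OF n \<tau> t] ident[OF t] by (simp add: act_def)
  qed
  then have "?M (\<lambda>_. 0) (\<lambda>_. 0) 1 = ?M (\<lambda>_. 0) (\<lambda>_. 0) 0"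
    using h car by (auto simp: mon_def dest: inj_onD)
  then have "?M (\<lambda>_. 0) (\<lambda>_. 0) 1 $$ (0, n + 1) = ?M (\<lambda>_. 0) (\<lambda>_. 0) 0 $$ (0, n + 1)" by simp
  then show False by (simp add: heisenberg_mat_def)
qed

section \<open>A profile and its time changes\<close>

lemma antiderivative_exists:
  fixes f :: "real \<Rightarrow> real"
  assumes "continuous_on UNIV f"
  shows "\<exists>F. \<forall>x. (F has_real_derivative f x) (at x)"
proof (intro exI allI)
  fix x :: real
  have "((\<lambda>u. LBINT y=0..u. f y) has_vector_derivative f x) (at x within {-(\<bar>x\<bar> + 1)..\<bar>x\<bar> + 1})"
    unfolding zero_ereal_def
    by (rule interval_integral_FTC2) (auto intro: continuous_on_subset[OF assms])
  moreover have "at x within {-(\<bar>x\<bar> + 1)..\<bar>x\<bar> + 1} = at x"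
    by (rule at_within_Icc_at) auto
  ultimately show "((\<lambda>u. LBINT y=0..u. f y) has_real_derivative f x) (at x)"
    by (simp add: has_real_derivative_iff_has_vector_derivative)
qed

lemma profile_antiderivative_bounded:
  fixes F :: "real \<Rightarrow> real"
  assumes r: "1 / 2 < r" and F: "\<And>x. (F has_real_derivative (1 + x\<^sup>2) powr (- r)) (at x)"
  shows "\<exists>M. \<forall>x. F x \<le> M"
proof -
  let ?s = "2 * r - 1"
  define H where "H = (\<lambda>x. F x + x powr (- ?s) / ?s)"
  have s: "?s > 0" using r by simp
  have "H y \<le> H x" if "1 \<le> x" "x \<le> y" for x y
  proof (rule DERIV_nonpos_imp_nonincreasing[OF that(2)])
    fix t assume t: "x \<le> t" "t \<le> y"
    then have t0: "t > 0" using that by linarith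
    have e: "- ?s - 1 = - 2 * r" by simp
    have "((\<lambda>x. x powr (- ?s) / ?s) has_real_derivative - ?s * t powr (- 2 * r) / ?s) (at t)"
      using DERIV_cdivide[OF has_real_derivative_powr[OF t0, of "- ?s"], of ?s] unfolding e .
    also have "- ?s * t powr (- 2 * r) / ?s = - (t powr (- 2 * r))"
    proof -
      have "- q * x / q = - x" if "q > 0" for q x :: real using that by simp
      from this[OF s] show ?thesis .
    qed
    finally have "(H has_real_derivative (1 + t\<^sup>2) powr (- r) + - (t powr (- 2 * r))) (at t)"
      unfolding H_def by (rule DERIV_add[OF F])
    moreover have "(1 + t\<^sup>2) powr (- r) \<le> (t\<^sup>2) powr (- r)"
      using t0 r by (intro powr_mono2') auto
    moreover have "(t\<^sup>2) powr (- r) = t powr (- 2 * r)"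
    proof -
      have "t\<^sup>2 = t powr 2" using t0 by simp
      moreover have "2 * (- r) = - 2 * r" by simp
      ultimately show ?thesis by (simp only: powr_powr)
    qed
    ultimately show "\<exists>d. (H has_real_derivative d) (at t) \<and> d \<le> 0"
      by (intro exI[of _ "(1 + t\<^sup>2) powr (- r) + - (t powr (- 2 * r))"] conjI) simp_all
  qed
  moreover have "F x \<le> H x" for x using s by (simp add: H_def)
  ultimately have "F x \<le> H 1" if "1 \<le> x" for x using order_trans[of "F x" "H x" "H 1"] that by simp
  moreover have "F x \<le> F 1" if "x \<le> 1" for x
  proof (rule DERIV_nonneg_imp_nondecreasing[OF that])
    fix t show "\<exists>d. (F has_real_derivative d) (at t) \<and> 0 \<le> d"
      by (intro exI[of _ "(1 + t\<^sup>2) powr (- r)"] conjI F) simp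
  qed
  ultimately have bd: "1 \<le> x \<Longrightarrow> F x \<le> H 1" "x \<le> 1 \<Longrightarrow> F x \<le> F 1" for x by blast+
  have "F x \<le> max (F 1) (H 1)" for x using bd[of x] by (cases "x \<le> 1") simp_all
  then show ?thesis by blast
qed

text \<open>
  The function \<open>\<Psi>\<close> identifies the real line with \<open>{0<..<1}\<close>. Its decay exponent \<open>2 * r\<close> is a parameter
  because it determines how the length of an interval relates to the time scale on it.
\<close>

lemma profile_exists:
  fixes r :: real
  assumes r: "1 / 2 < r"
  shows "\<exists>\<Psi> c. 0 < c \<and> (\<forall>v. (\<Psi> has_real_derivative c * (1 + v\<^sup>2) powr (- r)) (at v)) \<and>
    (\<forall>v. 0 < \<Psi> v \<and> \<Psi> v < 1) \<and> (\<forall>u. 0 < u \<and> u < 1 \<longrightarrow> (\<exists>v. \<Psi> v = u))"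
proof -
  let ?f = "\<lambda>x::real. (1 + x\<^sup>2) powr (- r)"
  have nz: "1 + x\<^sup>2 \<noteq> (0::real)" for x using zero_le_power2[of x] by linarith
  have "continuous_on UNIV ?f" by (intro continuous_intros) (use nz in auto)
  from antiderivative_exists[OF this] obtain F where F: "\<And>x. (F has_real_derivative ?f x) (at x)" by (elim exE) (rule that, erule spec)
  obtain M where M: "\<And>x. F x \<le> M" using profile_antiderivative_bounded[OF r F] by (elim exE) (rule that, erule spec)
  have G: "((\<lambda>x. - F (- x)) has_real_derivative ?f x) (at x)" for x
    using DERIV_minus[OF DERIV_chain'[OF DERIV_minus[OF DERIV_ident] F]] by simp
  obtain M' where M': "\<And>x. - F (- x) \<le> M'" using profile_antiderivative_bounded[OF r G] by (elim exE) (rule that, erule spec)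
  have lower: "- M' \<le> F x" for x using M'[of "- x"] by simp
  have mono: "F x < F y" if "x < y" for x y
  proof (rule DERIV_pos_imp_increasing[OF that])
    fix t show "\<exists>d. (F has_real_derivative d) (at t) \<and> d > 0"
      using F[of t] nz[of t] by (intro exI[of _ "?f t"]) simp
  qed
  define S I where "S = Sup (range F)" and "I = Inf (range F)"
  have bdd: "bdd_above (range F)" "bdd_below (range F)" using M lower by (auto intro!: bdd_aboveI[of _ M] bdd_belowI[of _ "- M'"])
  have SI: "I < F x" "F x < S" for x
  proof -
    have "I \<le> F (x - 1)" "F (x + 1) \<le> S" unfolding S_def I_def
      by (rule cInf_lower[OF rangeI bdd(2)], rule cSup_upper[OF rangeI bdd(1)])
    then show "I < F x" "F x < S" using mono[of "x - 1" x] mono[of x "x + 1"] by simp_all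
  qed
  define \<Psi> where "\<Psi> x = (F x - I) / (S - I)" for x
  have pos: "S - I > 0" using SI[of 0] by simp
  have sur: "\<exists>v. \<Psi> v = u" if u: "0 < u" "u < 1" for u
  proof -
    let ?w = "I + u * (S - I)"
    have "I < ?w" using mult_pos_pos[OF u(1) pos] by simp
    moreover have "?w < S"
    proof -
      have "S - ?w = (1 - u) * (S - I)" by (simp add: algebra_simps)
      moreover have "(1 - u) * (S - I) > 0" using u pos by (intro mult_pos_pos) simp_all
      ultimately show ?thesis by linarith
    qed
    ultimately obtain x y where xy: "F x < ?w" "?w < F y"
      using less_cSup_iff[of "range F" ?w] cInf_less_iff[of "range F" ?w] bdd unfolding S_def[symmetric] I_def[symmetric]
      by auto
    have "x \<le> y"
    proof (rule ccontr)
      assume "\<not> x \<le> y"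
      then have "F y < F x" by (intro mono) simp
      with xy show False by linarith
    qed
    moreover have "continuous_on {x..y} F"
      by (rule DERIV_continuous_on[where D = ?f]) (rule has_field_derivative_at_within[OF F])
    ultimately obtain v where "F v = ?w"
      using IVT'[of F x ?w y] xy by (auto simp: less_imp_le)
    then show ?thesis using pos by (intro exI[of _ v]) (simp add: \<Psi>_def)
  qed
  have der: "(\<Psi> has_real_derivative 1 / (S - I) * ?f v) (at v)" for v
    unfolding \<Psi>_def using DERIV_cdivide[OF DERIV_diff[OF F[of v] DERIV_const[of I]], of "S - I"] by simp
  have rng: "0 < \<Psi> v" "\<Psi> v < 1" for v using SI[of v] pos by (simp_all add: \<Psi>_def field_simps)
  have "0 < 1 / (S - I)" using pos by simp
  then show ?thesis
    by (intro exI[of _ \<Psi>], intro exI[of _ "1 / (S - I)"]) (intro conjI allI impI der rng sur; simp)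
qed

text \<open>
  A time shift from an interval with time scale \<open>T\<close> to one with time scale \<open>\<tau> * T\<close> is
  \<open>v \<mapsto> (v + b) / \<tau>\<close> in rescaled time. Up to a power of \<open>\<tau>\<close>, this is its derivative in the
  coordinate \<open>\<Psi>\<close>.
\<close>

definition distortion_ratio :: "real \<Rightarrow> real \<Rightarrow> real \<Rightarrow> real \<Rightarrow> real" where
  "distortion_ratio r \<tau> b v = ((1 + v\<^sup>2) / (\<tau>\<^sup>2 + (v + b)\<^sup>2)) powr r"

definition distortion_bound :: "real \<Rightarrow> real" where
  "distortion_bound A = 2 * (A * (2 * A + 3)) * ((1 + 2 * A\<^sup>2) * A\<^sup>2) ^ 3"

text \<open>
  With \<open>Q = \<tau>\<^sup>2 + (v + b)\<^sup>2\<close> the numerator of the derivative of \<open>(1 + v\<^sup>2) / Q\<close> is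
  \<open>2 * (v * (\<tau>\<^sup>2 - 1) - b + b * v * (v + b))\<close>: every term is small because \<open>\<tau> - 1\<close> and \<open>b\<close> are of order
  \<open>\<delta>\<close>, and the cubic terms in \<open>v\<close> cancel. The remaining factor \<open>1 / (1 + v\<^sup>2)\<close> is dominated by the
  density of \<open>\<Psi>\<close> because \<open>r \<le> 1\<close>.
\<close>

lemma distortion_ratio_derivative:
  fixes A :: real
  assumes r: "0 < r" "r \<le> 1" and A: "1 \<le> A" and \<delta>: "0 \<le> \<delta>" "\<delta> \<le> 1"
    and \<tau>: "1 / A \<le> \<tau>" "\<tau> \<le> A" "\<bar>\<tau> - 1\<bar> \<le> A * \<delta>" and b: "\<bar>b\<bar> \<le> A * \<delta>"
  shows "\<exists>d. (distortion_ratio r \<tau> b has_real_derivative d) (at v) \<and>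
    \<bar>d\<bar> \<le> distortion_bound A * \<delta> * (1 + v\<^sup>2) powr (- r)"
proof -
  (* K bounds the ratio of P and Q from both sides. *)
  define K where "K = (1 + 2 * A\<^sup>2) * A\<^sup>2"
  define P where "P = 1 + v\<^sup>2"
  define Q where "Q = \<tau>\<^sup>2 + (v + b)\<^sup>2"
  have A2: "1 \<le> A\<^sup>2" using A by (simp add: power2_eq_square) (metis mult_mono' mult_1 zero_le_one)
  have K1: "3 * A\<^sup>2 \<le> K" unfolding K_def using A2 by (intro mult_right_mono) auto
  have K3: "3 \<le> K" using K1 A2 by linarith
  have \<tau>0: "0 < \<tau>" using \<tau>(1) A by (smt (verit) divide_pos_pos)
  have \<tau>A: "1 \<le> A\<^sup>2 * \<tau>\<^sup>2"
  proof -
    have "1 \<le> A * \<tau>" using \<tau>(1) A by (simp add: field_simps)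
    then show ?thesis by (metis one_le_power power_mult_distrib)
  qed
  have P1: "1 \<le> P" by (simp add: P_def)
  have Q0: "0 < Q" unfolding Q_def using \<tau>0 by (simp add: add_pos_nonneg)
  have bA: "\<bar>b\<bar> \<le> A"
  proof -
    have "A * \<delta> \<le> A * 1" using A \<delta> by (intro mult_left_mono) auto
    then show ?thesis using b by simp
  qed
  then have b2: "b\<^sup>2 \<le> A\<^sup>2" using A abs_le_square_iff[of b A] by simp
  have PQ: "P \<le> K * Q"
  proof -
    have "v\<^sup>2 \<le> 2 * (v + b)\<^sup>2 + 2 * b\<^sup>2" using zero_le_power2[of "v + 2 * b"] by (simp add: power2_eq_square algebra_simps)
    then have "P \<le> (1 + 2 * A\<^sup>2) * 1 + 2 * (v + b)\<^sup>2" using b2 by (simp add: P_def)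
    also have "\<dots> \<le> (1 + 2 * A\<^sup>2) * (A\<^sup>2 * \<tau>\<^sup>2) + K * (v + b)\<^sup>2"
      using \<tau>A A2 K3 by (intro add_mono mult_left_mono mult_right_mono) auto
    also have "\<dots> = K * Q" by (simp add: K_def Q_def algebra_simps)
    finally show ?thesis .
  qed
  have QP: "Q \<le> K * P"
  proof -
    have "(v + b)\<^sup>2 \<le> 2 * v\<^sup>2 + 2 * b\<^sup>2" using zero_le_power2[of "v - b"] by (simp add: power2_eq_square algebra_simps)
    moreover have "\<tau>\<^sup>2 \<le> A\<^sup>2" using \<tau>0 \<tau>(2) by (intro power_mono) auto
    ultimately have "Q \<le> 3 * A\<^sup>2 + 2 * v\<^sup>2" using b2 by (simp add: Q_def)
    also have "\<dots> \<le> K * 1 + K * v\<^sup>2" using K1 K3 by (intro add_mono mult_right_mono) auto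
    also have "\<dots> = K * P" by (simp add: P_def algebra_simps)
    finally show ?thesis .
  qed
  define num where "num = v * (\<tau>\<^sup>2 - 1) - b + b * (v * (v + b))"
  have vP: "\<bar>v\<bar> \<le> P"
    using zero_le_power2[of "\<bar>v\<bar> - 1"] abs_ge_zero[of v] unfolding P_def power2_eq_square
    by (simp add: algebra_simps)
  have v2P: "\<bar>v * (v + b)\<bar> \<le> (1 + A) * P"
  proof -
    have "\<bar>v * (v + b)\<bar> \<le> v\<^sup>2 + \<bar>v\<bar> * \<bar>b\<bar>"
      unfolding abs_mult power2_eq_square using abs_triangle_ineq[of v b]
      by (metis abs_ge_zero abs_mult_self_eq distrib_left mult_left_mono)
    also have "\<dots> \<le> P + P * A" using vP bA P1 by (intro add_mono mult_mono) (auto simp: P_def)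
    finally show ?thesis by (simp add: algebra_simps)
  qed
  have num_le: "\<bar>num\<bar> \<le> A * (2 * A + 3) * \<delta> * P"
  proof -
    have "\<bar>\<tau>\<^sup>2 - 1\<bar> = \<bar>\<tau> - 1\<bar> * \<bar>\<tau> + 1\<bar>" by (simp add: abs_mult[symmetric] power2_eq_square algebra_simps)
    also have "\<dots> \<le> (A * \<delta>) * (A + 1)" using \<tau> \<tau>0 by (intro mult_mono) auto
    finally have 1: "\<bar>v * (\<tau>\<^sup>2 - 1)\<bar> \<le> P * ((A * \<delta>) * (A + 1))"
      unfolding abs_mult using vP P1 by (intro mult_mono) auto
    have "A * \<delta> \<ge> 0" using A \<delta> by simp
    then have 2: "\<bar>b\<bar> \<le> A * \<delta> * P" using b mult_left_mono[OF P1, of "A * \<delta>"] by linarith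
    have 3: "\<bar>b * (v * (v + b))\<bar> \<le> A * \<delta> * ((1 + A) * P)"
      unfolding abs_mult[of b] using v2P b by (intro mult_mono) auto
    have "\<bar>num\<bar> \<le> P * ((A * \<delta>) * (A + 1)) + A * \<delta> * P + A * \<delta> * ((1 + A) * P)"
      using 1 2 3 unfolding num_def by linarith
    then show ?thesis by (simp add: algebra_simps)
  qed
  let ?R = "P / Q"
  have R: "?R > 0" "1 / K \<le> ?R" using P1 Q0 QP K3 by (auto simp: field_simps)
  have dR: "((\<lambda>v. (1 + v\<^sup>2) / (\<tau>\<^sup>2 + (v + b)\<^sup>2)) has_real_derivative 2 * num / Q\<^sup>2) (at v)"
  proof -
    have "\<tau>\<^sup>2 + (v + b)\<^sup>2 \<noteq> 0" using Q0 unfolding Q_def by linarith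
    with \<tau>0 have "((\<lambda>v. (1 + v\<^sup>2) / (\<tau>\<^sup>2 + (v + b)\<^sup>2)) has_real_derivative
        (2 * v * (\<tau>\<^sup>2 + (v + b)\<^sup>2) - (1 + v\<^sup>2) * (2 * (v + b))) / ((\<tau>\<^sup>2 + (v + b)\<^sup>2) * (\<tau>\<^sup>2 + (v + b)\<^sup>2))) (at v)"
      by (auto intro!: derivative_eq_intros)
    moreover have "2 * v * (\<tau>\<^sup>2 + (v + b)\<^sup>2) - (1 + v\<^sup>2) * (2 * (v + b)) = 2 * num"
      unfolding num_def power2_eq_square by (simp add: algebra_simps)
    ultimately show ?thesis by (simp add: Q_def power2_eq_square)
  qed
  have d: "(distortion_ratio r \<tau> b has_real_derivative r * ?R powr (r - 1) * (2 * num / Q\<^sup>2)) (at v)"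
    unfolding distortion_ratio_def
    using DERIV_fun_powr[OF dR, of r] R(1) by (simp add: P_def Q_def)
  have "\<bar>r * ?R powr (r - 1) * (2 * num / Q\<^sup>2)\<bar> = r * ?R powr (r - 1) * (2 * \<bar>num\<bar> / Q\<^sup>2)"
    using r by (simp add: abs_mult)
  also have "\<dots> \<le> (1 * K) * (2 * (A * (2 * A + 3) * \<delta> * P) / (P / K)\<^sup>2)"
  proof (intro mult_mono divide_mono frac_le power_mono mult_left_mono num_le)
    have "?R powr (r - 1) \<le> (1 / K) powr (r - 1)" using R r K3 by (intro powr_mono2') auto
    also have "\<dots> = K powr (1 - r)" using K3 by (simp add: powr_divide powr_minus_divide[symmetric])
    also have "\<dots> \<le> K powr 1" using K3 r by (intro powr_mono) auto
    finally show "?R powr (r - 1) \<le> K" using K3 by simp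
    show "P / K \<le> Q" using PQ K3 by (simp add: field_simps)
    show "0 < (P / K)\<^sup>2" using P1 K3 by simp
  qed (use r R K3 P1 Q0 A \<delta> in auto)
  also have "\<dots> = distortion_bound A * \<delta> * (1 / P)"
  proof -
    have "(1 * K) * (2 * (X * \<delta> * P) / (P / K)\<^sup>2) = 2 * X * K ^ 3 * \<delta> * (1 / P)" for X
      using P1 K3 by (simp add: power2_eq_square power3_eq_cube field_simps)
    then show ?thesis unfolding distortion_bound_def K_def[symmetric] .
  qed
  also have "\<dots> \<le> distortion_bound A * \<delta> * P powr (- r)"
  proof (rule mult_left_mono)
    have "P powr r \<le> P powr 1" using P1 r by (intro powr_mono) auto
    then show "1 / P \<le> P powr (- r)" using P1 by (simp add: powr_minus_divide field_simps)
    show "0 \<le> distortion_bound A * \<delta>" using A \<delta> by (simp add: distortion_bound_def)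
  qed
  finally show ?thesis using d unfolding P_def by blast
qed

lemma distortion_ratio_tendsto_1:
  assumes "\<tau> > 0"
  shows "(distortion_ratio r \<tau> b \<longlongrightarrow> 1) at_top" "(distortion_ratio r \<tau> b \<longlongrightarrow> 1) at_bot"
proof -
  have "((\<lambda>v::real. (1 + v\<^sup>2) / (\<tau>\<^sup>2 + (v + b)\<^sup>2)) \<longlongrightarrow> 1) at_top" by real_asymp
  then show "(distortion_ratio r \<tau> b \<longlongrightarrow> 1) at_top"
    unfolding distortion_ratio_def using tendsto_powr[OF _ tendsto_const, of _ 1 _ r] by fastforce
  have "((\<lambda>v::real. (1 + v\<^sup>2) / (\<tau>\<^sup>2 + (v + b)\<^sup>2)) \<longlongrightarrow> 1) at_bot" by real_asymp
  then show "(distortion_ratio r \<tau> b \<longlongrightarrow> 1) at_bot"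
    unfolding distortion_ratio_def using tendsto_powr[OF _ tendsto_const, of _ 1 _ r] by fastforce
qed

locale profile =
  fixes r c :: real and \<Psi> :: "real \<Rightarrow> real"
  assumes r: "1 / 2 < r" "r \<le> 1" and c: "0 < c"
    and \<Psi>_deriv: "\<And>v. (\<Psi> has_real_derivative c * (1 + v\<^sup>2) powr (- r)) (at v)"
    and \<Psi>_range: "\<And>v. 0 < \<Psi> v" "\<And>v. \<Psi> v < 1"
    and \<Psi>_onto: "\<And>u. 0 < u \<Longrightarrow> u < 1 \<Longrightarrow> \<exists>v. \<Psi> v = u"
begin

lemma weight_pos: "0 < (1 + v\<^sup>2) powr (- r)"
  using zero_le_power2[of v] by (simp add: add_nonneg_eq_0_iff)

lemma \<Psi>_less:
  assumes "v < w"
  shows "\<Psi> v < \<Psi> w"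
proof (rule DERIV_pos_imp_increasing[OF assms])
  fix t show "\<exists>d. (\<Psi> has_real_derivative d) (at t) \<and> 0 < d"
    by (intro exI[of _ "c * (1 + t\<^sup>2) powr (- r)"] conjI \<Psi>_deriv mult_pos_pos c weight_pos)
qed

lemma \<Psi>_less_iff: "\<Psi> v < \<Psi> w \<longleftrightarrow> v < w"
  using \<Psi>_less[of v w] \<Psi>_less[of w v] linorder_less_linear[of v w] by auto

lemma \<Psi>_eq_iff: "\<Psi> v = \<Psi> w \<longleftrightarrow> v = w"
  using \<Psi>_less[of v w] \<Psi>_less[of w v] linorder_less_linear[of v w] by auto

definition time :: "real \<Rightarrow> real" where
  "time u = (THE v. \<Psi> v = u)"

lemma time_\<Psi>: "time (\<Psi> v) = v"
  unfolding time_def by (simp add: \<Psi>_eq_iff)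

lemma \<Psi>_time: "0 < u \<Longrightarrow> u < 1 \<Longrightarrow> \<Psi> (time u) = u"
  using \<Psi>_onto[of u] time_\<Psi> by auto

text \<open>
  The translation by \<open>\<beta>\<close> in time, from an interval with time scale \<open>T\<close> to one with time scale \<open>T'\<close>, both
  rescaled to \<open>{0..1}\<close>. As the identity outside \<open>{0<..<1}\<close> it is a monotone bijection of the real
  line, which makes its continuity immediate.
\<close>

definition shift_map :: "real \<Rightarrow> real \<Rightarrow> real \<Rightarrow> real \<Rightarrow> real" where
  "shift_map T T' \<beta> u = (if 0 < u \<and> u < 1 then \<Psi> ((T * time u + \<beta>) / T') else u)"

lemma shift_map_inside: "0 < u \<Longrightarrow> u < 1 \<Longrightarrow> 0 < shift_map T T' \<beta> u \<and> shift_map T T' \<beta> u < 1"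
  by (simp add: shift_map_def \<Psi>_range)

lemma shift_map_outside: "\<not> (0 < u \<and> u < 1) \<Longrightarrow> shift_map T T' \<beta> u = u"
  unfolding shift_map_def by (rule if_not_P)

lemma shift_map_comp:
  assumes "T' > 0"
  shows "shift_map T' T'' \<beta>' (shift_map T T' \<beta> u) = shift_map T T'' (\<beta> + \<beta>') u"
proof (cases "0 < u \<and> u < 1")
  case True
  have "T' * ((T * time u + \<beta>) / T') = T * time u + \<beta>" using assms by simp
  with True show ?thesis by (simp add: shift_map_def \<Psi>_range time_\<Psi> add.assoc)
qed (simp add: shift_map_outside)

lemma shift_map_id:
  assumes "T > 0"
  shows "shift_map T T 0 u = u"
  using assms by (simp add: shift_map_def \<Psi>_time)

lemma shift_map_mono:
  assumes "T > 0" "T' > 0" "u \<le> w"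
  shows "shift_map T T' \<beta> u \<le> shift_map T T' \<beta> w"
proof (cases "0 < u \<and> u < 1 \<and> 0 < w \<and> w < 1")
  case True
  have "\<not> time w < time u"
    using True assms(3) \<Psi>_less[of "time w" "time u"] by (auto simp: \<Psi>_time)
  then have "T * time u \<le> T * time w" using assms(1) by simp
  then have "\<not> (T * time w + \<beta>) / T' < (T * time u + \<beta>) / T'"
    using assms(2) by (simp add: not_less divide_right_mono)
  then show ?thesis using True by (simp add: shift_map_def not_less[symmetric] \<Psi>_less_iff)
next
  case False
  then consider "\<not> (0 < u \<and> u < 1)" "0 < w \<and> w < 1" | "0 < u \<and> u < 1" "\<not> (0 < w \<and> w < 1)"
    | "\<not> (0 < u \<and> u < 1)" "\<not> (0 < w \<and> w < 1)" by blast
  then show ?thesis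
  proof cases
    case 1
    then show ?thesis using assms(3) shift_map_inside[of w T T' \<beta>] by (simp add: shift_map_outside)
  next
    case 2
    then show ?thesis using assms(3) shift_map_inside[of u T T' \<beta>] by (simp add: shift_map_outside)
  next
    case 3
    then show ?thesis using assms(3) by (simp add: shift_map_outside)
  qed
qed

lemma shift_map_continuous:
  assumes "T > 0" "T' > 0"
  shows "continuous_on UNIV (shift_map T T' \<beta>)"
proof (rule continuous_onI_mono)
  have "u = shift_map T T' \<beta> (shift_map T' T (- \<beta>) u)" for u
    by (simp add: shift_map_comp[OF assms(1)] shift_map_id[OF assms(2)])
  then have "shift_map T T' \<beta> ` UNIV = UNIV" by (intro surjI) (rule sym)
  then show "open (shift_map T T' \<beta> ` UNIV)" by simp
qed (rule shift_map_mono[OF assms])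

definition density :: "real \<Rightarrow> real \<Rightarrow> real \<Rightarrow> real" where
  "density \<tau> b u = (if 0 < u \<and> u < 1 then distortion_ratio r \<tau> b (time u) else 1)"

lemma shift_map_deriv:
  assumes T: "T > 0" "T' > 0" and u: "0 < u" "u < 1"
  shows "(shift_map T T' \<beta> has_real_derivative (T' / T) powr (2 * r - 1) * density (T' / T) (\<beta> / T) u) (at u)"
proof -
  let ?v = "time u" and ?w = "\<lambda>v. (T * v + \<beta>) / T'"
  let ?d = "\<lambda>v. c * (1 + v\<^sup>2) powr (- r)"
  have d0: "?d v > 0" for v by (intro mult_pos_pos c weight_pos)
  have nz: "1 + v\<^sup>2 \<noteq> 0" for v :: real using zero_le_power2[of v] by linarith
  have "isCont time u"
  proof -
    have "isCont time (\<Psi> ?v)"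
      by (rule isCont_inverse_function2[of "?v - 1" _ "?v + 1"])
        (auto simp: time_\<Psi> intro: DERIV_isCont[OF \<Psi>_deriv])
    then show ?thesis using u by (simp add: \<Psi>_time)
  qed
  then have "(time has_real_derivative inverse (?d ?v)) (at u)"
    by (rule DERIV_inverse_function[where f = \<Psi> and a = 0 and b = 1, rotated -1])
      (use u c nz in \<open>simp_all add: \<Psi>_deriv \<Psi>_time\<close>)
  moreover have w': "(?w has_real_derivative T / T') (at x)" for x
    using T by (auto intro!: derivative_eq_intros)
  ultimately have "(?w \<circ> time has_real_derivative T / T' * inverse (?d ?v)) (at u)"
    by (rule DERIV_chain[rotated])
  then have "(\<Psi> \<circ> (?w \<circ> time) has_real_derivative ?d ((?w \<circ> time) u) * (T / T' * inverse (?d ?v))) (at u)"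
    by (rule DERIV_chain[OF \<Psi>_deriv])
  then have "(\<Psi> \<circ> (?w \<circ> time) has_real_derivative ?d (?w ?v) * (T / T' * inverse (?d ?v))) (at u)"
    by (simp only: comp_apply)
  moreover have "?d (?w ?v) * (T / T' * inverse (?d ?v)) =
      (T' / T) powr (2 * r - 1) * density (T' / T) (\<beta> / T) u"
  proof -
    let ?\<tau> = "T' / T"
    define P where "P = 1 + ?v\<^sup>2"
    define Q where "Q = ?\<tau>\<^sup>2 + (?v + \<beta> / T)\<^sup>2"
    have PQ: "P > 0" "Q > 0" "?\<tau> > 0" using T zero_le_power2[of ?v] zero_le_power2[of "?v + \<beta> / T"]
      by (simp_all add: P_def Q_def add_pos_nonneg)
    have "?w ?v = (?v + \<beta> / T) / ?\<tau>" using T by (simp add: field_simps)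
    moreover have "1 + (a / t)\<^sup>2 = (t\<^sup>2 + a\<^sup>2) / t\<^sup>2" if "t > 0" for a t :: real
      using that by (simp add: power_divide add_divide_distrib)
    ultimately have w: "1 + (?w ?v)\<^sup>2 = Q / ?\<tau>\<^sup>2" using PQ(3) unfolding Q_def by metis
    have "c * x * (T / T' * inverse (c * inverse p)) = x * p * (1 / ?\<tau>)" if "p > 0" for x p
      using c T that by (simp add: field_simps)
    from this[of "P powr r" "(Q / ?\<tau>\<^sup>2) powr (- r)"]
    have "?d (?w ?v) * (T / T' * inverse (?d ?v)) = (Q / ?\<tau>\<^sup>2) powr (- r) * P powr r * (1 / ?\<tau>)"
      unfolding w P_def[symmetric] powr_minus[of P] using PQ by simp
    also have "(Q / ?\<tau>\<^sup>2) powr (- r) = (?\<tau>\<^sup>2) powr r / Q powr r"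
    proof -
      have "(Q / X) powr (- r) = X powr r / Q powr r" if "X > 0" for X
        using PQ(2) that by (simp add: powr_divide powr_minus field_simps)
      then show ?thesis using PQ(3) zero_less_power by blast
    qed
    also have "(?\<tau>\<^sup>2) powr r = ?\<tau> powr (2 * r)"
    proof -
      have "?\<tau>\<^sup>2 = ?\<tau> powr 2" using PQ by simp
      then show ?thesis by (simp only: powr_powr)
    qed
    also have "?\<tau> powr (2 * r) / Q powr r * P powr r * (1 / ?\<tau>) = ?\<tau> powr (2 * r - 1) * (P / Q) powr r"
      using PQ T by (simp add: powr_diff powr_divide mult_ac)
    finally show ?thesis using u by (simp add: density_def distortion_ratio_def P_def Q_def)
  qed
  ultimately have "(\<Psi> \<circ> (?w \<circ> time) has_real_derivative
      (T' / T) powr (2 * r - 1) * density (T' / T) (\<beta> / T) u) (at u)" by (simp only:)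
  then show ?thesis
    by (rule has_field_derivative_transform_within_open[of _ _ _ "{0<..<1}"])
      (use u in \<open>simp_all add: shift_map_def\<close>)
qed

text \<open>
  The bound on the derivative of the ratio is a multiple of the derivative of \<open>\<Psi>\<close>, so the ratio is
  Lipschitz as a function of \<open>u = \<Psi> v\<close>. It tends to \<open>1\<close> at both ends of the line, which extends the
  estimate to the end points of the interval.
\<close>

lemma density_lipschitz:
  assumes A: "1 \<le> A" and \<delta>: "0 \<le> \<delta>" "\<delta> \<le> 1"
    and \<tau>: "1 / A \<le> \<tau>" "\<tau> \<le> A" "\<bar>\<tau> - 1\<bar> \<le> A * \<delta>" and b: "\<bar>b\<bar> \<le> A * \<delta>"
    and u: "0 \<le> u" "u \<le> w" "w \<le> 1"
  shows "\<bar>density \<tau> b u - density \<tau> b w\<bar> \<le> distortion_bound A / c * \<delta> * (w - u)"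
proof -
  let ?R = "distortion_ratio r \<tau> b"
  define B where "B = distortion_bound A / c * \<delta>"
  have r0: "0 < r" using r by simp
  have \<tau>0: "\<tau> > 0" using \<tau>(1) A by (smt (verit) divide_pos_pos)
  have B0: "B \<ge> 0" unfolding B_def using A \<delta> c by (simp add: distortion_bound_def)
  have key: "\<bar>?R x - ?R y\<bar> \<le> B * (\<Psi> y - \<Psi> x)" if "x \<le> y" for x y
  proof -
    (* Both B * \<Psi> + R and B * \<Psi> - R are nondecreasing. *)
    have mono: "B * \<Psi> x + s * ?R x \<le> B * \<Psi> y + s * ?R y" if s: "\<bar>s\<bar> = 1" for s
    proof (rule DERIV_nonneg_imp_nondecreasing[OF \<open>x \<le> y\<close>])
      fix t
      obtain d where d: "(?R has_real_derivative d) (at t)"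
        "\<bar>d\<bar> \<le> distortion_bound A * \<delta> * (1 + t\<^sup>2) powr (- r)"
        using distortion_ratio_derivative[OF r0 r(2) A \<delta> \<tau> b, of t] by (elim exE conjE) (rule that)
      have "((\<lambda>v. B * \<Psi> v + s * ?R v) has_real_derivative B * (c * (1 + t\<^sup>2) powr (- r)) + s * d) (at t)"
        by (intro DERIV_add DERIV_cmult \<Psi>_deriv d(1))
      moreover have "B * (c * (1 + t\<^sup>2) powr (- r)) = distortion_bound A * \<delta> * (1 + t\<^sup>2) powr (- r)"
        using c by (simp add: B_def)
      moreover have "\<bar>s * d\<bar> = \<bar>d\<bar>" using s by (simp add: abs_mult)
      ultimately show "\<exists>e. ((\<lambda>v. B * \<Psi> v + s * ?R v) has_real_derivative e) (at t) \<and> 0 \<le> e"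
        using d(2) by (intro exI[of _ "B * (c * (1 + t\<^sup>2) powr (- r)) + s * d"] conjI) linarith+
    qed
    from mono[of 1] mono[of "-1"] show ?thesis by (simp add: abs_le_iff algebra_simps)
  qed
  have right: "\<bar>?R x - 1\<bar> \<le> B * (1 - \<Psi> x)" for x
  proof (rule tendsto_upperbound)
    show "((\<lambda>y. \<bar>?R x - ?R y\<bar>) \<longlongrightarrow> \<bar>?R x - 1\<bar>) at_top"
      by (intro tendsto_intros distortion_ratio_tendsto_1 \<tau>0)
    show "\<forall>\<^sub>F y in at_top. \<bar>?R x - ?R y\<bar> \<le> B * (1 - \<Psi> x)"
      using eventually_ge_at_top[of x]
    proof eventually_elim
      case (elim y)
      have "B * (\<Psi> y - \<Psi> x) \<le> B * (1 - \<Psi> x)"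
        using \<Psi>_range(2)[of y] B0 by (intro mult_left_mono) simp_all
      with key[OF elim] show ?case by linarith
    qed
  qed simp
  have left: "\<bar>1 - ?R x\<bar> \<le> B * \<Psi> x" for x
  proof (rule tendsto_upperbound)
    show "((\<lambda>y. \<bar>?R y - ?R x\<bar>) \<longlongrightarrow> \<bar>1 - ?R x\<bar>) at_bot"
      by (intro tendsto_intros distortion_ratio_tendsto_1 \<tau>0)
    show "\<forall>\<^sub>F y in at_bot. \<bar>?R y - ?R x\<bar> \<le> B * \<Psi> x"
      using eventually_le_at_bot[of x]
    proof eventually_elim
      case (elim y)
      have "B * (\<Psi> x - \<Psi> y) \<le> B * \<Psi> x"
        using \<Psi>_range(1)[of y] B0 by (intro mult_left_mono) simp_all
      with key[OF elim] show ?case by linarith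
    qed
  qed simp
  have times: "time u \<le> time w" if "0 < u" "w < 1"
    using \<Psi>_less[of "time w" "time u"] \<Psi>_time[of u] \<Psi>_time[of w] that u by (cases "time u \<le> time w") auto
  have "\<bar>density \<tau> b u - density \<tau> b w\<bar> \<le> B * (w - u)"
  proof (cases "0 < u")
    case True
    note u0 = this
    show ?thesis
    proof (cases "w < 1")
      case True
      then show ?thesis
        using key[OF times[OF u0 True]] u u0 by (simp add: density_def \<Psi>_time)
    next
      case False
      then have w: "w = 1" using u by simp
      show ?thesis
      proof (cases "u < 1")
        case True
        then show ?thesis using right[of "time u"] u0 w by (simp add: density_def \<Psi>_time)
      qed (use u w in \<open>simp add: density_def\<close>)
    qed
  next
    case False
    then have u: "u = 0" using u by simp
    show ?thesis
    proof (cases "0 < w \<and> w < 1")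
      case True
      then show ?thesis using left[of "time w"] u by (simp add: density_def \<Psi>_time)
    next
      case False
      then show ?thesis using assms(8-10) u B0 unfolding density_def by (simp only: if_not_P if_False) simp
    qed
  qed
  then show ?thesis by (simp add: B_def)
qed

end

section \<open>Intervals arranged along an ordered set\<close>

locale ordered_lengths =
  fixes K :: "'k set" and prec :: "'k \<Rightarrow> 'k \<Rightarrow> bool" and len :: "'k \<Rightarrow> real"
  assumes irrefl: "\<And>k. \<not> prec k k"
    and trans: "\<And>i j k. prec i j \<Longrightarrow> prec j k \<Longrightarrow> prec i k"
    and total: "\<And>i j. i \<in> K \<Longrightarrow> j \<in> K \<Longrightarrow> i = j \<or> prec i j \<or> prec j i"
    and len_pos: "\<And>k. k \<in> K \<Longrightarrow> 0 < len k"
    and len_summable: "len summable_on K"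
    and len_total: "infsum len K = 1"
begin

definition below :: "'k \<Rightarrow> 'k set" where
  "below k = {j \<in> K. prec j k}"

definition base :: "'k \<Rightarrow> real" where
  "base k = infsum len (below k)"

definition coord :: "'k \<Rightarrow> real \<Rightarrow> real" where
  "coord k x = max 0 (min 1 ((x - base k) / len k))"

text \<open>
  A point of \<open>{0..1}\<close> is determined by the proportions \<open>u k\<close> of the intervals that lie to its left.
  The families that arise are those in which every interval before a nonempty portion is full.
  Working with them spares an extension of maps from the union of the intervals to its closure.
\<close>

definition cut :: "('k \<Rightarrow> real) \<Rightarrow> bool" where
  "cut u \<longleftrightarrow> (\<forall>k\<in>K. 0 \<le> u k \<and> u k \<le> 1) \<and> (\<forall>j\<in>K. \<forall>k\<in>K. prec j k \<longrightarrow> 0 < u k \<longrightarrow> u j = 1)"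

definition position :: "('k \<Rightarrow> real) \<Rightarrow> real" where
  "position u = infsum (\<lambda>k. len k * u k) K"

definition glued :: "('k \<Rightarrow> 'k) \<Rightarrow> ('k \<Rightarrow> real \<Rightarrow> real) \<Rightarrow> real \<Rightarrow> real" where
  "glued \<pi> \<gamma> x = infsum (\<lambda>k. len (\<pi> k) * \<gamma> k (coord k x)) K"

lemma summable_sub: "S \<subseteq> K \<Longrightarrow> len summable_on S"
  by (rule summable_on_subset_banach[OF len_summable])

lemma len_nonneg: "k \<in> K \<Longrightarrow> 0 \<le> len k"
  by (simp add: len_pos less_imp_le)

lemma infsum_len_mono: "S \<subseteq> S' \<Longrightarrow> S' \<subseteq> K \<Longrightarrow> infsum len S \<le> infsum len S'"
  by (rule infsum_mono_neutral) (use summable_sub len_nonneg in auto)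

lemma infsum_len_union: "S \<subseteq> K \<Longrightarrow> S' \<subseteq> K \<Longrightarrow> S \<inter> S' = {} \<Longrightarrow> infsum len (S \<union> S') = infsum len S + infsum len S'"
  by (rule infsum_Un_disjoint) (simp_all add: summable_sub)

lemma weighted_summable:
  assumes "\<And>k. k \<in> K \<Longrightarrow> 0 \<le> u k \<and> u k \<le> 1"
  shows "(\<lambda>k. len k * u k) summable_on K"
proof (rule summable_on_comparison_test[OF len_summable])
  fix k assume "k \<in> K"
  then show "len k * u k \<le> len k" "0 \<le> len k * u k"
    using assms len_nonneg by (simp_all add: mult_left_le)
qed

lemma base_nonneg: "0 \<le> base k"
  unfolding base_def by (rule infsum_nonneg) (use len_nonneg in \<open>auto simp: below_def\<close>)

lemma base_plus_len:
  assumes "k \<in> K"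
  shows "base k + len k = infsum len (below k \<union> {k})"
  unfolding base_def using assms irrefl by (subst infsum_len_union) (auto simp: below_def)

lemma base_plus_len_le_1: "k \<in> K \<Longrightarrow> base k + len k \<le> 1"
  unfolding base_plus_len len_total[symmetric] by (rule infsum_len_mono) (auto simp: below_def)

lemma base_step:
  assumes "j \<in> K" "k \<in> K" "prec j k"
  shows "base j + len j \<le> base k"
proof -
  have "infsum len (below j \<union> {j}) \<le> infsum len (below k)"
    by (rule infsum_len_mono) (use assms trans in \<open>auto simp: below_def\<close>)
  then show ?thesis by (simp add: base_plus_len[OF assms(1)] base_def[of k])
qed

lemma coord_range: "0 \<le> coord k x" "coord k x \<le> 1"
  by (simp_all add: coord_def)

lemma coord_eq:
  assumes "k \<in> K"
  shows "x \<le> base k \<Longrightarrow> coord k x = 0" "base k + len k \<le> x \<Longrightarrow> coord k x = 1"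
    "base k \<le> x \<Longrightarrow> x \<le> base k + len k \<Longrightarrow> base k + len k * coord k x = x"
proof -
  note l = len_pos[OF assms]
  show "x \<le> base k \<Longrightarrow> coord k x = 0" using l by (simp add: coord_def divide_nonpos_pos)
  show "base k + len k \<le> x \<Longrightarrow> coord k x = 1" using l by (simp add: coord_def le_divide_eq)
  show "base k \<le> x \<Longrightarrow> x \<le> base k + len k \<Longrightarrow> base k + len k * coord k x = x"
  proof -
    assume "base k \<le> x" "x \<le> base k + len k"
    then have "0 \<le> (x - base k) / len k" "(x - base k) / len k \<le> 1" using l by (simp_all add: divide_le_eq)
    then have "coord k x = (x - base k) / len k" by (simp add: coord_def)
    then show ?thesis using l by simp
  qed
qed

lemma coord_pos_iff: "k \<in> K \<Longrightarrow> 0 < coord k x \<longleftrightarrow> base k < x"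
  using len_pos[of k] by (simp add: coord_def less_max_iff_disj zero_less_divide_iff)

lemma coord_less_1_iff: "k \<in> K \<Longrightarrow> coord k x < 1 \<longleftrightarrow> x < base k + len k"
  using len_pos[of k] by (auto simp: coord_def min_less_iff_disj divide_less_eq)

lemma coord_mono: "k \<in> K \<Longrightarrow> x \<le> y \<Longrightarrow> coord k x \<le> coord k y"
  unfolding coord_def using len_pos[of k] by (intro max.mono min.mono order_refl divide_right_mono) auto

lemma cut_coord: "cut (\<lambda>k. coord k x)"
  unfolding cut_def
proof (intro conjI ballI impI coord_range)
  fix j k assume jk: "j \<in> K" "k \<in> K" "prec j k" "0 < coord k x"
  then have "base j + len j \<le> x" using base_step[OF jk(1-3)] coord_pos_iff[OF jk(2), of x] by simp
  then show "coord j x = 1" by (rule coord_eq(2)[OF jk(1)])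
qed

lemma position_split:
  assumes u: "cut u" and k: "k \<in> K"
  shows "u k = 1 \<Longrightarrow> base k + len k \<le> position u" "u k = 0 \<Longrightarrow> position u \<le> base k"
    "0 < u k \<Longrightarrow> u k < 1 \<Longrightarrow> position u = base k + len k * u k"
proof -
  have u01: "\<And>k. k \<in> K \<Longrightarrow> 0 \<le> u k \<and> u k \<le> 1" and uc: "\<And>j k. j \<in> K \<Longrightarrow> k \<in> K \<Longrightarrow> prec j k \<Longrightarrow> 0 < u k \<Longrightarrow> u j = 1"
    using u by (auto simp: cut_def)
  let ?B = "below k \<union> {k}"
  have sub: "?B \<subseteq> K" "below k \<subseteq> K" using k by (auto simp: below_def)
  note ws = weighted_summable[OF u01]
  show "base k + len k \<le> position u" if "u k = 1"
  proof -
    have "infsum len ?B \<le> infsum (\<lambda>k. len k * u k) K"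
      by (rule infsum_mono_neutral[OF summable_sub[OF sub(1)] ws])
        (use that uc[OF _ k] k u01 len_nonneg in \<open>auto simp: below_def\<close>)
    then show ?thesis by (simp add: base_plus_len[OF k] position_def)
  qed
  show "position u \<le> base k" if "u k = 0"
  proof -
    have "u j = 0" if j: "j \<in> K" "\<not> prec j k" for j
    proof (cases "j = k")
      case False
      then have "prec k j" using total[OF j(1) k] j(2) by blast
      then show ?thesis using uc[OF k j(1)] \<open>u k = 0\<close> u01[OF j(1)] by force
    qed (simp add: \<open>u k = 0\<close>)
    then have "infsum (\<lambda>k. len k * u k) K \<le> infsum len (below k)"
      by (intro infsum_mono_neutral[OF ws summable_sub[OF sub(2)]])
        (use u01 len_nonneg in \<open>auto simp: below_def mult_left_le\<close>)
    then show ?thesis by (simp add: base_def position_def)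
  qed
  show "position u = base k + len k * u k" if "0 < u k" "u k < 1"
  proof -
    have z: "u j = 0" if j: "j \<in> K" "\<not> prec j k" "j \<noteq> k" for j
    proof -
      have "prec k j" using total[OF j(1) k] j(2,3) by blast
      then show ?thesis using uc[OF k j(1)] \<open>u k < 1\<close> u01[OF j(1)] by force
    qed
    have "position u = infsum (\<lambda>k. len k * u k) ?B"
      unfolding position_def by (rule infsum_cong_neutral) (use z sub in \<open>auto simp: below_def\<close>)
    also have "\<dots> = infsum (\<lambda>k. len k * u k) (below k) + infsum (\<lambda>k. len k * u k) {k}"
      by (rule infsum_Un_disjoint) (use irrefl in \<open>auto simp: below_def intro: summable_on_subset_banach[OF ws]\<close>)
    also have "infsum (\<lambda>k. len k * u k) (below k) = base k"
      unfolding base_def by (rule infsum_cong) (use uc[OF _ k] that in \<open>auto simp: below_def\<close>)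
    finally show ?thesis by simp
  qed
qed

lemma coord_position:
  assumes u: "cut u" and k: "k \<in> K"
  shows "coord k (position u) = u k"
proof -
  have u01: "0 \<le> u k" "u k \<le> 1" using u k by (auto simp: cut_def)
  note p = position_split[OF u k] and l = len_pos[OF k]
  consider "u k = 0" | "u k = 1" | "0 < u k" "u k < 1" using u01 by linarith
  then show ?thesis
  proof cases
    case 3
    then have "(position u - base k) / len k = u k" using p(3) l by simp
    then show ?thesis using u01 by (simp add: coord_def)
  qed (use p(1,2) coord_eq[OF k] in simp_all)
qed

lemma position_range:
  assumes "cut u"
  shows "position u \<in> {0..1}"
proof -
  have u01: "\<And>k. k \<in> K \<Longrightarrow> 0 \<le> u k \<and> u k \<le> 1" using assms by (auto simp: cut_def)
  have "0 \<le> position u" unfolding position_def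
    by (rule infsum_nonneg) (use u01 len_nonneg in simp)
  moreover have le: "len k * u k \<le> len k" if "k \<in> K" for k
    using u01[OF that] len_nonneg[OF that] by (simp add: mult_left_le)
  moreover have "position u \<le> infsum len K" unfolding position_def
    by (rule infsum_mono[OF weighted_summable[OF u01] len_summable]) (assumption, rule le)
  ultimately show ?thesis by (simp add: len_total)
qed

lemma infsum_le_bound:
  assumes "S \<subseteq> K" "\<And>F. finite F \<Longrightarrow> F \<subseteq> S \<Longrightarrow> F \<noteq> {} \<Longrightarrow> sum len F \<le> b" "0 \<le> b"
  shows "infsum len S \<le> b"
  by (rule infsum_le_finite_sums[OF summable_sub[OF assms(1)]]) (use assms(2,3) in \<open>metis sum.empty\<close>)

lemma finite_extreme:
  assumes "finite F" "F \<noteq> {}" "F \<subseteq> K"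
  shows "\<exists>m\<in>F. \<forall>j\<in>F. j = m \<or> prec j m" "\<exists>m\<in>F. \<forall>j\<in>F. j = m \<or> prec m j"
proof -
  show "\<exists>m\<in>F. \<forall>j\<in>F. j = m \<or> prec j m"
    using assms
  proof (induction F rule: finite_ne_induct)
    case (insert x F)
    then obtain m where m: "m \<in> F" "\<forall>j\<in>F. j = m \<or> prec j m" by auto
    have "x = m \<or> prec x m \<or> prec m x" using total[of x m] insert.prems m(1) by auto
    then consider "x = m \<or> prec x m" | "prec m x" by blast
    then show ?case
    proof cases
      case 1
      with m have "\<forall>j\<in>insert x F. j = m \<or> prec j m" by blast
      with m(1) show ?thesis by blast
    next
      case 2
      have "prec j x" if "j \<in> F" for j using bspec[OF m(2) that] trans[of j m x] 2 by blast
      then show ?thesis by blast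
    qed
  qed simp
  show "\<exists>m\<in>F. \<forall>j\<in>F. j = m \<or> prec m j"
    using assms
  proof (induction F rule: finite_ne_induct)
    case (insert x F)
    then obtain m where m: "m \<in> F" "\<forall>j\<in>F. j = m \<or> prec m j" by auto
    have "x = m \<or> prec x m \<or> prec m x" using total[of x m] insert.prems m(1) by auto
    then consider "x = m \<or> prec m x" | "prec x m" by blast
    then show ?case
    proof cases
      case 1
      with m have "\<forall>j\<in>insert x F. j = m \<or> prec m j" by blast
      with m(1) show ?thesis by blast
    next
      case 2
      have "prec x j" if "j \<in> F" for j using bspec[OF m(2) that] trans[of x m j] 2 by blast
      then show ?thesis by blast
    qed
  qed simp
qed

text \<open>
  For a point \<open>x\<close> inside no interval: the intervals on the left of \<open>x\<close> have total length at most \<open>x\<close>,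
  those on the right at most \<open>1 - x\<close>, and together they have length \<open>1\<close>, so both bounds are sharp.
\<close>

lemma position_coord:
  assumes x: "x \<in> {0..1}"
  shows "position (\<lambda>k. coord k x) = x"
proof (cases "\<exists>k\<in>K. 0 < coord k x \<and> coord k x < 1")
  case True
  then obtain k where k: "k \<in> K" "0 < coord k x" "coord k x < 1" by blast
  then have "base k < x" "x < base k + len k" using coord_pos_iff[OF k(1), of x] coord_less_1_iff[OF k(1), of x] by simp_all
  then show ?thesis using position_split(3)[OF cut_coord k] coord_eq(3)[OF k(1), of x] by simp
next
  case False
  define S where "S = {k \<in> K. coord k x = 1}"
  have zero: "coord k x = 0" if "k \<in> K - S" for k
  proof -
    have "\<not> (0 < coord k x \<and> coord k x < 1)" "coord k x \<noteq> 1" using False that by (simp_all add: S_def)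
    then show ?thesis using coord_range[of k x] by linarith
  qed
  have SK: "S \<subseteq> K" "K - S \<subseteq> K" by (auto simp: S_def)
  have eq: "position (\<lambda>k. coord k x) = infsum len S"
    unfolding position_def
  proof (rule infsum_cong_neutral)
    show "k \<in> S - K \<Longrightarrow> len k = 0" for k using SK by blast
    show "k \<in> K - S \<Longrightarrow> len k * coord k x = 0" for k using zero[of k] by simp
    show "k \<in> K \<inter> S \<Longrightarrow> len k * coord k x = len k" for k by (simp add: S_def)
  qed
  have "infsum len S \<le> x"
  proof (rule infsum_le_bound[OF SK(1)])
    fix F assume F: "finite F" "F \<subseteq> S" "F \<noteq> {}"
    then obtain m where m: "m \<in> F" "\<forall>j\<in>F. j = m \<or> prec j m" using finite_extreme(1)[of F] SK by blast
    have mK: "m \<in> K" "coord m x = 1" using m(1) F(2) by (auto simp: S_def)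
    have "sum len F = infsum len F" using F(1) by simp
    also have "\<dots> \<le> infsum len (below m \<union> {m})"
      by (rule infsum_len_mono) (use m(2) F(2) SK mK(1) in \<open>unfold below_def, blast+\<close>)
    also have "\<dots> \<le> x" unfolding base_plus_len[OF mK(1), symmetric]
      using coord_less_1_iff[OF mK(1), of x] mK(2) by simp
    finally show "sum len F \<le> x" .
  qed (use x in simp)
  moreover have "infsum len (K - S) \<le> 1 - x"
  proof (rule infsum_le_bound[OF SK(2)])
    fix F assume F: "finite F" "F \<subseteq> K - S" "F \<noteq> {}"
    then obtain m where m: "m \<in> F" "\<forall>j\<in>F. j = m \<or> prec m j" using finite_extreme(2)[of F] SK by blast
    have mK: "m \<in> K" "coord m x = 0" using m(1) F(2) zero[of m] by blast+
    have "j \<notin> below m" if "j \<in> F" for j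
      using bspec[OF m(2) that] irrefl[of m] trans[of m j m] by (auto simp: below_def)
    then have disj: "F \<inter> below m = {}" by blast
    have "base m + sum len F = infsum len (below m \<union> F)"
      unfolding base_def using F disj SK by (subst infsum_len_union) (auto simp: below_def)
    also have "\<dots> \<le> infsum len K" by (rule infsum_len_mono) (use F SK in \<open>auto simp: below_def\<close>)
    also have "\<dots> = 1" by (rule len_total)
    finally have "sum len F \<le> 1 - base m" by simp
    moreover have "x \<le> base m" using coord_pos_iff[OF mK(1), of x] mK(2) by simp
    ultimately show "sum len F \<le> 1 - x" by linarith
  qed (use x in simp)
  moreover have "infsum len S + infsum len (K - S) = 1"
    using infsum_len_union[OF SK] len_total SK(1) by (simp add: Un_absorb1)
  ultimately show ?thesis using eq by linarith
qed

lemma interior_unique: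
  assumes "j \<in> K" "k \<in> K" "0 < coord j x" "coord j x < 1" "0 < coord k x" "coord k x < 1"
  shows "j = k"
proof (rule ccontr)
  assume "j \<noteq> k"
  then have "prec j k \<or> prec k j" using total assms(1,2) by blast
  then have "coord j x = 1 \<or> coord k x = 1" using cut_coord[of x] assms unfolding cut_def by blast
  with assms show False by auto
qed

end

text \<open>
  The intervals are permuted by \<open>\<pi>\<close>, and \<open>\<gamma> k\<close> is the map from interval \<open>k\<close> to its image with both
  rescaled to \<open>{0..1}\<close>. Thus \<open>\<Gamma> k\<close> is the derivative of the unscaled map.
\<close>

locale piecewise_map = ordered_lengths K prec len
  for K :: "'k set" and prec and len +
  fixes \<pi> :: "'k \<Rightarrow> 'k" and \<gamma> \<Gamma> :: "'k \<Rightarrow> real \<Rightarrow> real" and C \<alpha> :: real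
  assumes bij: "bij_betw \<pi> K K"
    and \<gamma>_ends: "\<And>k. k \<in> K \<Longrightarrow> \<gamma> k 0 = 0" "\<And>k. k \<in> K \<Longrightarrow> \<gamma> k 1 = 1"
    and \<gamma>_mono: "\<And>k u w. k \<in> K \<Longrightarrow> 0 \<le> u \<Longrightarrow> u \<le> w \<Longrightarrow> w \<le> 1 \<Longrightarrow> \<gamma> k u \<le> \<gamma> k w"
    and \<gamma>_cont: "\<And>k. k \<in> K \<Longrightarrow> continuous_on {0..1} (\<gamma> k)"
    and \<gamma>_deriv: "\<And>k u. k \<in> K \<Longrightarrow> 0 < u \<Longrightarrow> u < 1 \<Longrightarrow>
      (\<gamma> k has_real_derivative len k / len (\<pi> k) * \<Gamma> k u) (at u)"
    and \<Gamma>_ends: "\<And>k. k \<in> K \<Longrightarrow> \<Gamma> k 0 = 1" "\<And>k. k \<in> K \<Longrightarrow> \<Gamma> k 1 = 1"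
    and \<Gamma>_hoelder: "\<And>k u w. k \<in> K \<Longrightarrow> 0 \<le> u \<Longrightarrow> u \<le> w \<Longrightarrow> w \<le> 1 \<Longrightarrow>
      \<bar>\<Gamma> k u - \<Gamma> k w\<bar> \<le> C * (len k * (w - u)) powr \<alpha>"
    and prec_\<pi>: "\<And>j k. j \<in> K \<Longrightarrow> k \<in> K \<Longrightarrow> prec j k \<Longrightarrow> prec (\<pi> j) (\<pi> k)"
    and C: "0 \<le> C" and \<alpha>: "0 < \<alpha>"
begin

text \<open>
  At most one interval contains \<open>x\<close> in its interior, so the choice is unique. The value \<open>1\<close> elsewhere
  continues the values of \<open>\<Gamma>\<close> at the end points.
\<close>

definition glued_deriv :: "real \<Rightarrow> real" where
  "glued_deriv x = (if \<exists>k\<in>K. 0 < coord k x \<and> coord k x < 1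
     then (let k = (SOME k. k \<in> K \<and> 0 < coord k x \<and> coord k x < 1) in \<Gamma> k (coord k x)) else 1)"

lemma glued_deriv_inside:
  assumes k: "k \<in> K" "0 < coord k x" "coord k x < 1"
  shows "glued_deriv x = \<Gamma> k (coord k x)"
proof -
  have "(SOME k. k \<in> K \<and> 0 < coord k x \<and> coord k x < 1) = k"
    by (rule some_equality) (use k interior_unique in blast)+
  then show ?thesis using k by (auto simp: glued_deriv_def)
qed

lemma glued_deriv_outside:
  assumes "\<And>k. k \<in> K \<Longrightarrow> \<not> (0 < coord k x \<and> coord k x < 1)"
  shows "glued_deriv x = 1"
  using assms by (auto simp: glued_deriv_def)

lemma coord_inside:
  assumes "k \<in> K" "0 < coord k x" "coord k x < 1"
  shows "base k < x" "x < base k + len k" "base k + len k * coord k x = x"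
  using assms coord_pos_iff[of k x] coord_less_1_iff[of k x] coord_eq(3)[of k x] by simp_all

lemma hoelder_mono: "0 \<le> s \<Longrightarrow> s \<le> t \<Longrightarrow> C * s powr \<alpha> \<le> C * t powr \<alpha>"
  by (intro mult_left_mono powr_mono2 C) (use \<alpha> in auto)

text \<open>
  Inside one interval this is the assumption. Between points of different intervals one passes
  through the value \<open>1\<close> at end points of the intervals that lie between them.
\<close>

lemma glued_deriv_hoelder_le:
  assumes xy: "x \<le> y"
  shows "\<bar>glued_deriv x - glued_deriv y\<bar> \<le> 2 * C * (y - x) powr \<alpha>"
proof -
  let ?in = "\<lambda>k x. k \<in> K \<and> 0 < coord k x \<and> coord k x < 1"
  have nonneg: "0 \<le> C * (y - x) powr \<alpha>" using C by simp
  have left: "\<bar>glued_deriv x - 1\<bar> \<le> C * (y - x) powr \<alpha>" if not: "\<And>k. ?in k x \<Longrightarrow> \<not> ?in k y"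
  proof (cases "\<exists>k. ?in k x")
    case True
    then obtain k where k: "?in k x" by blast
    then have kK: "k \<in> K" by simp
    note ci = coord_inside[of k x]
    have "0 < coord k y" using k coord_mono[OF kK xy] by linarith
    then have "\<not> y < base k + len k" using not[OF k] kK coord_less_1_iff[OF kK, of y] by simp
    moreover have "len k * (1 - coord k x) = base k + len k - x"
      using ci(3) k by (simp add: algebra_simps)
    ultimately have le: "len k * (1 - coord k x) \<le> y - x" by linarith
    have "\<bar>\<Gamma> k (coord k x) - \<Gamma> k 1\<bar> \<le> C * (len k * (1 - coord k x)) powr \<alpha>"
      using k by (intro \<Gamma>_hoelder) simp_all
    also have "\<dots> \<le> C * (y - x) powr \<alpha>"
      by (rule hoelder_mono[OF _ le]) (use k len_nonneg in simp)
    finally show ?thesis using glued_deriv_inside[of k x] k \<Gamma>_ends(2)[OF kK] by simp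
  next
    case False
    then have "glued_deriv x = 1" by (intro glued_deriv_outside) blast
    then show ?thesis using nonneg by simp
  qed
  have right: "\<bar>1 - glued_deriv y\<bar> \<le> C * (y - x) powr \<alpha>" if not: "\<And>k. ?in k y \<Longrightarrow> \<not> ?in k x"
  proof (cases "\<exists>k. ?in k y")
    case True
    then obtain k where k: "?in k y" by blast
    then have kK: "k \<in> K" by simp
    note ci = coord_inside[of k y]
    have "coord k x < 1" using k coord_mono[OF kK xy] by linarith
    then have "\<not> base k < x" using not[OF k] kK coord_pos_iff[OF kK, of x] by simp
    moreover have "len k * (coord k y - 0) = y - base k"
      using ci(3) k by (simp add: algebra_simps)
    ultimately have le: "len k * (coord k y - 0) \<le> y - x" by linarith
    have "\<bar>\<Gamma> k 0 - \<Gamma> k (coord k y)\<bar> \<le> C * (len k * (coord k y - 0)) powr \<alpha>"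
      using k by (intro \<Gamma>_hoelder) simp_all
    also have "\<dots> \<le> C * (y - x) powr \<alpha>"
      by (rule hoelder_mono[OF _ le]) (use k len_nonneg in simp)
    finally show ?thesis using glued_deriv_inside[of k y] k \<Gamma>_ends(1)[OF kK] by simp
  next
    case False
    then have "glued_deriv y = 1" by (intro glued_deriv_outside) blast
    then show ?thesis using nonneg by simp
  qed
  show ?thesis
  proof (cases "\<exists>k. ?in k x \<and> ?in k y")
    case True
    then obtain k where k: "?in k x" "?in k y" by blast
    then have kK: "k \<in> K" by simp
    have "len k * (coord k y - coord k x) = y - x"
      using coord_inside(3)[of k x] coord_inside(3)[of k y] k by (simp add: algebra_simps)
    moreover have "\<bar>\<Gamma> k (coord k x) - \<Gamma> k (coord k y)\<bar> \<le> C * (len k * (coord k y - coord k x)) powr \<alpha>"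
      using k coord_mono[OF kK xy] by (intro \<Gamma>_hoelder) simp_all
    ultimately show ?thesis
      using glued_deriv_inside[of k x] glued_deriv_inside[of k y] k nonneg by simp
  next
    case False
    then have "\<bar>glued_deriv x - 1\<bar> \<le> C * (y - x) powr \<alpha>" "\<bar>1 - glued_deriv y\<bar> \<le> C * (y - x) powr \<alpha>"
      by (intro left right; blast)+
    then show ?thesis by linarith
  qed
qed

lemma glued_deriv_hoelder: "\<bar>glued_deriv x - glued_deriv y\<bar> \<le> 2 * C * \<bar>x - y\<bar> powr \<alpha>"
proof (cases "x \<le> y")
  case True
  then show ?thesis using glued_deriv_hoelder_le[OF True] by simp
next
  case False
  then show ?thesis using glued_deriv_hoelder_le[of y x] by (simp add: abs_minus_commute)
qed

lemma \<gamma>_range: "k \<in> K \<Longrightarrow> 0 \<le> u \<Longrightarrow> u \<le> 1 \<Longrightarrow> 0 \<le> \<gamma> k u \<and> \<gamma> k u \<le> 1"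
  using \<gamma>_mono[of k 0 u] \<gamma>_mono[of k u 1] \<gamma>_ends[of k] by simp

lemma glued_summable: "(\<lambda>k. len (\<pi> k) * \<gamma> k (coord k x)) summable_on K"
proof (rule summable_on_comparison_test)
  show "(\<lambda>k. len (\<pi> k)) summable_on K"
    using summable_on_reindex_bij_betw[OF bij, of len] len_summable by simp
  fix k assume k: "k \<in> K"
  then have "\<pi> k \<in> K" using bij by (auto simp: bij_betw_def)
  then show "len (\<pi> k) * \<gamma> k (coord k x) \<le> len (\<pi> k)" "0 \<le> len (\<pi> k) * \<gamma> k (coord k x)"
    using \<gamma>_range[OF k coord_range] len_nonneg[of "\<pi> k"] by (simp_all add: mult_left_le)
qed

lemma piece_increment:
  assumes k: "k \<in> K" and lt: "coord k p < coord k q"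
  shows "\<exists>z. p < z \<and> z < q \<and>
    len (\<pi> k) * (\<gamma> k (coord k q) - \<gamma> k (coord k p)) = glued_deriv z * (len k * (coord k q - coord k p))"
proof -
  let ?d = "\<lambda>u. len k / len (\<pi> k) * \<Gamma> k u"
  have c: "continuous_on {coord k p..coord k q} (\<gamma> k)"
    by (rule continuous_on_subset[OF \<gamma>_cont[OF k]]) (use coord_range in auto)
  have d: "(\<gamma> k has_derivative (*) (?d u)) (at u)" if "coord k p < u" "u < coord k q" for u
    using \<gamma>_deriv[OF k, of u] that coord_range(1)[of k p] coord_range(2)[of k q]
    by (simp add: has_field_derivative_def)
  obtain \<xi> where \<xi>: "coord k p < \<xi>" "\<xi> < coord k q"
    "\<gamma> k (coord k q) - \<gamma> k (coord k p) = ?d \<xi> * (coord k q - coord k p)"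
    by (rule mvt[OF lt c d]) (assumption, assumption, rule that)
  have \<xi>01: "0 < \<xi>" "\<xi> < 1" using \<xi>(1,2) coord_range(1)[of k p] coord_range(2)[of k q] by linarith+
  let ?z = "base k + len k * \<xi>"
  have z: "coord k ?z = \<xi>" using len_pos[OF k] \<xi>01 by (simp add: coord_def)
  have "p < ?z"
  proof (rule ccontr)
    assume "\<not> p < ?z"
    then have "coord k ?z \<le> coord k p" by (intro coord_mono[OF k]) simp
    with z \<xi>(1) show False by simp
  qed
  moreover have "?z < q"
  proof (rule ccontr)
    assume "\<not> ?z < q"
    then have "coord k q \<le> coord k ?z" by (intro coord_mono[OF k]) simp
    with z \<xi>(2) show False by simp
  qed
  moreover have "glued_deriv ?z = \<Gamma> k \<xi>" using glued_deriv_inside[OF k, of ?z] z \<xi>01 by simp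
  moreover have "len (\<pi> k) > 0" using bij k by (intro len_pos) (auto simp: bij_betw_def)
  ultimately show ?thesis unfolding \<xi>(3) by (intro exI[of _ ?z]) simp
qed

text \<open>
  Both \<open>q - p\<close> and the increment of the glued map are sums over the intervals, the latter with
  weights that are values of the derivative between \<open>p\<close> and \<open>q\<close>. So the Hoelder bound for the
  derivative controls the error, also at points outside all the intervals.
\<close>

lemma glued_increment:
  assumes pq: "0 \<le> p" "p < q" "q \<le> 1" and x: "p \<le> x" "x \<le> q"
  shows "\<bar>glued \<pi> \<gamma> q - glued \<pi> \<gamma> p - glued_deriv x * (q - p)\<bar> \<le> 2 * C * (q - p) powr \<alpha> * (q - p)"
proof -
  let ?M = "2 * C * (q - p) powr \<alpha>"
  let ?E = "\<lambda>k. len k * coord k q - len k * coord k p"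
  let ?D = "\<lambda>k. (len (\<pi> k) * \<gamma> k (coord k q) - len (\<pi> k) * \<gamma> k (coord k p)) - glued_deriv x * ?E k"
  have sum_x: "((\<lambda>k. len k * coord k y) has_sum y) K" if "y \<in> {0..1}" for y
  proof -
    have "((\<lambda>k. len k * coord k y) has_sum position (\<lambda>k. coord k y)) K"
      unfolding position_def by (rule has_sum_infsum[OF weighted_summable]) (simp add: coord_range)
    then show ?thesis by (simp add: position_coord[OF that])
  qed
  have sum_diff: "((\<lambda>k. f k - g k) has_sum (a - b)) K" if "(f has_sum a) K" "(g has_sum b) K"
    for f g :: "'k \<Rightarrow> real" and a b
    using has_sum_add[OF that(1) has_sum_uminusI[OF that(2)]] by simp
  have sum_E: "(?E has_sum (q - p)) K"
    by (intro sum_diff sum_x) (use pq in auto)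
  have sum_g: "((\<lambda>k. len (\<pi> k) * \<gamma> k (coord k y)) has_sum glued \<pi> \<gamma> y) K" for y
    unfolding glued_def by (rule has_sum_infsum[OF glued_summable])
  have sum_D: "(?D has_sum (glued \<pi> \<gamma> q - glued \<pi> \<gamma> p - glued_deriv x * (q - p))) K"
    by (intro sum_diff sum_g has_sum_cmult_right sum_E)
  have sum_ME: "((\<lambda>k. ?M * ?E k) has_sum ?M * (q - p)) K"
    by (intro has_sum_cmult_right sum_E)
  have bound: "\<bar>?D k\<bar> \<le> ?M * ?E k" if k: "k \<in> K" for k
  proof (cases "coord k p = coord k q")
    case False
    then have lt: "coord k p < coord k q" using coord_mono[OF k, of p q] pq by simp
    obtain z where z: "p < z" "z < q"
      "len (\<pi> k) * (\<gamma> k (coord k q) - \<gamma> k (coord k p)) = glued_deriv z * (len k * (coord k q - coord k p))"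
      using piece_increment[OF k lt] by (elim exE conjE) (rule that)
    have E0: "0 \<le> ?E k" using lt len_nonneg[OF k] by (simp add: mult_left_mono)
    have "?D k = (glued_deriv z - glued_deriv x) * ?E k"
      using z(3) by (simp add: algebra_simps)
    then have "\<bar>?D k\<bar> = \<bar>glued_deriv z - glued_deriv x\<bar> * ?E k" using E0 by (simp add: abs_mult)
    also have "\<dots> \<le> ?M * ?E k"
    proof (rule mult_right_mono[OF _ E0])
      have "\<bar>glued_deriv z - glued_deriv x\<bar> \<le> 2 * (C * \<bar>z - x\<bar> powr \<alpha>)"
        using glued_deriv_hoelder[of z x] by simp
      also have "\<dots> \<le> 2 * (C * (q - p) powr \<alpha>)"
        using hoelder_mono[of "\<bar>z - x\<bar>" "q - p"] z x by simp
      finally show "\<bar>glued_deriv z - glued_deriv x\<bar> \<le> ?M" by simp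
    qed
    finally show ?thesis .
  qed simp
  have "norm (glued \<pi> \<gamma> q - glued \<pi> \<gamma> p - glued_deriv x * (q - p)) \<le> ?M * (q - p)"
    by (rule norm_infsum_le[OF sum_D sum_ME]) (simp only: real_norm_def bound)
  then show ?thesis by (simp only: real_norm_def)
qed

theorem glued_has_derivative:
  assumes x: "x \<in> {0..1}"
  shows "(glued \<pi> \<gamma> has_real_derivative glued_deriv x) (at x within {0..1})"
proof -
  have "((\<lambda>y. (glued \<pi> \<gamma> y - glued \<pi> \<gamma> x) / (y - x) - glued_deriv x) \<longlongrightarrow> 0) (at x within {0..1})"
  proof (rule Lim_null_comparison)
    show "\<forall>\<^sub>F y in at x within {0..1}. norm ((glued \<pi> \<gamma> y - glued \<pi> \<gamma> x) / (y - x) - glued_deriv x) \<le> 2 * C * \<bar>y - x\<bar> powr \<alpha>"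
      unfolding eventually_at_filter
    proof (rule always_eventually, intro allI impI)
      fix y :: real assume y: "y \<noteq> x" "y \<in> {0..1}"
      define p q where "p = min x y" and "q = max x y"
      have pq: "0 \<le> p" "p < q" "q \<le> 1" "p \<le> x" "x \<le> q" "q - p = \<bar>y - x\<bar>"
        using x y by (auto simp: p_def q_def)
      have "\<bar>glued \<pi> \<gamma> y - glued \<pi> \<gamma> x - glued_deriv x * (y - x)\<bar> = \<bar>glued \<pi> \<gamma> q - glued \<pi> \<gamma> p - glued_deriv x * (q - p)\<bar>"
      proof (cases "x < y")
        case True
        then show ?thesis by (simp add: p_def q_def)
      next
        case False
        then have "p = y" "q = x" using y by (simp_all add: p_def q_def)
        then show ?thesis by (simp add: algebra_simps abs_minus_commute)
      qed
      also have "\<dots> \<le> 2 * C * \<bar>y - x\<bar> powr \<alpha> * \<bar>y - x\<bar>"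
        using glued_increment[OF pq(1-5)] unfolding pq(6) .
      finally have le: "\<bar>glued \<pi> \<gamma> y - glued \<pi> \<gamma> x - glued_deriv x * (y - x)\<bar> \<le> 2 * C * \<bar>y - x\<bar> powr \<alpha> * \<bar>y - x\<bar>" .
      have "(glued \<pi> \<gamma> y - glued \<pi> \<gamma> x) / (y - x) - glued_deriv x = (glued \<pi> \<gamma> y - glued \<pi> \<gamma> x - glued_deriv x * (y - x)) / (y - x)"
        using y by (simp add: diff_divide_distrib)
      then have "norm ((glued \<pi> \<gamma> y - glued \<pi> \<gamma> x) / (y - x) - glued_deriv x) =
          \<bar>glued \<pi> \<gamma> y - glued \<pi> \<gamma> x - glued_deriv x * (y - x)\<bar> / \<bar>y - x\<bar>" by simp
      also have "\<dots> \<le> 2 * C * \<bar>y - x\<bar> powr \<alpha>"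
        using le y by (simp add: divide_le_eq)
      finally show "norm ((glued \<pi> \<gamma> y - glued \<pi> \<gamma> x) / (y - x) - glued_deriv x) \<le> 2 * C * \<bar>y - x\<bar> powr \<alpha>" .
    qed
    have "((\<lambda>y. \<bar>y - x\<bar>) \<longlongrightarrow> \<bar>x - x\<bar>) (at x within {0..1})" by (intro tendsto_intros)
    then have "((\<lambda>y. \<bar>y - x\<bar> powr \<alpha>) \<longlongrightarrow> 0) (at x within {0..1})"
      by (intro tendsto_zero_powrI[where b = \<alpha>]) (use \<alpha> in simp_all)
    then show "((\<lambda>y. 2 * C * \<bar>y - x\<bar> powr \<alpha>) \<longlongrightarrow> 0) (at x within {0..1})"
      by (rule tendsto_mult_right_zero)
  qed
  then show ?thesis unfolding has_field_derivative_iff by (rule LIM_zero_cancel)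
qed

lemma continuous_on_glued_deriv: "continuous_on S glued_deriv"
  unfolding continuous_on_def
proof
  fix x assume "x \<in> S"
  have "((\<lambda>y. glued_deriv y - glued_deriv x) \<longlongrightarrow> 0) (at x within S)"
  proof (rule Lim_null_comparison)
    show "\<forall>\<^sub>F y in at x within S. norm (glued_deriv y - glued_deriv x) \<le> 2 * C * \<bar>y - x\<bar> powr \<alpha>"
      by (rule always_eventually) (simp only: real_norm_def glued_deriv_hoelder simp_thms)
    have "((\<lambda>y. \<bar>y - x\<bar>) \<longlongrightarrow> \<bar>x - x\<bar>) (at x within S)" by (intro tendsto_intros)
    then have "((\<lambda>y. \<bar>y - x\<bar> powr \<alpha>) \<longlongrightarrow> 0) (at x within S)"
      by (intro tendsto_zero_powrI[where b = \<alpha>]) (use \<alpha> in simp_all)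
    then show "((\<lambda>y. 2 * C * \<bar>y - x\<bar> powr \<alpha>) \<longlongrightarrow> 0) (at x within S)"
      by (rule tendsto_mult_right_zero)
  qed
  then show "(glued_deriv \<longlongrightarrow> glued_deriv x) (at x within S)" by (rule LIM_zero_cancel)
qed

lemma \<pi>_in: "k \<in> K \<Longrightarrow> \<pi> k \<in> K"
  using bij by (auto simp: bij_betw_def)

text \<open>
  The image of a point is described by the proportions \<open>\<gamma> k (coord k x)\<close> at the places \<open>\<pi> k\<close>, and
  these form a cut again because \<open>\<pi>\<close> preserves the order.
\<close>

lemma coord_glued:
  shows "glued \<pi> \<gamma> x \<in> {0..1}" "k \<in> K \<Longrightarrow> coord (\<pi> k) (glued \<pi> \<gamma> x) = \<gamma> k (coord k x)"
proof -
  let ?i = "inv_into K \<pi>"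
  define v where "v = (\<lambda>j. \<gamma> (?i j) (coord (?i j) x))"
  have i: "?i j \<in> K" "\<pi> (?i j) = j" if "j \<in> K" for j
    using bij that by (simp_all add: bij_betw_def inv_into_into f_inv_into_f)
  have v_\<pi>: "v (\<pi> k) = \<gamma> k (coord k x)" if "k \<in> K" for k
    using bij that by (simp add: v_def bij_betw_def inv_into_f_f)
  have "cut v"
    unfolding cut_def
  proof (intro conjI ballI impI)
    fix j assume j: "j \<in> K"
    show "0 \<le> v j" "v j \<le> 1" using \<gamma>_range[OF i(1)[OF j] coord_range] by (simp_all add: v_def)
  next
    fix j k assume jk: "j \<in> K" "k \<in> K" "prec j k" "0 < v k"
    have "?i j = ?i k \<or> prec (?i j) (?i k) \<or> prec (?i k) (?i j)" by (rule total[OF i(1)[OF jk(1)] i(1)[OF jk(2)]])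
    moreover have "?i j \<noteq> ?i k" using i(2)[OF jk(1)] i(2)[OF jk(2)] jk(3) irrefl by metis
    moreover have "\<not> prec (?i k) (?i j)"
      using prec_\<pi>[OF i(1)[OF jk(2)] i(1)[OF jk(1)]] i(2)[OF jk(1)] i(2)[OF jk(2)] trans[OF jk(3), of j] irrefl[of j] jk(3)
      by auto
    ultimately have p: "prec (?i j) (?i k)" by blast
    have "coord (?i k) x \<noteq> 0" using jk(4) \<gamma>_ends(1)[OF i(1)[OF jk(2)]] by (auto simp: v_def)
    then have "0 < coord (?i k) x" using coord_range(1)[of "?i k" x] by simp
    then have "coord (?i j) x = 1" using cut_coord[of x] p i(1)[OF jk(1)] i(1)[OF jk(2)] unfolding cut_def by blast
    then show "v j = 1" using \<gamma>_ends(2)[OF i(1)[OF jk(1)]] by (simp add: v_def)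
  qed
  have "position v = infsum (\<lambda>k. len (\<pi> k) * v (\<pi> k)) K"
    unfolding position_def by (rule infsum_reindex_bij_betw[OF bij, symmetric])
  also have "\<dots> = glued \<pi> \<gamma> x"
    unfolding glued_def by (rule infsum_cong) (simp add: v_\<pi>)
  finally have g: "glued \<pi> \<gamma> x = position v" by simp
  show "glued \<pi> \<gamma> x \<in> {0..1}" unfolding g by (rule position_range[OF \<open>cut v\<close>])
  show "coord (\<pi> k) (glued \<pi> \<gamma> x) = \<gamma> k (coord k x)" if "k \<in> K"
    unfolding g coord_position[OF \<open>cut v\<close> \<pi>_in[OF that]] by (rule v_\<pi>[OF that])
qed

lemma glued_mono:
  assumes "x \<le> y"
  shows "glued \<pi> \<gamma> x \<le> glued \<pi> \<gamma> y"
  unfolding glued_def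
proof (rule infsum_mono[OF glued_summable glued_summable])
  fix k assume k: "k \<in> K"
  show "len (\<pi> k) * \<gamma> k (coord k x) \<le> len (\<pi> k) * \<gamma> k (coord k y)"
    by (intro mult_left_mono \<gamma>_mono k coord_range coord_mono assms len_nonneg \<pi>_in)
qed

end

section \<open>The lattice of intervals\<close>

definition grid :: "nat \<Rightarrow> (nat \<Rightarrow> int) set" where
  "grid n = PiE {1..n} (\<lambda>_. UNIV)"

definition lex_less :: "nat \<Rightarrow> (nat \<Rightarrow> int) \<Rightarrow> (nat \<Rightarrow> int) \<Rightarrow> bool" where
  "lex_less n j k \<longleftrightarrow> (\<exists>i\<in>{1..n}. j i < k i \<and> (\<forall>l\<in>{1..<i}. j l = k l))"

definition height :: "nat \<Rightarrow> (nat \<Rightarrow> int) \<Rightarrow> real" where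
  "height n k = 1 + (\<Sum>i=1..n. real_of_int \<bar>k i\<bar>)"

definition grid_shift :: "nat \<Rightarrow> (nat \<Rightarrow> int) \<Rightarrow> (nat \<Rightarrow> int) \<Rightarrow> nat \<Rightarrow> int" where
  "grid_shift n y k = restrict (\<lambda>i. k i + y i) {1..n}"

lemma grid_eqI: "j \<in> grid n \<Longrightarrow> k \<in> grid n \<Longrightarrow> (\<And>i. i \<in> {1..n} \<Longrightarrow> j i = k i) \<Longrightarrow> j = k"
  unfolding grid_def by (rule PiE_ext)

lemma lex_less_irrefl: "\<not> lex_less n k k"
  by (simp add: lex_less_def)

lemma lex_less_trans:
  assumes "lex_less n i j" "lex_less n j k"
  shows "lex_less n i k"
proof -
  obtain a where a: "a \<in> {1..n}" "i a < j a" "\<forall>l\<in>{1..<a}. i l = j l"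
    using assms(1) unfolding lex_less_def by blast
  obtain b where b: "b \<in> {1..n}" "j b < k b" "\<forall>l\<in>{1..<b}. j l = k l"
    using assms(2) unfolding lex_less_def by blast
  have "i (min a b) < k (min a b)"
  proof (cases a b rule: linorder_cases)
    case less
    then have "j a = k a" using a(1) b(3) by simp
    then show ?thesis using less a(2) by (simp add: min_def)
  next
    case equal
    then show ?thesis using a(2) b(2) by simp
  next
    case greater
    then have "i b = j b" using b(1) a(3) by simp
    then show ?thesis using greater b(2) by (simp add: min_def)
  qed
  moreover have "\<forall>l\<in>{1..<min a b}. i l = k l" using a(3) b(3) by simp
  moreover have "min a b \<in> {1..n}" using a(1) b(1) by (simp add: min_def)
  ultimately show ?thesis unfolding lex_less_def by blast
qed

lemma lex_less_total:
  assumes "j \<in> grid n" "k \<in> grid n"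
  shows "j = k \<or> lex_less n j k \<or> lex_less n k j"
proof (cases "j = k")
  case False
  then have ex: "\<exists>i. i \<in> {1..n} \<and> j i \<noteq> k i"
    using grid_eqI[OF assms] by blast
  define i where "i = (LEAST i. i \<in> {1..n} \<and> j i \<noteq> k i)"
  have i: "i \<in> {1..n} \<and> j i \<noteq> k i" unfolding i_def by (rule LeastI_ex[OF ex])
  have less: "j l = k l" if "l \<in> {1..<i}" for l
  proof -
    have "l < i" "l \<in> {1..n}" using that i by auto
    then show ?thesis using not_less_Least[of l "\<lambda>i. i \<in> {1..n} \<and> j i \<noteq> k i"] unfolding i_def by blast
  qed
  then have less': "k l = j l" if "l \<in> {1..<i}" for l using that by simp
  have "j i < k i \<or> k i < j i" using i by linarith
  then show ?thesis using i less less' unfolding lex_less_def by blast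
qed simp

lemma grid_shift_in: "grid_shift n y k \<in> grid n"
  by (simp add: grid_shift_def grid_def)

lemma grid_shift_apply: "i \<in> {1..n} \<Longrightarrow> grid_shift n y k i = k i + y i"
  by (simp add: grid_shift_def)

lemma grid_shift_add: "grid_shift n y (grid_shift n y' k) = grid_shift n (\<lambda>i. y i + y' i) k"
  by (rule grid_eqI[OF grid_shift_in grid_shift_in]) (simp add: grid_shift_apply)

lemma grid_shift_0: "k \<in> grid n \<Longrightarrow> grid_shift n (\<lambda>_. 0) k = k"
  by (rule grid_eqI[OF grid_shift_in]) (simp_all add: grid_shift_apply)

lemma bij_grid_shift: "bij_betw (grid_shift n y) (grid n) (grid n)"
proof (rule bij_betw_byWitness[where f' = "grid_shift n (\<lambda>i. - y i)"])
  show "\<forall>k\<in>grid n. grid_shift n (\<lambda>i. - y i) (grid_shift n y k) = k"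
    "\<forall>k\<in>grid n. grid_shift n y (grid_shift n (\<lambda>i. - y i) k) = k"
    by (simp_all add: grid_shift_add grid_shift_0)
qed (use grid_shift_in in blast)+

lemma lex_less_shift:
  assumes "lex_less n j k"
  shows "lex_less n (grid_shift n y j) (grid_shift n y k)"
proof -
  obtain a where a: "a \<in> {1..n}" "j a < k a" "\<forall>l\<in>{1..<a}. j l = k l"
    using assms unfolding lex_less_def by blast
  have "\<forall>l\<in>{1..<a}. grid_shift n y j l = grid_shift n y k l"
  proof
    fix l assume l: "l \<in> {1..<a}"
    then have "l \<in> {1..n}" using a(1) by auto
    then show "grid_shift n y j l = grid_shift n y k l" using a(3) l by (simp add: grid_shift_apply)
  qed
  moreover have "grid_shift n y j a < grid_shift n y k a" using a(2) by (simp add: grid_shift_apply[OF a(1)])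
  ultimately show ?thesis using a(1) unfolding lex_less_def by blast
qed

lemma height_ge_1: "1 \<le> height n k"
  unfolding height_def by (simp add: sum_nonneg)

lemma abs_coordinate_le_height: "i \<in> {1..n} \<Longrightarrow> 1 + real_of_int \<bar>k i\<bar> \<le> height n k"
  unfolding height_def using member_le_sum[of i "{1..n}" "\<lambda>i. real_of_int \<bar>k i\<bar>"] by simp

lemma height_shift:
  "\<bar>height n (grid_shift n y k) - height n k\<bar> \<le> (\<Sum>i=1..n. real_of_int \<bar>y i\<bar>)"
proof -
  have "height n (grid_shift n y k) - height n k = (\<Sum>i=1..n. real_of_int (\<bar>k i + y i\<bar> - \<bar>k i\<bar>))"
  proof -
    have "(\<Sum>i=1..n. real_of_int \<bar>grid_shift n y k i\<bar>) = (\<Sum>i=1..n. real_of_int \<bar>k i + y i\<bar>)"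
      by (rule sum.cong) (simp_all only: grid_shift_apply)
    then show ?thesis unfolding height_def by (simp only: of_int_diff sum_subtractf)
  qed
  also have "\<bar>\<dots>\<bar> \<le> (\<Sum>i=1..n. \<bar>real_of_int (\<bar>k i + y i\<bar> - \<bar>k i\<bar>)\<bar>)" by (rule sum_abs)
  also have "\<dots> \<le> (\<Sum>i=1..n. real_of_int \<bar>y i\<bar>)" by (rule sum_mono) linarith
  finally show ?thesis .
qed

lemma summable_on_int_powr:
  assumes q: "1 < q"
  shows "(\<lambda>j::int. (1 + real_of_int \<bar>j\<bar>) powr (- q)) summable_on UNIV"
proof -
  let ?f = "\<lambda>j::int. (1 + real_of_int \<bar>j\<bar>) powr (- q)"
  have "summable (\<lambda>m. real m powr (- q))" using q by (simp add: summable_real_powr_iff)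
  then have "summable (\<lambda>m. real (Suc m) powr (- q))"
    using summable_Suc_iff[of "\<lambda>m. real m powr (- q)"] by simp
  then have nat: "(\<lambda>m::nat. (1 + real m) powr (- q)) summable_on UNIV"
    by (subst summable_on_UNIV_nonneg_real_iff) (simp_all add: add.commute)
  have 1: "?f summable_on range int"
    by (subst summable_on_reindex) (use nat in \<open>simp_all add: o_def\<close>)
  have 2: "?f summable_on range (\<lambda>m. - int m)"
    by (subst summable_on_reindex) (use nat in \<open>simp_all add: o_def inj_def\<close>)
  have "(UNIV :: int set) = range int \<union> (range (\<lambda>m. - int m) - range int)"
  proof -
    have "j \<in> range int \<or> j \<in> range (\<lambda>m. - int m)" for j
      by (cases j rule: int_cases2) auto
    then show ?thesis by auto
  qed
  moreover have "?f summable_on (range int \<union> (range (\<lambda>m. - int m) - range int))"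
    by (intro summable_on_Un_disjoint 1 summable_on_subset_banach[OF 2]) auto
  ultimately show ?thesis by simp
qed

text \<open>
  Each factor \<open>1 + \<bar>k i\<bar>\<close> is at most the height, so the summand is dominated by a product of \<open>n\<close>
  one-dimensional summands with exponent \<open>p / n > 1\<close>.
\<close>

lemma height_summable:
  assumes n: "n \<ge> 1" and p: "real n < p"
  shows "(\<lambda>k. height n k powr (- p)) summable_on grid n"
proof -
  define q where "q = p / real n"
  have q: "1 < q" "p = real n * q" using n p by (simp_all add: q_def field_simps)
  let ?f = "\<lambda>j::int. (1 + real_of_int \<bar>j\<bar>) powr (- q)"
  have "infsum (\<lambda>k. \<Prod>i=1..n. ?f (k i)) (grid n) = (\<Prod>i=1..n. infsum ?f UNIV)"
    unfolding grid_def
    by (rule infsum_prod_PiE_abs) (use summable_on_int_powr[OF q(1)] in simp_all)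
  moreover have "infsum ?f UNIV > 0"
  proof -
    have "infsum ?f {0} \<le> infsum ?f UNIV"
      by (rule infsum_mono2) (use summable_on_int_powr[OF q(1)] in simp_all)
    then show ?thesis by simp
  qed
  (* A nonzero value of infsum implies summability, since infsum is 0 otherwise. *)
  ultimately have "infsum (\<lambda>k. \<Prod>i=1..n. ?f (k i)) (grid n) \<noteq> 0" by (simp add: prod_pos)
  then have sum: "(\<lambda>k. \<Prod>i=1..n. ?f (k i)) summable_on grid n"
    using infsum_not_exists by blast
  show ?thesis
  proof (rule summable_on_comparison_test[OF sum])
    fix k :: "nat \<Rightarrow> int"
    have "height n k powr (- p) = (height n k powr (- q)) ^ n"
      using height_ge_1[of n k] by (simp add: powr_power q(2) mult.commute)
    also have "\<dots> = (\<Prod>i=1..n. height n k powr (- q))" by simp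
    also have "\<dots> \<le> (\<Prod>i=1..n. ?f (k i))"
      by (rule prod_mono) (use abs_coordinate_le_height q(1) in \<open>auto intro!: powr_mono2'\<close>)
    finally show "height n k powr (- p) \<le> (\<Prod>i=1..n. ?f (k i))" .
  qed simp
qed

lemma powr_sub_1_le:
  fixes s S q :: real
  assumes s: "0 < s" "s \<le> S" and S: "1 \<le> S" and q: "1 \<le> q"
  shows "\<bar>s powr q - 1\<bar> \<le> q * S powr q * \<bar>s - 1\<bar>"
proof -
  have aux: "\<bar>v powr q - u powr q\<bar> \<le> q * S powr q * (v - u)" if uv: "0 < u" "u < v" "v \<le> S" for u v
  proof -
    obtain z where z: "u < z" "z < v" "v powr q - u powr q = (v - u) * (q * z powr (q - 1))"
      using MVT2[OF uv(2), of "\<lambda>x. x powr q" "\<lambda>x. q * x powr (q - 1)"] has_real_derivative_powr uv(1) by auto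
    have "z powr (q - 1) \<le> S powr (q - 1)" using z uv q by (intro powr_mono2) auto
    also have "\<dots> \<le> S powr q" using S by (intro powr_mono) auto
    finally have "(v - u) * (q * z powr (q - 1)) \<le> (v - u) * (q * S powr q)"
      using uv q by (intro mult_left_mono) auto
    moreover have "0 \<le> (v - u) * (q * z powr (q - 1))" using uv q by simp
    ultimately show ?thesis unfolding z(3) by (simp add: mult_ac)
  qed
  consider "s < 1" | "s = 1" | "1 < s" by linarith
  then show ?thesis
  proof cases
    case 1
    then show ?thesis using aux[of s 1] s S by (simp add: abs_minus_commute)
  next
    case 3
    then show ?thesis using aux[of 1 s] s S by simp
  qed simp
qed

section \<open>Heisenberg actions below the critical regularity\<close>

locale heisenberg_model = profile r c \<Psi> for r c \<Psi> +
  fixes n :: nat and p :: real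
  assumes n: "1 \<le> n" and p: "real n < p" and r_eq: "r = (2 * p + 1) / (2 * p + 2)"
begin

lemma p_gt_1: "1 < p"
  using n p by linarith

definition total_length :: real where
  "total_length = infsum (\<lambda>k. height n k powr (- p)) (grid n)"

definition len :: "(nat \<Rightarrow> int) \<Rightarrow> real" where
  "len k = height n k powr (- p) / total_length"

text \<open>
  Interval \<open>k\<close> has length of order \<open>height n k powr (- p)\<close> and time scale \<open>height n k powr (p + 1)\<close>.
  The decay exponent of the density of \<open>\<Psi>\<close> is chosen such that near the ends of the intervals the
  density of length with respect to time is the same on all of them; hence the derivatives of the
  maps between them tend to \<open>1\<close> at the end points.
\<close>

definition duration :: "(nat \<Rightarrow> int) \<Rightarrow> real" where
  "duration k = height n k powr (p + 1)"

lemma total_length_pos: "0 < total_length"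
proof -
  let ?k = "restrict (\<lambda>_. 0) {1..n} :: nat \<Rightarrow> int"
  have "?k \<in> grid n" by (simp add: grid_def)
  then have "infsum (\<lambda>k. height n k powr (- p)) {?k} \<le> total_length"
    unfolding total_length_def
    by (intro infsum_mono2) (use height_summable[OF n p] in \<open>simp_all del: restrict_apply\<close>)
  moreover have "infsum (\<lambda>k. height n k powr (- p)) {?k} = height n ?k powr (- p)" by simp
  moreover have "0 < height n ?k powr (- p)" using height_ge_1[of n ?k] by simp
  ultimately show ?thesis by linarith
qed

lemma duration_pos: "0 < duration k"
  unfolding duration_def using height_ge_1[of n k] by simp

sublocale ordered_lengths "grid n" "lex_less n" len
proof
  show "len summable_on grid n"
    unfolding len_def divide_inverse by (rule summable_on_cmult_left[OF height_summable[OF n p]])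
  have "infsum len (grid n) = total_length * inverse total_length"
    unfolding len_def divide_inverse total_length_def by (rule infsum_cmult_left')
  then show "infsum len (grid n) = 1" using total_length_pos by simp
  show "0 < len k" for k using height_ge_1[of n k] total_length_pos by (simp add: len_def)
qed (use lex_less_irrefl lex_less_trans lex_less_total in blast)+

definition time_shift :: "(nat \<Rightarrow> int) \<Rightarrow> int \<Rightarrow> (nat \<Rightarrow> int) \<Rightarrow> real" where
  "time_shift x z k = real_of_int (z + (\<Sum>i=1..n. x i * k i))"

definition fibre_map :: "(nat \<Rightarrow> int) \<Rightarrow> (nat \<Rightarrow> int) \<Rightarrow> int \<Rightarrow> (nat \<Rightarrow> int) \<Rightarrow> real \<Rightarrow> real" where
  "fibre_map x y z k = shift_map (duration k) (duration (grid_shift n y k)) (time_shift x z k)"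

definition fibre_density :: "(nat \<Rightarrow> int) \<Rightarrow> (nat \<Rightarrow> int) \<Rightarrow> int \<Rightarrow> (nat \<Rightarrow> int) \<Rightarrow> real \<Rightarrow> real" where
  "fibre_density x y z k =
    density (duration (grid_shift n y k) / duration k) (time_shift x z k / duration k)"

text \<open>
  The element \<open>(x, y, z)\<close> acts on pairs of a lattice point and a time by sending \<open>(k, t)\<close> to
  \<open>(k + y, t + z + (\<Sum>i=1..n. x i * k i))\<close>. Composing two such maps reproduces the multiplication
  of Heisenberg matrices.
\<close>

definition act :: "(nat \<Rightarrow> int) \<Rightarrow> (nat \<Rightarrow> int) \<Rightarrow> int \<Rightarrow> real \<Rightarrow> real" where
  "act x y z = glued (grid_shift n y) (fibre_map x y z)"

lemma len_ratio: "len k / len k' = (duration k' / duration k) powr (2 * r - 1)"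
proof -
  have h: "0 < height n k" "0 < height n k'" using height_ge_1[of n k] height_ge_1[of n k'] by linarith+
  have "2 * r - 1 = p / (p + 1)" using p_gt_1 by (simp add: r_eq field_simps)
  then have e: "(p + 1) * (2 * r - 1) = p" using p_gt_1 by simp
  have "(duration k' / duration k) powr (2 * r - 1) = ((height n k' / height n k) powr (p + 1)) powr (2 * r - 1)"
    using h by (simp add: duration_def powr_divide)
  also have "\<dots> = (height n k' / height n k) powr p" unfolding powr_powr e ..
  also have "\<dots> = len k / len k'"
    using h total_length_pos by (simp add: len_def powr_divide powr_minus_divide)
  finally show ?thesis ..
qed

text \<open>
  A group element changes the height \<open>N\<close> by a bounded amount, so it changes the time scale by a factor
  \<open>1 + O(1 / N)\<close>. It shifts time by \<open>O(N)\<close>, and relative to the time scale, which is at least \<open>N\<^sup>2\<close>,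
  this is \<open>O(1 / N)\<close> as well.
\<close>

lemma fibre_density_lipschitz:
  "\<exists>B\<ge>0. \<forall>k u w. 0 \<le> u \<longrightarrow> u \<le> w \<longrightarrow> w \<le> 1 \<longrightarrow>
    \<bar>fibre_density x y z k u - fibre_density x y z k w\<bar> \<le> B * (1 / height n k) * (w - u)"
proof -
  define a where "a = 1 + (\<Sum>i=1..n. real_of_int \<bar>y i\<bar>)"
  define X where "X = real_of_int \<bar>z\<bar> + (\<Sum>i=1..n. real_of_int \<bar>x i\<bar>)"
  (* One constant that dominates the ratio of the time scales, its deviation from 1 and the time shift. *)
  define A where "A = (p + 1) * a powr (p + 1) * a + X + 1"
  have a: "1 \<le> a" by (simp add: a_def sum_nonneg)
  have X: "0 \<le> X" by (simp add: X_def sum_nonneg)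
  have ap: "1 \<le> a powr (p + 1)" using a p_gt_1 by (simp add: ge_one_powr_ge_zero)
  have apA: "a powr (p + 1) \<le> A"
  proof -
    have "1 * a powr (p + 1) * 1 \<le> (p + 1) * a powr (p + 1) * a"
      using a p_gt_1 ap by (intro mult_mono) auto
    then show ?thesis using X by (simp add: A_def)
  qed
  have A1: "1 \<le> A" using ap apA by linarith
  have "\<bar>fibre_density x y z k u - fibre_density x y z k w\<bar> \<le> distortion_bound A / c * (1 / height n k) * (w - u)"
    if u: "0 \<le> u" "u \<le> w" "w \<le> 1" for k u w
    unfolding fibre_density_def
  proof (rule density_lipschitz[OF A1 _ _ _ _ _ _ u])
    let ?k' = "grid_shift n y k"
    let ?N = "height n k" and ?N' = "height n ?k'"
    let ?s = "?N' / ?N"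
    have N: "1 \<le> ?N" "1 \<le> ?N'" by (rule height_ge_1)+
    show "0 \<le> 1 / ?N" "1 / ?N \<le> 1" using N by simp_all
    have d: "\<bar>?N' - ?N\<bar> \<le> a - 1" using height_shift[of n y k] by (simp add: a_def)
    have s_le: "?s \<le> a"
    proof -
      have "?N' \<le> ?N + (a - 1)" using d by linarith
      also have "\<dots> \<le> ?N + (a - 1) * ?N" using a N mult_left_mono[of 1 ?N "a - 1"] by simp
      finally show ?thesis using N by (simp add: divide_le_eq algebra_simps)
    qed
    have s_ge: "1 / a \<le> ?s"
    proof -
      have "?N \<le> ?N' + (a - 1)" using d by linarith
      also have "\<dots> \<le> ?N' + (a - 1) * ?N'" using a N mult_left_mono[of 1 ?N' "a - 1"] by simp
      finally have "?N \<le> a * ?N'" by (simp add: algebra_simps)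
      then show ?thesis using N a by (simp add: field_simps)
    qed
    have s0: "0 < ?s" using N by simp
    have \<tau>: "duration ?k' / duration k = ?s powr (p + 1)" using N by (simp add: duration_def powr_divide)
    show "duration ?k' / duration k \<le> A"
    proof -
      have "?s powr (p + 1) \<le> a powr (p + 1)" using s0 s_le p_gt_1 by (intro powr_mono2) auto
      then show ?thesis unfolding \<tau> using apA by linarith
    qed
    show "1 / A \<le> duration ?k' / duration k"
    proof -
      have "1 / A \<le> 1 / a powr (p + 1)" using apA ap A1 by (intro divide_left_mono mult_pos_pos) linarith+
      also have "\<dots> = (1 / a) powr (p + 1)" using a by (simp add: powr_divide)
      also have "\<dots> \<le> ?s powr (p + 1)" using s_ge a p_gt_1 by (intro powr_mono2) auto
      finally show ?thesis unfolding \<tau> .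
    qed
    show "\<bar>duration ?k' / duration k - 1\<bar> \<le> A * (1 / ?N)"
    proof -
      have "\<bar>?s - 1\<bar> = \<bar>?N' - ?N\<bar> / ?N" using N by (simp add: field_simps)
      also have "\<dots> \<le> a / ?N" using d N by (intro divide_right_mono) auto
      finally have s1: "\<bar>?s - 1\<bar> \<le> a / ?N" .
      have "\<bar>?s powr (p + 1) - 1\<bar> \<le> (p + 1) * a powr (p + 1) * \<bar>?s - 1\<bar>"
        using p_gt_1 by (intro powr_sub_1_le s0 s_le a) simp
      also have "\<dots> \<le> (p + 1) * a powr (p + 1) * (a / ?N)"
        using s1 p_gt_1 by (intro mult_left_mono) auto
      also have "\<dots> = (p + 1) * a powr (p + 1) * a * (1 / ?N)" by simp
      also have "\<dots> \<le> A * (1 / ?N)" using X N by (intro mult_right_mono) (auto simp: A_def)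
      finally show ?thesis unfolding \<tau> .
    qed
    show "\<bar>time_shift x z k / duration k\<bar> \<le> A * (1 / ?N)"
    proof -
      have k_le: "real_of_int \<bar>k i\<bar> \<le> ?N" if "i \<in> {1..n}" for i
        using abs_coordinate_le_height[OF that, of k] by simp
      have "\<bar>time_shift x z k\<bar> \<le> real_of_int \<bar>z\<bar> + (\<Sum>i=1..n. \<bar>real_of_int (x i * k i)\<bar>)"
        unfolding time_shift_def of_int_add of_int_sum
        by (rule order_trans[OF abs_triangle_ineq add_mono[OF _ sum_abs]]) simp
      also have "\<dots> \<le> real_of_int \<bar>z\<bar> * ?N + (\<Sum>i=1..n. real_of_int \<bar>x i\<bar> * ?N)"
      proof (rule add_mono)
        show "real_of_int \<bar>z\<bar> \<le> real_of_int \<bar>z\<bar> * ?N"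
          using N mult_left_mono[of 1 ?N "real_of_int \<bar>z\<bar>"] by simp
        show "(\<Sum>i=1..n. \<bar>real_of_int (x i * k i)\<bar>) \<le> (\<Sum>i=1..n. real_of_int \<bar>x i\<bar> * ?N)"
        proof (rule sum_mono)
          fix i assume "i \<in> {1..n}"
          then have "real_of_int \<bar>x i\<bar> * real_of_int \<bar>k i\<bar> \<le> real_of_int \<bar>x i\<bar> * ?N"
            by (intro mult_left_mono k_le) simp_all
          then show "\<bar>real_of_int (x i * k i)\<bar> \<le> real_of_int \<bar>x i\<bar> * ?N" by (simp add: abs_mult)
        qed
      qed
      also have "\<dots> = X * ?N" by (simp add: X_def sum_distrib_right distrib_right)
      finally have t: "\<bar>time_shift x z k\<bar> \<le> X * ?N" .
      have NN: "?N * ?N \<le> duration k"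
      proof -
        have "?N powr 2 \<le> ?N powr (p + 1)" using N p_gt_1 by (intro powr_mono) auto
        then show ?thesis using N by (simp add: duration_def power2_eq_square)
      qed
      have "\<bar>time_shift x z k / duration k\<bar> = \<bar>time_shift x z k\<bar> / duration k"
        using duration_pos[of k] by (simp add: abs_divide)
      also have "\<dots> \<le> X * ?N / (?N * ?N)"
        using t NN N X by (intro frac_le) auto
      also have "\<dots> = X * (1 / ?N)" using N by simp
      also have "\<dots> \<le> A * (1 / ?N)" using N a p_gt_1 by (intro mult_right_mono) (auto simp: A_def)
      finally show ?thesis .
    qed
  qed
  moreover have "0 \<le> distortion_bound A / c" using A1 c by (simp add: distortion_bound_def)
  ultimately show ?thesis by (intro exI[of _ "distortion_bound A / c"]) simp
qed

text \<open>
  The relative error \<open>1 / height n k\<close> is a constant multiple of \<open>len k powr (1 / p)\<close>, which is what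
  Hoelder continuity with exponent \<open>1 / p\<close> asks for.
\<close>

lemma piecewise: "\<exists>C. piecewise_map (grid n) (lex_less n) len (grid_shift n y)
  (fibre_map x y z) (fibre_density x y z) C (1 / p)"
proof -
  obtain B where B: "0 \<le> B" "\<forall>k u w. 0 \<le> u \<longrightarrow> u \<le> w \<longrightarrow> w \<le> 1 \<longrightarrow>
    \<bar>fibre_density x y z k u - fibre_density x y z k w\<bar> \<le> B * (1 / height n k) * (w - u)"
    using fibre_density_lipschitz[where x = x and y = y and z = z] by (elim exE conjE) (rule that)
  define C where "C = B * total_length powr (1 / p)"
  have p0: "0 < 1 / p" using p_gt_1 by simp
  have "piecewise_map (grid n) (lex_less n) len (grid_shift n y)
    (fibre_map x y z) (fibre_density x y z) C (1 / p)"
  proof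
    show "bij_betw (grid_shift n y) (grid n) (grid n)" by (rule bij_grid_shift)
    show "fibre_map x y z k 0 = 0" "fibre_map x y z k 1 = 1" for k
      unfolding fibre_map_def by (rule shift_map_outside; simp)+
    show "fibre_map x y z k u \<le> fibre_map x y z k w" if "u \<le> w" for k u w
      unfolding fibre_map_def by (rule shift_map_mono[OF duration_pos duration_pos that])
    show "continuous_on {0..1} (fibre_map x y z k)" for k
      unfolding fibre_map_def
      by (rule continuous_on_subset[OF shift_map_continuous[OF duration_pos duration_pos]]) simp
    show "(fibre_map x y z k has_real_derivative
        len k / len (grid_shift n y k) * fibre_density x y z k u) (at u)"
      if "0 < u" "u < 1" for k u
      unfolding fibre_map_def fibre_density_def len_ratio
      by (rule shift_map_deriv[OF duration_pos duration_pos that])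
    show "fibre_density x y z k 0 = 1" "fibre_density x y z k 1 = 1" for k
      by (simp_all add: fibre_density_def density_def)
    show "\<bar>fibre_density x y z k u - fibre_density x y z k w\<bar> \<le> C * (len k * (w - u)) powr (1 / p)"
      if u: "0 \<le> u" "u \<le> w" "w \<le> 1" for k u w
    proof -
      have N: "1 \<le> height n k" by (rule height_ge_1)
      have "len k powr (1 / p) = (height n k powr (- p)) powr (1 / p) / total_length powr (1 / p)"
        unfolding len_def by (rule powr_divide)
      also have "(height n k powr (- p)) powr (1 / p) = 1 / height n k"
      proof -
        have "- p * (1 / p) = - 1" using p_gt_1 by simp
        then have "(height n k powr (- p)) powr (1 / p) = height n k powr (- 1)" by (simp only: powr_powr)
        then show ?thesis using N by (simp add: powr_minus_divide)
      qed
      finally have lp: "total_length powr (1 / p) * len k powr (1 / p) = 1 / height n k"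
        using total_length_pos by simp
      have le1: "w - u \<le> (w - u) powr (1 / p)"
      proof -
        have "(w - u) powr 1 \<le> (w - u) powr (1 / p)" using u p_gt_1 by (intro powr_mono') auto
        then show ?thesis using u by simp
      qed
      have "\<bar>fibre_density x y z k u - fibre_density x y z k w\<bar> \<le> B * (1 / height n k) * (w - u)"
        using B(2)[THEN spec[of _ k], THEN spec[of _ u], THEN spec[of _ w], THEN mp, THEN mp, THEN mp, OF u] .
      also have "\<dots> \<le> B * (1 / height n k) * (w - u) powr (1 / p)"
        using le1 B(1) N by (intro mult_left_mono) auto
      also have "\<dots> = C * (len k powr (1 / p) * (w - u) powr (1 / p))"
        unfolding C_def lp[symmetric] by (simp add: mult_ac)
      also have "len k powr (1 / p) * (w - u) powr (1 / p) = (len k * (w - u)) powr (1 / p)"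
        by (rule powr_mult[symmetric])
      finally show ?thesis .
    qed
    show "lex_less n (grid_shift n y j) (grid_shift n y k)" if "lex_less n j k" for j k
      by (rule lex_less_shift[OF that])
    show "0 \<le> C" using B(1) by (simp add: C_def)
    show "0 < 1 / p" by (rule p0)
  qed
  then show ?thesis by (rule exI)
qed

lemma
  shows act_range: "act x y z t \<in> {0..1}"
    and coord_act: "k \<in> grid n \<Longrightarrow> coord (grid_shift n y k) (act x y z t) = fibre_map x y z k (coord k t)"
    and act_mono: "s \<le> t \<Longrightarrow> act x y z s \<le> act x y z t"
    and act_smooth: "\<exists>D C. (\<forall>t\<in>{0..1}. (act x y z has_real_derivative D t) (at t within {0..1})) \<and>
      continuous_on {0..1} D \<and> (\<forall>s t. \<bar>D s - D t\<bar> \<le> C * \<bar>s - t\<bar> powr (1 / p))"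
proof -
  obtain C where "piecewise_map (grid n) (lex_less n) len (grid_shift n y)
    (fibre_map x y z) (fibre_density x y z) C (1 / p)"
    using piecewise[where x = x and y = y and z = z] by (elim exE) (rule that)
  then interpret P: piecewise_map "grid n" "lex_less n" len "grid_shift n y"
    "fibre_map x y z" "fibre_density x y z" C "1 / p" .
  show "act x y z t \<in> {0..1}" unfolding act_def by (rule P.coord_glued(1))
  show "coord (grid_shift n y k) (act x y z t) = fibre_map x y z k (coord k t)" if "k \<in> grid n"
    unfolding act_def by (rule P.coord_glued(2)[OF that])
  show "act x y z s \<le> act x y z t" if "s \<le> t" unfolding act_def by (rule P.glued_mono[OF that])
  show "\<exists>D C. (\<forall>t\<in>{0..1}. (act x y z has_real_derivative D t) (at t within {0..1})) \<and>
      continuous_on {0..1} D \<and> (\<forall>s t. \<bar>D s - D t\<bar> \<le> C * \<bar>s - t\<bar> powr (1 / p))"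
    unfolding act_def
    by (intro exI[of _ P.glued_deriv] exI[of _ "2 * C"] conjI ballI allI P.glued_has_derivative
        P.continuous_on_glued_deriv P.glued_deriv_hoelder)
qed

lemma act_comp:
  "act x y z (act x' y' z' t) = act (\<lambda>i. x i + x' i) (\<lambda>i. y i + y' i) (z + z' + (\<Sum>i=1..n. x i * y' i)) t"
proof -
  let ?\<pi> = "grid_shift n y" and ?\<pi>' = "grid_shift n y'"
  let ?\<pi>'' = "grid_shift n (\<lambda>i. y i + y' i)"
  let ?z = "z + z' + (\<Sum>i=1..n. x i * y' i)"
  have fibre: "fibre_map x y z (?\<pi>' k) (fibre_map x' y' z' k u) =
      fibre_map (\<lambda>i. x i + x' i) (\<lambda>i. y i + y' i) ?z k u" for k u
  proof -
    have "(\<Sum>i=1..n. x i * ?\<pi>' k i) = (\<Sum>i=1..n. x i * k i) + (\<Sum>i=1..n. x i * y' i)"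
      unfolding sum.distrib[symmetric] by (rule sum.cong) (simp_all only: grid_shift_apply distrib_left)
    then have "time_shift x' z' k + time_shift x z (?\<pi>' k) = time_shift (\<lambda>i. x i + x' i) ?z k"
      by (simp add: time_shift_def distrib_right sum.distrib)
    then show ?thesis
      unfolding fibre_map_def shift_map_comp[OF duration_pos] grid_shift_add by simp
  qed
  have "act x y z (act x' y' z' t) = infsum (\<lambda>k. len (?\<pi> k) * fibre_map x y z k (coord k (act x' y' z' t))) (grid n)"
    unfolding act_def[of x y z] glued_def ..
  also have "\<dots> = infsum (\<lambda>k. len (?\<pi> (?\<pi>' k)) * fibre_map x y z (?\<pi>' k) (coord (?\<pi>' k) (act x' y' z' t))) (grid n)"
    by (rule infsum_reindex_bij_betw[OF bij_grid_shift, symmetric])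
  also have "\<dots> = infsum (\<lambda>k. len (?\<pi>'' k) * fibre_map (\<lambda>i. x i + x' i) (\<lambda>i. y i + y' i) ?z k (coord k t)) (grid n)"
    by (rule infsum_cong) (simp only: coord_act fibre grid_shift_add)
  also have "\<dots> = act (\<lambda>i. x i + x' i) (\<lambda>i. y i + y' i) ?z t" unfolding act_def glued_def ..
  finally show ?thesis .
qed

lemma act_ident:
  assumes t: "t \<in> {0..1}"
  shows "act (\<lambda>_. 0) (\<lambda>_. 0) 0 t = t"
proof -
  have "act (\<lambda>_. 0) (\<lambda>_. 0) 0 t = position (\<lambda>k. coord k t)"
    unfolding act_def glued_def position_def
    by (rule infsum_cong)
      (simp add: fibre_map_def time_shift_def grid_shift_0 shift_map_id[OF duration_pos])
  then show ?thesis by (simp only: position_coord[OF t])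
qed

lemma act_cong:
  assumes "\<And>i. i \<in> {1..n} \<Longrightarrow> x i = x' i" "\<And>i. i \<in> {1..n} \<Longrightarrow> y i = y' i"
  shows "act x y z = act x' y' z"
proof -
  have 1: "grid_shift n y = grid_shift n y'"
    unfolding grid_shift_def using assms(2) by (intro ext restrict_ext) simp
  have "(\<Sum>i=1..n. x i * k i) = (\<Sum>i=1..n. x' i * k i)" for k
    by (rule sum.cong) (simp_all only: assms(1))
  then have "fibre_map x y z = fibre_map x' y' z"
    by (intro ext) (simp add: fibre_map_def time_shift_def 1)
  with 1 show ?thesis by (simp add: act_def)
qed

text \<open>
  A point in the interior of an interval remembers its interval and its time, so the action
  determines \<open>k + y\<close> and \<open>z + (\<Sum>i=1..n. x i * k i)\<close> for every \<open>k\<close>. The vectors \<open>0\<close> and the unit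
  vectors then suffice.
\<close>

lemma act_faithful:
  assumes eq: "\<And>t. t \<in> {0..1} \<Longrightarrow> act x y z t = act x' y' z' t"
  shows "(\<forall>i\<in>{1..n}. x i = x' i \<and> y i = y' i) \<and> z = z'"
proof -
  have key: "grid_shift n y k = grid_shift n y' k \<and> time_shift x z k = time_shift x' z' k"
    if k: "k \<in> grid n" for k
  proof -
    (* The point of interval k at time 0. *)
    define t where "t = base k + len k * \<Psi> 0"
    have ct: "coord k t = \<Psi> 0"
      using len_pos[OF k] \<Psi>_range[of 0] by (simp add: t_def coord_def)
    have "0 \<le> t" using base_nonneg[of k] len_nonneg[OF k] \<Psi>_range(1)[of 0] by (simp add: t_def)
    moreover have "t \<le> 1"
      using base_plus_len_le_1[OF k] mult_left_mono[OF less_imp_le[OF \<Psi>_range(2)[of 0]] len_nonneg[OF k]]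
      by (simp add: t_def)
    ultimately have "act x y z t = act x' y' z' t" by (intro eq) simp
    then have c': "coord (grid_shift n y' k) (act x y z t) = fibre_map x' y' z' k (\<Psi> 0)"
      using coord_act[OF k, of y' x' z' t] ct by simp
    have c: "coord (grid_shift n y k) (act x y z t) = fibre_map x y z k (\<Psi> 0)"
      using coord_act[OF k, of y x z t] ct by simp
    have in01: "0 < fibre_map x y z k (\<Psi> 0) \<and> fibre_map x y z k (\<Psi> 0) < 1"
      "0 < fibre_map x' y' z' k (\<Psi> 0) \<and> fibre_map x' y' z' k (\<Psi> 0) < 1"
      unfolding fibre_map_def by (rule shift_map_inside[OF \<Psi>_range])+
    have same: "grid_shift n y k = grid_shift n y' k"
      by (rule interior_unique[OF grid_shift_in grid_shift_in, of _ _ "act x y z t"])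
        (use in01 c c' in simp_all)
    then have "fibre_map x y z k (\<Psi> 0) = fibre_map x' y' z' k (\<Psi> 0)" using c c' by simp
    then have "\<Psi> ((duration k * 0 + time_shift x z k) / duration (grid_shift n y' k)) =
        \<Psi> ((duration k * 0 + time_shift x' z' k) / duration (grid_shift n y' k))"
      unfolding fibre_map_def shift_map_def same using \<Psi>_range by (simp add: time_\<Psi>)
    then have "time_shift x z k = time_shift x' z' k"
      using duration_pos[of "grid_shift n y' k"] by (simp add: \<Psi>_eq_iff)
    with same show ?thesis by blast
  qed
  define O0 where "O0 = (restrict (\<lambda>_. 0) {1..n} :: nat \<Rightarrow> int)"
  have O0: "O0 \<in> grid n" by (simp add: O0_def grid_def)
  have "(\<Sum>i=1..n. x i * O0 i) = 0" for x by (rule sum.neutral) (simp add: O0_def)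
  then have z: "z = z'" using key[OF O0] by (simp add: time_shift_def)
  have "x i = x' i \<and> y i = y' i" if i: "i \<in> {1..n}" for i
  proof
    have "grid_shift n y O0 i = grid_shift n y' O0 i" using key[OF O0] by simp
    then show "y i = y' i" using i by (simp add: grid_shift_apply)
    define e where "e = (restrict (\<lambda>j. if j = i then 1 else 0) {1..n} :: nat \<Rightarrow> int)"
    have e: "e \<in> grid n" by (simp add: e_def grid_def)
    have "(\<Sum>j=1..n. x j * e j) = (\<Sum>j=1..n. if j = i then x j else 0)" for x :: "nat \<Rightarrow> int"
      by (rule sum.cong) (simp_all add: e_def)
    then have "(\<Sum>j=1..n. x j * e j) = x i" for x :: "nat \<Rightarrow> int" using i by simp
    then show "x i = x' i" using key[OF e] z by (simp add: time_shift_def)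
  qed
  with z show ?thesis by blast
qed

end

lemma C01_1I:
  assumes D: "\<forall>t\<in>{0..1}. (f has_real_derivative D t) (at t within {0..1})" and c: "continuous_on {0..1} D"
  shows "C01 1 f" "\<forall>t\<in>{0..1}. deriv01 1 f t = D t"
proof -
  show eq: "\<forall>t\<in>{0..1}. deriv01 1 f t = D t"
  proof
    fix t :: real assume t: "t \<in> {0..1}"
    have "(f has_vector_derivative D t) (at t within {0..1})"
      using bspec[OF D t] by (simp add: has_real_derivative_iff_has_vector_derivative)
    then show "deriv01 1 f t = D t"
      unfolding One_nat_def deriv01_Suc deriv01_0
      by (intro vector_derivative_within_closed_interval) (use t in simp_all)
  qed
  have "f differentiable_on {0..1}"
    unfolding differentiable_on_def
  proof
    fix t :: real assume t: "t \<in> {0..1}"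
    show "f differentiable (at t within {0..1})"
      using bspec[OF D t] unfolding has_field_derivative_def by (rule differentiableI)
  qed
  moreover have "continuous_on {0..1} (deriv01 1 f)"
    using continuous_on_cong[OF refl, of "{0..1}" "deriv01 1 f" D] eq c by blast
  ultimately show "C01 1 f" by (simp add: C01_def)
qed

context heisenberg_model
begin

lemma act_inverse:
  assumes t: "t \<in> {0..1}"
  shows "act (\<lambda>i. - x i) (\<lambda>i. - y i) (- z + (\<Sum>i=1..n. x i * y i)) (act x y z t) = t"
    "act x y z (act (\<lambda>i. - x i) (\<lambda>i. - y i) (- z + (\<Sum>i=1..n. x i * y i)) t) = t"
  by (simp_all add: act_comp act_ident[OF t] sum_negf)

definition diffeo :: "(nat \<Rightarrow> int) \<Rightarrow> (nat \<Rightarrow> int) \<Rightarrow> int \<Rightarrow> real \<Rightarrow> real" where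
  "diffeo x y z = restrict (act x y z) {0..1}"

lemma diffeo_Diff01: "diffeo x y z \<in> Diff01 1 (1 / p)"
proof -
  let ?a = "act x y z"
  let ?b = "act (\<lambda>i. - x i) (\<lambda>i. - y i) (- z + (\<Sum>i=1..n. x i * y i))"
  have bij: "bij_betw ?a {0..1} {0..1}"
  proof (rule bij_betw_byWitness[where f' = ?b])
    show "\<forall>t\<in>{0..1}. ?b (?a t) = t" "\<forall>t\<in>{0..1}. ?a (?b t) = t" using act_inverse by blast+
  qed (use act_range in blast)+
  then have bij_d: "bij_betw (diffeo x y z) {0..1} {0..1}"
    by (rule bij_betw_cong[THEN iffD1, rotated]) (simp add: diffeo_def)
  have B: "diffeo x y z \<in> Bij {0..1}"
    using bij_d by (simp add: Bij_def diffeo_def)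
  have inj: "inj_on ?a {0..1}" using bij by (rule bij_betw_imp_inj_on)
  have mono: "strict_mono_on {0..1} (diffeo x y z)"
  proof (rule strict_mono_onI)
    fix s t :: real assume st: "s \<in> {0..1}" "t \<in> {0..1}" "s < t"
    have "?a s \<noteq> ?a t" using inj_onD[OF inj _ st(1,2)] st(3) by blast
    with act_mono[of s t] st show "diffeo x y z s < diffeo x y z t" by (simp add: diffeo_def less_le)
  qed
  have C: "C01 1 f" if f: "\<And>t. t \<in> {0..1} \<Longrightarrow> f t = act x' y' z' t" for f x' y' z'
  proof -
    obtain D where D: "\<forall>t\<in>{0..1}. (act x' y' z' has_real_derivative D t) (at t within {0..1})"
      "continuous_on {0..1} D"
      using act_smooth[where x = x' and y = y' and z = z'] by (elim exE conjE) (rule that)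
    have "\<forall>t\<in>{0..1}. (f has_real_derivative D t) (at t within {0..1})"
    proof
      fix t :: real assume t: "t \<in> {0..1}"
      show "(f has_real_derivative D t) (at t within {0..1})"
        by (rule has_field_derivative_transform_within[OF bspec[OF D(1) t] _ t, where d = 1])
          (simp_all only: f zero_less_one)
    qed
    then show ?thesis by (rule C01_1I(1)[OF _ D(2)])
  qed
  have inv: "inv_into {0..1} (diffeo x y z) t = ?b t" if t: "t \<in> {0..1}" for t
    by (rule inv_into_f_eq[OF bij_betw_imp_inj_on[OF bij_d] act_range])
      (use act_range act_inverse(2)[OF t] in \<open>simp add: diffeo_def del: atLeastAtMost_iff\<close>)
  have hoelder: "hoelder_on (1 / p) {0..1} (deriv01 1 (diffeo x y z))"
  proof -
    obtain D K where D: "\<forall>t\<in>{0..1}. (act x y z has_real_derivative D t) (at t within {0..1})"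
      "continuous_on {0..1} D" and K: "\<forall>s t. \<bar>D s - D t\<bar> \<le> K * \<bar>s - t\<bar> powr (1 / p)"
      using act_smooth[where x = x and y = y and z = z] by (elim exE conjE) (rule that)
    have "\<forall>t\<in>{0..1}. (diffeo x y z has_real_derivative D t) (at t within {0..1})"
    proof
      fix t :: real assume t: "t \<in> {0..1}"
      show "(diffeo x y z has_real_derivative D t) (at t within {0..1})"
        by (rule has_field_derivative_transform_within[OF bspec[OF D(1) t] _ t, where d = 1])
          (simp_all add: diffeo_def)
    qed
    from C01_1I(2)[OF this D(2)] K show ?thesis unfolding hoelder_on_def by (intro exI[of _ K]) simp
  qed
  show ?thesis
    unfolding Diff01_def
    using B mono C[of "diffeo x y z" x y z] C[OF inv] hoelder by (simp add: diffeo_def)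
qed

lemma model_embeds: "embeds (heisenberg_group n) (Diff01_group 1 (1 / p))"
proof -
  define h where "h = (\<lambda>M :: int mat. diffeo (\<lambda>j. M $$ (0, j)) (\<lambda>i. M $$ (i, n + 1)) (M $$ (0, n + 1)))"
  have h: "h (heisenberg_mat n x y z) = diffeo x y z" for x y z
  proof -
    have "act (\<lambda>j. heisenberg_mat n x y z $$ (0, j)) (\<lambda>i. heisenberg_mat n x y z $$ (i, n + 1)) z = act x y z"
      by (rule act_cong) (auto simp: heisenberg_mat_def)
    moreover have "heisenberg_mat n x y z $$ (0, n + 1) = z" by (simp add: heisenberg_mat_def)
    ultimately show ?thesis by (simp only: h_def diffeo_def)
  qed
  have car: "\<exists>x y z. M = heisenberg_mat n x y z" if "M \<in> carrier (heisenberg_group n)" for M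
    using that by (auto simp: heisenberg_group_def)
  have "h \<in> hom (heisenberg_group n) (Diff01_group 1 (1 / p))"
  proof (rule homI)
    fix M assume "M \<in> carrier (heisenberg_group n)"
    then obtain x y z where "M = heisenberg_mat n x y z" using car by blast
    then show "h M \<in> carrier (Diff01_group 1 (1 / p))"
      using diffeo_Diff01 by (simp add: h Diff01_group_def)
  next
    fix M M' assume "M \<in> carrier (heisenberg_group n)" "M' \<in> carrier (heisenberg_group n)"
    then obtain x y z x' y' z' where M: "M = heisenberg_mat n x y z" "M' = heisenberg_mat n x' y' z'"
      using car by metis
    have B: "diffeo x y z \<in> Bij {0..1}" "diffeo x' y' z' \<in> Bij {0..1}"
      using diffeo_Diff01 by (simp_all add: Diff01_def)
    have "diffeo (\<lambda>i. x i + x' i) (\<lambda>i. y i + y' i) (z + z' + (\<Sum>i=1..n. x i * y' i)) =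
        compose {0..1} (diffeo x y z) (diffeo x' y' z')"
      using act_range by (auto simp: fun_eq_iff diffeo_def compose_def act_comp simp del: atLeastAtMost_iff)
    then show "h (M \<otimes>\<^bsub>heisenberg_group n\<^esub> M') = h M \<otimes>\<^bsub>Diff01_group 1 (1 / p)\<^esub> h M'"
      using B by (simp add: M heisenberg_group_def heisenberg_mat_mult h Diff01_group_def BijGroup_def)
  qed
  moreover have "inj_on h (carrier (heisenberg_group n))"
  proof (rule inj_onI)
    fix M M' assume "M \<in> carrier (heisenberg_group n)" "M' \<in> carrier (heisenberg_group n)" and eq: "h M = h M'"
    then obtain x y z x' y' z' where M: "M = heisenberg_mat n x y z" "M' = heisenberg_mat n x' y' z'"
      using car by metis
    have "act x y z t = act x' y' z' t" if "t \<in> {0..1}" for t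
      using fun_cong[OF eq, of t] that by (simp add: M h diffeo_def del: atLeastAtMost_iff)
    then have "(\<forall>i\<in>{1..n}. x i = x' i \<and> y i = y' i) \<and> z = z'" by (rule act_faithful)
    then show "M = M'" unfolding M by (intro eq_matI) (auto simp: heisenberg_mat_def)
  qed
  ultimately show ?thesis by (auto simp: embeds_def mon_def)
qed

end

lemma heisenberg_embeds:
  assumes n: "n \<ge> 1" and \<alpha>: "0 < \<alpha>" "\<alpha> < 1 / real n"
  shows "embeds (heisenberg_group n) (Diff01_group 1 \<alpha>)"
proof -
  define p where "p = 1 / \<alpha>"
  define r where "r = (2 * p + 1) / (2 * p + 2)"
  have p: "real n < p" using n \<alpha> by (simp add: p_def field_simps)
  then have "p > 0" by linarith
  then have r: "1 / 2 < r" "r \<le> 1" by (simp_all add: r_def field_simps)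
  obtain \<Psi> c where \<Psi>: "0 < c" "\<forall>v. (\<Psi> has_real_derivative c * (1 + v\<^sup>2) powr (- r)) (at v)"
    "\<forall>v. 0 < \<Psi> v \<and> \<Psi> v < 1" "\<forall>u. 0 < u \<and> u < 1 \<longrightarrow> (\<exists>v. \<Psi> v = u)"
    using profile_exists[OF r(1)] by (elim exE conjE) (rule that)
  interpret heisenberg_model r c \<Psi> n p
  proof
    show "1 / 2 < r" "r \<le> 1" "0 < c" "1 \<le> n" "real n < p" "r = (2 * p + 1) / (2 * p + 2)"
      by (rule r \<Psi> n p r_def)+
    show "(\<Psi> has_real_derivative c * (1 + v\<^sup>2) powr (- r)) (at v)" for v using \<Psi>(2) by (rule spec)
    show "0 < \<Psi> v" "\<Psi> v < 1" for v using \<Psi>(3) by simp_all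
    show "0 < u \<Longrightarrow> u < 1 \<Longrightarrow> \<exists>v. \<Psi> v = u" for u using \<Psi>(4) by simp
  qed
  show ?thesis using model_embeds by (simp add: p_def)
qed

section \<open>The critical regularity\<close>

theorem theoremB:
  fixes n :: nat
  assumes "n \<ge> 1"
  shows "critical_regularity (heisenberg_group n) = ereal (1 + 1 / real n)"
proof (rule antisym)
  show "critical_regularity (heisenberg_group n) \<le> ereal (1 + 1 / real n)"
    unfolding critical_regularity_def
  proof (rule Sup_least)
    fix s assume "s \<in> {ereal (real m + \<alpha>) | m \<alpha>. 0 \<le> \<alpha> \<and> \<alpha> < 1 \<and> embeds (heisenberg_group n) (Diff01_group m \<alpha>)}"
    then obtain m \<alpha> where s: "s = ereal (real m + \<alpha>)" "0 \<le> \<alpha>" "\<alpha> < 1"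
      "embeds (heisenberg_group n) (Diff01_group m \<alpha>)" by blast
    have "\<not> (m = 1 \<and> 1 / real n < \<alpha> \<and> \<alpha> < 1 \<or> m \<ge> 2)"
      using heisenberg_not_embeds[OF assms] s(4) by blast
    then consider "m = 0" | "m = 1" "\<alpha> \<le> 1 / real n" using s(3) by fastforce
    then have "real m + \<alpha> \<le> 1 + 1 / real n"
    proof cases
      case 1
      have "0 < 1 / real n" using assms by simp
      then have "\<alpha> \<le> 1 + 1 / real n" using s(3) by linarith
      then show ?thesis using 1 by simp
    qed simp
    then show "s \<le> ereal (1 + 1 / real n)" using s(1) by simp
  qed
next
  show "ereal (1 + 1 / real n) \<le> critical_regularity (heisenberg_group n)"
  proof (rule dense_le)
    fix w assume w: "w < ereal (1 + 1 / real n)"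
    have n0: "0 < 1 / real n" "1 / real n \<le> 1" using assms by simp_all
    show "w \<le> critical_regularity (heisenberg_group n)"
    proof -
      obtain \<alpha> where \<alpha>: "0 < \<alpha>" "\<alpha> < 1 / real n" "w \<le> ereal (1 + \<alpha>)"
      proof (cases w)
        case (real v)
        have "v < 1 + 1 / real n" using w unfolding real by (simp only: less_ereal.simps)
        then have "v - 1 < 1 / real n" by linarith
        moreover have "1 / (2 * real n) < 1 / real n" "0 < 1 / (2 * real n)" using assms by (simp_all add: field_simps)
        ultimately have *: "v - 1 < 1 / real n" "1 / (2 * real n) < 1 / real n" "0 < 1 / (2 * real n)" by blast+
        show ?thesis
        proof (cases "v - 1 \<le> 1 / (2 * real n)")
          case True
          then have "v \<le> 1 + 1 / (2 * real n)" by linarith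
          with * real show ?thesis by (intro that[of "1 / (2 * real n)"]) (simp_all only: ereal_less_eq)
        next
          case False
          with * have "0 < v - 1" by linarith
          moreover have "v \<le> 1 + (v - 1)" by simp
          ultimately show ?thesis using * real by (intro that[of "v - 1"]) (simp_all only: ereal_less_eq)
        qed
      next
        case PInf
        then show ?thesis using w by simp
      next
        case MInf
        have "1 / (2 * real n) < 1 / real n" "0 < 1 / (2 * real n)" using assms by (simp_all add: field_simps)
        then show ?thesis using MInf by (intro that[of "1 / (2 * real n)"]) (simp_all only: ereal_less_eq)
      qed
      have "embeds (heisenberg_group n) (Diff01_group 1 \<alpha>)" by (rule heisenberg_embeds[OF assms \<alpha>(1,2)])
      moreover have "\<alpha> < 1" using \<alpha>(2) n0(2) by linarith
      ultimately have "ereal (real 1 + \<alpha>) \<le> critical_regularity (heisenberg_group n)"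
        unfolding critical_regularity_def using \<alpha>(1) by (intro Sup_upper) (blast intro: less_imp_le)
      then show ?thesis using \<alpha>(3) by (simp add: order_trans)
    qed
  qed
qed

end
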